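(* Let $\zeta>0$, $1\le p\le\infty$ and $X=\ell^p(\mathbb{C}^3)$. Let $$A_0=\begin{pmatrix}0&1&0\\0&0&1\\-\zeta^3&-3\zeta^2&-3\zeta\end{pmatrix},\qquad A_1=\begin{pmatrix}0&-1&0\\0&0&0\\0&0&0\end{pmatrix},$$ and let $A\in\mathcal{B}(X)$ be given by $A(x_k)_{k\in\mathbb{Z}}=(A_0x_k+A_1x_{k-1})_{k\in\mathbb{Z}}$. For $x_0\in X$ let $x(t)=(x_k(t))_{k\in\mathbb{Z}}$, $t\ge0$, be the solution of $\dot x(t)=Ax(t)$, $t\ge0$, $x(0)=x_0$. Let $y_k(t)$ denote the first component of $x_k(t)\in\mathbb{C}^3$ and let $y_0=(y_k(0))_{k\in\mathbb{Z}}\in\ell^p(\mathbb{C})$. Let $S$ be the right shift on $\ell^p(\mathbb{C})$. Then the following hold. (a) The solution converges to a limit in the norm of $X$ as $t\to\infty$ if and only if there exists $c\in\mathbb{C}$ such that the constant sequence $y$ with entry $c$ is an element of $\ell^p(\mathbb{C})$ and $$\bigg\|\frac1n\sum_{j=1}^nS^jy_0-y\bigg\|_{\ell^p(\mathbb{C})}\to0,\qquad n\to\infty.\tag{$*$}$$ Moreover, if this is the case then $\|x(t)-z\|_X\to0$ as $t\to\infty$, where $z\in X$ is the constant sequence all of whose entries equal $(c,-\zeta c/3,0)^{\mathsf T}$. In particular, all initial vectors $x_0\in X$ lead to convergence if and only if $1<p<\infty$, and if $1\le p<\infty$ then the only possible candidate for $c$ is $0$. (b) If $y_0\in\ell^p(\mathbb{C})$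 is such that the convergence in $( * )$ holds with rate $O(n^{-1})$ as $n\to\infty$ (for some $y$ as in (a)), then, with $z$ as in (a), $\|x(t)-z\|_X=O(t^{-1/2})$ as $t\to\infty$. (c) For all $x_0\in X$ we have $\|\dot x(t)\|_X=O(t^{-1/2})$ as $t\to\infty$. Furthermore, the rates in (b) and (c) are optimal, in the sense that if in (b) or in (c) the rate $t^{-1/2}$ were replaced by $r(t)$ for some positive function $r$ with $r(t)=o(t^{-1/2})$ as $t\to\infty$, then the corresponding statement would become false.
   Context: For $m\in\mathbb{N}$, $\ell^p(\mathbb{C}^m)$ denotes the Banach space of doubly infinite sequences $x=(x_k)_{k\in\mathbb{Z}}$ with $x_k\in\mathbb{C}^m$ (Euclidean norm) and norm $\|x\|=(\sum_{k\in\mathbb{Z}}\|x_k\|^p)^{1/p}$ if $1\le p<\infty$, $\|x\|=\sup_{k\in\mathbb{Z}}\|x_k\|$ if $p=\infty$. $\mathcal{B}(X)$ is the space of bounded linear operators on $X$. The right shift is $S(y_k)=(y_{k-1})$. Since $A$ is bounded, the solution is $x(t)=e^{tA}x_0$. (Interpretation: in the platoon model, the three components of $x_k(t)$ are the discrepancy between target and actual separation of agents $k$ and $k-1$, the deviation of the velocity of agent $k$ from the target velocity, and the acceleration of agent $k$.) *)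

theory Defs
  imports "HOL-Analysis.Analysis" "HOL-Library.Landau_Symbols"
begin

(* The space l^p and its norm, for 1 \<le> p \<le> \<infinity>. The norm is only meaningful on members of
   the space: for other sequences the library's infinite sum and supremum take junk values. *)

definition lp_space :: "ereal \<Rightarrow> (int \<Rightarrow> 'a::real_normed_vector) set" where
  "lp_space p = (if p = \<infinity> then {x. bounded (range x)}
     else {x. (\<lambda>k. norm (x k) powr real_of_ereal p) summable_on UNIV})"

definition lp_norm :: "ereal \<Rightarrow> (int \<Rightarrow> 'a::real_normed_vector) \<Rightarrow> real" where
  "lp_norm p x = (if p = \<infinity> then (SUP k. norm (x k))
     else (\<Sum>\<^sub>\<infinity>k. norm (x k) powr real_of_ereal p) powr (1 / real_of_ereal p))"

definition lp_converges_to ::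
  "ereal \<Rightarrow> (real \<Rightarrow> int \<Rightarrow> 'a::real_normed_vector) \<Rightarrow> (int \<Rightarrow> 'a) \<Rightarrow> bool" where
  "lp_converges_to p x z \<longleftrightarrow> z \<in> lp_space p \<and>
     ((\<lambda>t. lp_norm p (\<lambda>k. x t k - z k)) \<longlongrightarrow> 0) at_top"

(* v is the derivative at t, in the norm of l^p, of the path x : [0,\<infinity>) \<rightarrow> l^p (one-sided at 0);
   the values of x at negative times are irrelevant. *)

definition has_lp_derivative ::
  "ereal \<Rightarrow> (real \<Rightarrow> int \<Rightarrow> 'a::real_normed_vector) \<Rightarrow> (int \<Rightarrow> 'a) \<Rightarrow> real \<Rightarrow> bool" where
  "has_lp_derivative p x v t \<longleftrightarrow> (\<forall>s\<ge>0. x s \<in> lp_space p) \<and> v \<in> lp_space p \<and>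
     ((\<lambda>s. lp_norm p (\<lambda>k. (1 / (s - t)) *\<^sub>R (x s k - x t k) - v k)) \<longlongrightarrow> 0) (at t within {0..})"

definition right_shift :: "(int \<Rightarrow> 'a) \<Rightarrow> int \<Rightarrow> 'a" where
  "right_shift y = (\<lambda>k. y (k - 1))"

definition cesaro_error :: "ereal \<Rightarrow> (int \<Rightarrow> complex) \<Rightarrow> complex \<Rightarrow> nat \<Rightarrow> real" where
  "cesaro_error p y c n =
     lp_norm p (\<lambda>k. (1 / of_nat n) * (\<Sum>j=1..n. (right_shift ^^ j) y k) - c)"

definition A0 :: "real \<Rightarrow> complex^3^3" where
  "A0 \<zeta> = vector [vector [0, 1, 0],
                   vector [0, 0, 1],
                   vector [- of_real (\<zeta>^3), - of_real (3 * \<zeta>^2), - of_real (3 * \<zeta>)]]"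

definition A1 :: "complex^3^3" where
  "A1 = vector [vector [0, -1, 0], vector [0, 0, 0], vector [0, 0, 0]]"

definition platoon_op :: "real \<Rightarrow> (int \<Rightarrow> complex^3) \<Rightarrow> int \<Rightarrow> complex^3" where
  "platoon_op \<zeta> x = (\<lambda>k. A0 \<zeta> *v x k + A1 *v x (k - 1))"

definition platoon_solution ::
  "ereal \<Rightarrow> real \<Rightarrow> (int \<Rightarrow> complex^3) \<Rightarrow> (real \<Rightarrow> int \<Rightarrow> complex^3) \<Rightarrow> bool" where
  "platoon_solution p \<zeta> x0 x \<longleftrightarrow> x 0 = x0 \<and>
     (\<forall>t\<ge>0. has_lp_derivative p x (platoon_op \<zeta> (x t)) t)"

definition first_comp :: "(int \<Rightarrow> complex^3) \<Rightarrow> int \<Rightarrow> complex" where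
  "first_comp x = (\<lambda>k. x k $ 1)"

definition platoon_limit :: "real \<Rightarrow> complex \<Rightarrow> int \<Rightarrow> complex^3" where
  "platoon_limit \<zeta> c = (\<lambda>k. vector [c, - of_real \<zeta> * c / 3, 0])"

(* The two rate statements with the rate r as a parameter, so that the optimality claims can
   refer to the same statements with a different rate. *)

definition convergence_rate :: "ereal \<Rightarrow> real \<Rightarrow> (real \<Rightarrow> real) \<Rightarrow> bool" where
  "convergence_rate p \<zeta> r \<longleftrightarrow>
     (\<forall>x0 x c. x0 \<in> lp_space p \<longrightarrow> platoon_solution p \<zeta> x0 x \<longrightarrow>
        (\<lambda>_. c) \<in> lp_space p \<longrightarrow>
        cesaro_error p (first_comp x0) c \<in> O(\<lambda>n. 1 / real n) \<longrightarrow>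
        (\<lambda>t. lp_norm p (\<lambda>k. x t k - platoon_limit \<zeta> c k)) \<in> O(r))"

definition derivative_rate :: "ereal \<Rightarrow> real \<Rightarrow> (real \<Rightarrow> real) \<Rightarrow> bool" where
  "derivative_rate p \<zeta> r \<longleftrightarrow>
     (\<forall>x0 x x'. x0 \<in> lp_space p \<longrightarrow> platoon_solution p \<zeta> x0 x \<longrightarrow>
        (\<forall>t\<ge>0. has_lp_derivative p x (x' t) t) \<longrightarrow>
        (\<lambda>t. lp_norm p (x' t)) \<in> O(r))"

end

theory Submission
  imports Defs
begin

text \<open>
  Write \<open>A\<close> for the generator and \<open>S\<close> for the right shift. The operator \<open>C = 1 + A / \<zeta>\<close>
  satisfies \<open>C\<^sup>3 = S\<close>, so it is power bounded on every \<open>\<ell>\<^sup>p\<close>, and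
  \<open>e\<^bsup>tA\<^esup> = e\<^bsup>\<zeta>t(C - 1)\<^esup>\<close> is the Poisson average of the powers of \<open>C\<close> with parameter
  \<open>\<tau> = \<zeta>t\<close>. Hence \<open>(C - 1) e\<^bsup>\<tau>(C - 1)\<^esup>\<close> is bounded by the \<open>\<ell>\<^sup>1\<close> norm of the differences of
  the Poisson weights, which is at most \<open>\<tau>\<^bsup>-1/2\<^esup>\<close> by the variance. This is (c), and it gives
  decay on the range of \<open>C - 1\<close>; the first component turns membership in that range into
  membership in the range of \<open>1 - S\<close>, which Cesaro means of \<open>S\<close> detect quantitatively. For
  optimality, truncated plane waves are approximate eigenvectors of \<open>C\<close> for the eigenvalues
  \<open>e\<^bsup>i\<theta>\<^esup>\<close>; with \<open>\<theta> = \<tau>\<^bsup>-1/2\<^esup>\<close> they give a matching lower bound for the operator norm, and a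
  gliding hump produces a single initial vector.\<close>

section \<open>The sequence spaces\<close>

text \<open>The sequence spaces stay sets of functions: each estimate is a \<open>lp_bound\<close>,
  limits and series are formed site by site, and a Fatou argument carries bounds to the limit. A
  series in powers of \<open>C\<close> has norm at most a constant times the l^1 norm of its
  coefficients, so operator estimates, differentiability of the semigroup included, become estimates
  for Poisson weights. What is available for every n is x - z = (C - 1) w + e, where
  \<open>e\<close> carries the n-th Cesaro mean of the first component and \<open>w\<close> depends
  on n; convergence therefore fixes n before t. In (b) the vectors \<open>w\<close> stay bounded as
  n grows, so n can be sent to infinity at fixed t. Optimality in (b) is deduced from optimality in
  (c): a derivative is itself an orbit that starts in the range of C - 1, and there the Cesaro means
  decay like 1/n with c = 0.\<close>

text \<open>Membership is bundled with the inequality because outside the space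
  \<open>lp_norm\<close> takes default values, so that a bound on it alone would carry no
  information.\<close>

definition lp_bound :: "ereal \<Rightarrow> (int \<Rightarrow> 'a::real_normed_vector) \<Rightarrow> real \<Rightarrow> bool" where
  "lp_bound p x B \<longleftrightarrow> x \<in> lp_space p \<and> lp_norm p x \<le> B"

lemma lp_norm_nonneg:
  assumes "x \<in> lp_space p" shows "0 \<le> lp_norm p x"
proof (cases "p = \<infinity>")
  case True
  then obtain K where "\<And>k. norm (x k) \<le> K" using assms by (auto simp: lp_space_def bounded_iff)
  then have "norm (x 0) \<le> (SUP k. norm (x k))" by (intro cSUP_upper) (auto intro!: bdd_aboveI2)
  then show ?thesis using True order_trans[OF norm_ge_zero] by (auto simp: lp_norm_def)
qed (simp add: lp_norm_def)

lemma lp_bound_infinity: "lp_bound \<infinity> x B \<longleftrightarrow> (\<forall>k. norm (x k) \<le> B)"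
proof
  assume "lp_bound \<infinity> x B"
  then have b: "bounded (range x)" and s: "(SUP k. norm (x k)) \<le> B"
    by (auto simp: lp_bound_def lp_space_def lp_norm_def)
  from b obtain K where "\<And>k. norm (x k) \<le> K" by (auto simp: bounded_iff)
  then have "norm (x k) \<le> (SUP k. norm (x k))" for k
    by (intro cSUP_upper) (auto intro!: bdd_aboveI2)
  with s show "\<forall>k. norm (x k) \<le> B" by (meson order_trans)
next
  assume "\<forall>k. norm (x k) \<le> B"
  then show "lp_bound \<infinity> x B"
    by (auto simp: lp_bound_def lp_space_def lp_norm_def bounded_iff intro!: cSUP_least)
qed

lemma real_of_ereal_ge_1: "1 \<le> p \<Longrightarrow> p \<noteq> \<infinity> \<Longrightarrow> 1 \<le> real_of_ereal p"
  by (cases p) auto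

text \<open>The summands are nonnegative, so finite partial sums decide everything; most later
  estimates then handle finite sums only.\<close>

lemma lp_bound_finite:
  assumes p: "1 \<le> p" "p \<noteq> \<infinity>"
  shows "lp_bound p x B \<longleftrightarrow>
    0 \<le> B \<and> (\<forall>F. finite F \<longrightarrow> (\<Sum>k\<in>F. norm (x k) powr real_of_ereal p) \<le> B powr real_of_ereal p)"
proof -
  define q where "q = real_of_ereal p"
  have q: "1 \<le> q" using real_of_ereal_ge_1[OF p] by (simp add: q_def)
  let ?f = "\<lambda>k. norm (x k) powr q"
  show ?thesis unfolding q_def[symmetric]
  proof (intro iffI conjI allI impI)
    assume L: "lp_bound p x B"
    then have s: "?f summable_on UNIV" and n: "(\<Sum>\<^sub>\<infinity>k. ?f k) powr (1/q) \<le> B"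
      using p by (auto simp: lp_bound_def lp_space_def lp_norm_def q_def)
    show B0: "0 \<le> B" using n powr_ge_zero by (meson order_trans)
    fix F :: "int set" assume F: "finite F"
    have "sum ?f F \<le> (\<Sum>\<^sub>\<infinity>k. ?f k)" by (rule finite_sum_le_infsum) (use s F in auto)
    also have "\<dots> = ((\<Sum>\<^sub>\<infinity>k. ?f k) powr (1/q)) powr q"
      using q by (simp add: powr_powr infsum_nonneg)
    also have "\<dots> \<le> B powr q" using n q by (intro powr_mono2) auto
    finally show "sum ?f F \<le> B powr q" .
  next
    assume R: "0 \<le> B \<and> (\<forall>F. finite F \<longrightarrow> sum ?f F \<le> B powr q)"
    then have s: "?f summable_on UNIV"
      by (intro nonneg_bdd_above_summable_on) (auto intro!: bdd_aboveI2)
    have "(\<Sum>\<^sub>\<infinity>k. ?f k) \<le> B powr q" using s R by (intro infsum_le_finite_sums) auto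
    then have "(\<Sum>\<^sub>\<infinity>k. ?f k) powr (1/q) \<le> (B powr q) powr (1/q)"
      using q by (intro powr_mono2) (auto intro!: infsum_nonneg)
    also have "\<dots> = B" using R q by (simp add: powr_powr)
    finally show "lp_bound p x B" using s p by (auto simp: lp_bound_def lp_space_def lp_norm_def q_def)
  qed
qed

lemma lp_bound_nonneg: "lp_bound p x B \<Longrightarrow> 0 \<le> B"
  unfolding lp_bound_def using lp_norm_nonneg order_trans by blast

lemma lp_bound_mono: "lp_bound p x B \<Longrightarrow> B \<le> B' \<Longrightarrow> lp_bound p x B'"
  by (simp add: lp_bound_def)

lemma lp_bound_norm: "x \<in> lp_space p \<Longrightarrow> lp_bound p x (lp_norm p x)"
  by (simp add: lp_bound_def)

lemma lp_bound_component:
  assumes "1 \<le> p" "lp_bound p x B" shows "norm (x k) \<le> B"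
proof (cases "p = \<infinity>")
  case True
  with assms show ?thesis by (auto simp: lp_bound_infinity)
next
  case False
  define q where "q = real_of_ereal p"
  have q: "1 \<le> q" using real_of_ereal_ge_1[OF assms(1) False] by (simp add: q_def)
  have B: "0 \<le> B" and "(\<Sum>k\<in>{k}. norm (x k) powr q) \<le> B powr q"
    using assms(2) False by (auto simp: lp_bound_finite[OF assms(1) False] q_def simp del: sum.insert)
  then have "norm (x k) powr q \<le> B powr q" by simp
  then have le: "(norm (x k) powr q) powr (1/q) \<le> (B powr q) powr (1/q)"
    using q by (simp add: powr_mono2 del: powr_powr)
  have "norm (x k) = (norm (x k) powr q) powr (1/q)" using q by (simp add: powr_powr)
  also note le
  also have "(B powr q) powr (1/q) = B" using B q by (simp add: powr_powr)
  finally show ?thesis .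
qed

text \<open>The two sequences may take values in different spaces, so this one comparison covers
  scaling, passage to a component and the embedding of scalars in \<open>complex^3\<close>.\<close>

lemma lp_bound_cmult_dominated:
  assumes p: "1 \<le> p" and x: "lp_bound p x B" and a: "0 \<le> a"
    and le: "\<And>k. norm (z k) \<le> a * norm (x k)"
  shows "lp_bound p z (a * B)"
proof (cases "p = \<infinity>")
  case True
  with x have "\<And>k. norm (x k) \<le> B" by (auto simp: lp_bound_infinity)
  then have "norm (z k) \<le> a * B" for k using le[of k] a by (meson mult_left_mono order_trans)
  then show ?thesis using True by (simp add: lp_bound_infinity)
next
  case False
  define q where "q = real_of_ereal p"
  have q: "1 \<le> q" using real_of_ereal_ge_1[OF p False] by (simp add: q_def)
  have B: "0 \<le> B" and F: "\<And>F. finite F \<Longrightarrow> (\<Sum>k\<in>F. norm (x k) powr q) \<le> B powr q"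
    using x by (auto simp: lp_bound_finite[OF p False] q_def)
  have "(\<Sum>k\<in>F. norm (z k) powr q) \<le> (a * B) powr q" if "finite F" for F
  proof -
    have "(\<Sum>k\<in>F. norm (z k) powr q) \<le> (\<Sum>k\<in>F. a powr q * norm (x k) powr q)"
      using powr_mono2[OF _ norm_ge_zero le, of q] q a by (intro sum_mono) (simp add: powr_mult)
    also have "\<dots> \<le> a powr q * B powr q" using F[OF that]
      by (simp add: sum_distrib_left[symmetric] mult_left_mono)
    also have "\<dots> = (a * B) powr q" using a B by (simp add: powr_mult)
    finally show ?thesis .
  qed
  then show ?thesis using a B by (auto simp: lp_bound_finite[OF p False] q_def)
qed

text \<open>Convexity of t^q at (u + v)/(\<alpha> + \<beta>), read as the mean of u/\<alpha> and
  v/\<beta> with weights \<alpha>/(\<alpha> + \<beta>) and \<beta>/(\<alpha> + \<beta>). This is the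
  pointwise half of Minkowski's inequality.\<close>

lemma powr_convex_combination:
  fixes u v \<alpha> \<beta> q :: real
  assumes "1 \<le> q" "0 \<le> u" "0 \<le> v" "0 < \<alpha>" "0 < \<beta>"
  shows "(u + v) powr q \<le>
    (\<alpha> + \<beta>) powr q * (\<alpha> / (\<alpha> + \<beta>) * (u / \<alpha>) powr q + \<beta> / (\<alpha> + \<beta>) * (v / \<beta>) powr q)"
proof -
  let ?s = "\<alpha> + \<beta>"
  \<comment> \<open>Convexity is applied only at positive arguments; when \<open>u\<close> or
    \<open>v\<close> vanishes, the bound t^q <= t for the weight in [0,1] replaces it.\<close>
  have small: "t powr q \<le> t" if "0 \<le> t" "t \<le> 1" for t :: real
    using that assms(1) powr_mono'[of 1 q t] by simp
  have *: "(\<alpha> / ?s * (u / \<alpha>) + \<beta> / ?s * (v / \<beta>)) powr q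
      \<le> \<alpha> / ?s * (u / \<alpha>) powr q + \<beta> / ?s * (v / \<beta>) powr q"
  proof -
    consider "u = 0" | "v = 0" | "0 < u" "0 < v" using assms by linarith
    then show ?thesis
    proof cases
      case 1
      have "(\<beta> / ?s * (v / \<beta>)) powr q = (\<beta> / ?s) powr q * (v / \<beta>) powr q"
        using assms by (subst powr_mult) auto
      also have "\<dots> \<le> \<beta> / ?s * (v / \<beta>) powr q"
        using assms by (intro mult_right_mono small) auto
      finally show ?thesis using 1 by simp
    next
      case 2
      have "(\<alpha> / ?s * (u / \<alpha>)) powr q = (\<alpha> / ?s) powr q * (u / \<alpha>) powr q"
        using assms by (subst powr_mult) auto
      also have "\<dots> \<le> \<alpha> / ?s * (u / \<alpha>) powr q"
        using assms by (intro mult_right_mono small) auto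
      finally show ?thesis using 2 by simp
    next
      case 3
      have "\<alpha> / ?s = 1 - \<beta> / ?s" using assms by (simp add: field_simps)
      then show ?thesis
        using convex_onD[OF powr_convex[OF assms(1)], of "\<beta> / ?s" "u / \<alpha>" "v / \<beta>"] 3 assms by simp
    qed
  qed
  have e: "\<alpha> / ?s * (u / \<alpha>) + \<beta> / ?s * (v / \<beta>) = (u + v) / ?s"
    using assms by (simp add: add_divide_distrib)
  have "(u + v) powr q = ?s powr q * ((u + v) / ?s) powr q"
    using assms by (simp add: powr_divide)
  also have "\<dots> \<le> ?s powr q * (\<alpha> / ?s * (u / \<alpha>) powr q + \<beta> / ?s * (v / \<beta>) powr q)"
    using * unfolding e by (intro mult_left_mono) auto
  finally show ?thesis .
qed

text \<open>Minkowski's inequality. With A and B as weights, the normalised power sums of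
  \<open>x\<close> and \<open>y\<close> are at most 1, and so is their weighted mean. Positivity
  allows division by A and B.\<close>

lemma lp_bound_add_pos:
  assumes p: "1 \<le> p" and x: "lp_bound p x A" and y: "lp_bound p y B" and AB: "0 < A" "0 < B"
    and le: "\<And>k. norm (z k) \<le> norm (x k) + norm (y k)"
  shows "lp_bound p z (A + B)"
proof (cases "p = \<infinity>")
  case True
  then show ?thesis using x y by (auto simp: lp_bound_infinity intro!: order_trans[OF le] add_mono)
next
  case False
  define q where "q = real_of_ereal p"
  have q: "1 \<le> q" using real_of_ereal_ge_1[OF p False] by (simp add: q_def)
  let ?s = "A + B"
  have X: "\<And>F. finite F \<Longrightarrow> (\<Sum>k\<in>F. norm (x k) powr q) \<le> A powr q"
    and Y: "\<And>F. finite F \<Longrightarrow> (\<Sum>k\<in>F. norm (y k) powr q) \<le> B powr q"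
    using x y by (auto simp: lp_bound_finite[OF p False] q_def)
  have "(\<Sum>k\<in>F. norm (z k) powr q) \<le> ?s powr q" if F: "finite F" for F
  proof -
    have "(\<Sum>k\<in>F. norm (z k) powr q) \<le> (\<Sum>k\<in>F. (norm (x k) + norm (y k)) powr q)"
      using le q by (intro sum_mono powr_mono2) auto
    also have "\<dots> \<le> (\<Sum>k\<in>F. ?s powr q *
        (A / ?s * (norm (x k) / A) powr q + B / ?s * (norm (y k) / B) powr q))"
      using q AB by (intro sum_mono powr_convex_combination) auto
    also have "\<dots> = ?s powr q * (A / ?s * ((\<Sum>k\<in>F. norm (x k) powr q) / A powr q)
        + B / ?s * ((\<Sum>k\<in>F. norm (y k) powr q) / B powr q))"
      using AB by (simp add: sum_distrib_left sum.distrib powr_divide sum_divide_distrib algebra_simps)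
    also have "\<dots> \<le> ?s powr q * (A / ?s * 1 + B / ?s * 1)"
      using X[OF F] Y[OF F] AB by (intro mult_left_mono add_mono) (auto simp: divide_le_eq)
    also have "\<dots> = ?s powr q" using AB by (simp add: add_divide_distrib[symmetric])
    finally show ?thesis .
  qed
  then show ?thesis using AB by (auto simp: lp_bound_finite[OF p False] q_def)
qed

text \<open>Fatou's lemma for l^p: finite sums pass to the limit. Since convergence at each site
  suffices, series and perturbed bounds can be treated without a completeness argument in
  l^p.\<close>

lemma lp_bound_limit:
  assumes p: "1 \<le> p" and b: "\<And>n::nat. lp_bound p (x n) (b n)" and B: "b \<longlonglongrightarrow> B"
    and lim: "\<And>k. (\<lambda>n. x n k) \<longlonglongrightarrow> z k"
  shows "lp_bound p z B"
proof -
  have B0: "0 \<le> B" using B lp_bound_nonneg[OF b] by (simp add: LIMSEQ_le_const)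
  show ?thesis
  proof (cases "p = \<infinity>")
    case True
    then have "\<And>n k. norm (x n k) \<le> b n" using b by (simp add: lp_bound_infinity)
    then have "norm (z k) \<le> B" for k
      using tendsto_le[OF sequentially_bot B tendsto_norm[OF lim[of k]]] by simp
    then show ?thesis using True by (simp add: lp_bound_infinity)
  next
    case False
    define q where "q = real_of_ereal p"
    have q: "1 \<le> q" using real_of_ereal_ge_1[OF p False] by (simp add: q_def)
    have X: "\<And>n F. finite F \<Longrightarrow> (\<Sum>k\<in>F. norm (x n k) powr q) \<le> b n powr q"
      using b by (auto simp: lp_bound_finite[OF p False] q_def)
    have b0: "0 \<le> b n" for n using lp_bound_nonneg[OF b] .
    have "(\<Sum>k\<in>F. norm (z k) powr q) \<le> B powr q" if F: "finite F" for F
    proof (rule tendsto_le[OF sequentially_bot])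
      show "(\<lambda>n. b n powr q) \<longlonglongrightarrow> B powr q"
        using q b0 by (intro tendsto_powr' B tendsto_const) auto
      show "(\<lambda>n. \<Sum>k\<in>F. norm (x n k) powr q) \<longlonglongrightarrow> (\<Sum>k\<in>F. norm (z k) powr q)"
        using q by (intro tendsto_sum tendsto_powr' tendsto_norm lim tendsto_const) auto
    qed (use X F in auto)
    then show ?thesis using B0 by (auto simp: lp_bound_finite[OF p False] q_def)
  qed
qed

lemma lp_bound_add_dominated:
  assumes p: "1 \<le> p" and x: "lp_bound p x A" and y: "lp_bound p y B"
    and le: "\<And>k. norm (z k) \<le> norm (x k) + norm (y k)"
  shows "lp_bound p z (A + B)"
proof (rule lp_bound_limit[OF p])
  fix n :: nat
  \<comment> \<open>Both bounds are raised by 1/(n + 1) to make them positive, and n is sent to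
    infinity.\<close>
  have e: "0 < inverse (real (Suc n))" by simp
  show "lp_bound p z ((A + inverse (real (Suc n))) + (B + inverse (real (Suc n))))"
    using lp_bound_nonneg[OF x] lp_bound_nonneg[OF y] e
    by (intro lp_bound_add_pos[OF p lp_bound_mono[OF x] lp_bound_mono[OF y] _ _ le]) (auto intro: add_nonneg_pos)
next
  show "(\<lambda>n. (A + inverse (real (Suc n))) + (B + inverse (real (Suc n)))) \<longlonglongrightarrow> A + B"
    using tendsto_add[OF LIMSEQ_inverse_real_of_nat_add LIMSEQ_inverse_real_of_nat_add, of A B] by simp
qed (rule tendsto_const)

lemma lp_bound_add:
  "1 \<le> p \<Longrightarrow> lp_bound p x A \<Longrightarrow> lp_bound p y B \<Longrightarrow> lp_bound p (\<lambda>k. x k + y k) (A + B)"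
  by (erule (2) lp_bound_add_dominated) (rule norm_triangle_ineq)

lemma lp_bound_diff:
  "1 \<le> p \<Longrightarrow> lp_bound p x A \<Longrightarrow> lp_bound p y B \<Longrightarrow> lp_bound p (\<lambda>k. x k - y k) (A + B)"
  by (erule (2) lp_bound_add_dominated) (rule norm_triangle_ineq4)

lemma lp_bound_zero: "1 \<le> p \<Longrightarrow> lp_bound p (\<lambda>k. 0) 0"
  by (cases "p = \<infinity>") (auto simp: lp_bound_infinity lp_bound_finite)

lemma lp_bound_sum:
  assumes "1 \<le> p" "\<And>i. i \<in> I \<Longrightarrow> lp_bound p (x i) (b i)"
  shows "lp_bound p (\<lambda>k. \<Sum>i\<in>I. x i k) (sum b I)"
  using assms(2)
proof (induction I rule: infinite_finite_induct)
  case (insert i I)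
  then show ?case using lp_bound_add[OF assms(1), of "x i" "b i" "\<lambda>k. \<Sum>i\<in>I. x i k" "sum b I"] by simp
qed (auto simp: lp_bound_zero[OF assms(1)])

lemma lp_bound_suminf:
  fixes x :: "nat \<Rightarrow> int \<Rightarrow> 'a::banach"
  assumes p: "1 \<le> p" and x: "\<And>n. lp_bound p (x n) (b n)" and b: "summable b"
  shows "summable (\<lambda>n. x n k)" "lp_bound p (\<lambda>k. \<Sum>n. x n k) (suminf b)"
proof -
  show s: "summable (\<lambda>n. x n k)" for k
    by (rule summable_comparison_test[OF _ b]) (use lp_bound_component[OF p x] in auto)
  show "lp_bound p (\<lambda>k. \<Sum>n. x n k) (suminf b)"
    by (rule lp_bound_limit[OF p lp_bound_sum[OF p x] summable_LIMSEQ[OF b] summable_LIMSEQ[OF s]])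
qed

lemma lp_bound_translate:
  assumes p: "1 \<le> p" and x: "lp_bound p x B" shows "lp_bound p (\<lambda>k. x (k + i)) B"
proof (cases "p = \<infinity>")
  case True
  then show ?thesis using x by (auto simp: lp_bound_infinity)
next
  case False
  have "(\<Sum>k\<in>F. norm (x (k + i)) powr real_of_ereal p) \<le> B powr real_of_ereal p" if "finite F" for F
  proof -
    have "(\<Sum>k\<in>F. norm (x (k + i)) powr real_of_ereal p) =
        (\<Sum>k\<in>(\<lambda>k. k + i) ` F. norm (x k) powr real_of_ereal p)"
      by (simp add: sum.reindex)
    then show ?thesis using x that by (simp add: lp_bound_finite[OF p False])
  qed
  then show ?thesis using lp_bound_nonneg[OF x] by (auto simp: lp_bound_finite[OF p False])
qed

lemma lp_bound_finite_support:
  assumes p: "1 \<le> p" "p \<noteq> \<infinity>" and F: "finite F" and B: "0 \<le> B" and x: "\<And>k. norm (x k) \<le> B"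
    and s: "\<And>k. k \<notin> F \<Longrightarrow> x k = 0"
  shows "lp_bound p x (B * real (card F) powr (1 / real_of_ereal p))"
proof -
  define q where "q = real_of_ereal p"
  have q: "1 \<le> q" using real_of_ereal_ge_1[OF p] by (simp add: q_def)
  have "(\<Sum>k\<in>G. norm (x k) powr q) \<le> (B * real (card F) powr (1 / q)) powr q" if "finite G" for G
  proof -
    have "(\<Sum>k\<in>G. norm (x k) powr q) = (\<Sum>k\<in>G \<inter> F. norm (x k) powr q)"
      using that s q by (intro sum.mono_neutral_right) auto
    also have "\<dots> \<le> (\<Sum>k\<in>F. norm (x k) powr q)" using F by (intro sum_mono2) auto
    also have "\<dots> \<le> (\<Sum>k\<in>F. B powr q)" using x q by (intro sum_mono powr_mono2) auto
    also have "\<dots> = (B * real (card F) powr (1 / q)) powr q"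
      using B q by (simp add: powr_mult powr_powr)
    finally show ?thesis .
  qed
  then show ?thesis using B by (auto simp: lp_bound_finite[OF p] q_def)
qed

section \<open>The step operator\<close>

definition platoon_step :: "real \<Rightarrow> (int \<Rightarrow> complex^3) \<Rightarrow> int \<Rightarrow> complex^3" where
  "platoon_step \<zeta> x = (\<lambda>k. x k + (1 / \<zeta>) *\<^sub>R platoon_op \<zeta> x k)"

lemma platoon_op_nth:
  "platoon_op \<zeta> x k $ 1 = x k $ 2 - x (k - 1) $ 2"
  "platoon_op \<zeta> x k $ 2 = x k $ 3"
  "platoon_op \<zeta> x k $ 3 = - of_real (\<zeta>^3) * x k $ 1 - of_real (3 * \<zeta>^2) * x k $ 2 - of_real (3 * \<zeta>) * x k $ 3"
  by (simp_all add: platoon_op_def A0_def A1_def matrix_vector_mult_def sum_3)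

lemma platoon_op_eq_step: "\<zeta> \<noteq> 0 \<Longrightarrow> platoon_op \<zeta> x k = \<zeta> *\<^sub>R (platoon_step \<zeta> x k - x k)"
  by (simp add: platoon_step_def)

lemma platoon_step_nth:
  "platoon_step \<zeta> x k $ 1 = x k $ 1 + (x k $ 2 - x (k - 1) $ 2) / of_real \<zeta>"
  "platoon_step \<zeta> x k $ 2 = x k $ 2 + x k $ 3 / of_real \<zeta>"
  "\<zeta> \<noteq> 0 \<Longrightarrow> platoon_step \<zeta> x k $ 3 = - of_real (\<zeta>^2) * x k $ 1 - of_real (3 * \<zeta>) * x k $ 2 - 2 * x k $ 3"
  by (simp_all add: platoon_step_def platoon_op_nth)
    (simp_all add: scaleR_conv_of_real field_simps power2_eq_square power3_eq_cube)

text \<open>Cayley--Hamilton for \<open>A\<^sub>0 + S A\<^sub>1\<close>, whose characteristic polynomial is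
  \<open>(\<lambda> + \<zeta>)\<^sup>3 - \<zeta>\<^sup>3 S\<close>.\<close>

lemma platoon_step_cubed:
  assumes "\<zeta> \<noteq> 0"
  shows "(platoon_step \<zeta> ^^ 3) x = right_shift x"
proof (rule ext)
  fix k
  have "(platoon_step \<zeta> ^^ 3) x k $ i = right_shift x k $ i" for i
    using exhaust_3[of i] assms
    by (elim disjE) (simp_all add: numeral_3_eq_3 right_shift_def platoon_step_nth field_simps power2_eq_square)
  then show "(platoon_step \<zeta> ^^ 3) x k = right_shift x k" by (simp add: vec_eq_iff)
qed

lemma right_shift_funpow: "(right_shift ^^ j) y k = y (k - int j)"
  by (induction j arbitrary: k) (simp_all add: right_shift_def algebra_simps)

lemma norm_vec3_le: "norm (z :: complex^3) \<le> norm (z $ 1) + norm (z $ 2) + norm (z $ 3)"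
  using L2_set_le_sum[of UNIV "\<lambda>i. norm (z $ i)"] by (simp add: norm_vec_def sum_3)

lemma norm_vector_smult: "norm (c *s z :: complex^'n) = norm c * norm z"
  by (simp add: norm_vec_def norm_mult L2_set_right_distrib)

text \<open>A crude bound for the norm of \<open>C\<close>: the three components of
  \<open>A x\<close> at site \<open>k\<close> cost 1, 1 and \<zeta>^3 + 3\<zeta>^2 + 3\<zeta> times
  the norm of \<open>x k\<close>, and \<open>x (k - 1)\<close> costs one more; the total is divided
  by \<zeta> and increased by 1.\<close>

definition platoon_step_const :: "real \<Rightarrow> real" where
  "platoon_step_const \<zeta> = 1 + (3 + \<zeta>^3 + 3 * \<zeta>^2 + 3 * \<zeta>) / \<zeta>"

lemma platoon_step_const_ge_1: "0 < \<zeta> \<Longrightarrow> 1 \<le> platoon_step_const \<zeta>"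
  by (simp add: platoon_step_const_def)

text \<open>The constant sits inside the norm as a scaled vector so that the right-hand side is a
  sum of norms of two sequences, the shape that \<open>lp_bound_add_dominated\<close>
  expects.\<close>

lemma norm_platoon_op_le:
  assumes "0 < \<zeta>"
  shows "norm (platoon_op \<zeta> x k) \<le> norm ((2 + \<zeta>^3 + 3 * \<zeta>^2 + 3 * \<zeta>) *\<^sub>R x k) + norm (x (k - 1))"
proof -
  have n: "norm (x j $ i) \<le> norm (x j)" for j i by (rule Finite_Cartesian_Product.norm_nth_le)
  have "norm (platoon_op \<zeta> x k $ 1) \<le> norm (x k) + norm (x (k - 1))"
    unfolding platoon_op_nth by (rule order_trans[OF norm_triangle_ineq4 add_mono[OF n n]])
  moreover have "norm (platoon_op \<zeta> x k $ 2) \<le> norm (x k)"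
    unfolding platoon_op_nth by (rule n)
  moreover have "norm (platoon_op \<zeta> x k $ 3) \<le> \<zeta>^3 * norm (x k) + 3 * \<zeta>^2 * norm (x k) + 3 * \<zeta> * norm (x k)"
    unfolding platoon_op_nth using assms
    by (intro order_trans[OF norm_triangle_ineq4 add_mono])
      (auto simp: norm_mult norm_power intro!: mult_mono n)
  ultimately have "norm (platoon_op \<zeta> x k) \<le> (2 + \<zeta>^3 + 3 * \<zeta>^2 + 3 * \<zeta>) * norm (x k) + norm (x (k - 1))"
    using norm_vec3_le[of "platoon_op \<zeta> x k"] by (simp add: algebra_simps)
  moreover have "0 \<le> 2 + \<zeta>^3 + 3 * \<zeta>^2 + 3 * \<zeta>" using assms by simp
  ultimately show ?thesis by simp
qed

lemma lp_bound_scaleR: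
  "1 \<le> p \<Longrightarrow> lp_bound p x B \<Longrightarrow> lp_bound p (\<lambda>k. a *\<^sub>R x k) (\<bar>a\<bar> * B)"
  by (rule lp_bound_cmult_dominated) auto

lemma lp_bound_right_shift: "1 \<le> p \<Longrightarrow> lp_bound p x B \<Longrightarrow> lp_bound p ((right_shift ^^ j) x) B"
  using lp_bound_translate[of p x B "- int j"]
  by (simp add: ext[of "(right_shift ^^ j) x" "\<lambda>k. x (k - int j)"] right_shift_funpow)

lemma lp_bound_platoon_op:
  assumes "0 < \<zeta>" "1 \<le> p" "lp_bound p x B"
  shows "lp_bound p (platoon_op \<zeta> x) ((3 + \<zeta>^3 + 3 * \<zeta>^2 + 3 * \<zeta>) * B)"
proof -
  have "lp_bound p (platoon_op \<zeta> x) (\<bar>2 + \<zeta>^3 + 3 * \<zeta>^2 + 3 * \<zeta>\<bar> * B + B)"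
    using norm_platoon_op_le[OF assms(1)]
    by (intro lp_bound_add_dominated[OF assms(2) lp_bound_scaleR[OF assms(2,3)]
          lp_bound_translate[OF assms(2,3), of "-1"]]) auto
  then show ?thesis using assms by (simp add: algebra_simps abs_of_pos add_pos_nonneg)
qed

lemma lp_bound_platoon_step:
  assumes "0 < \<zeta>" "1 \<le> p" "lp_bound p x B"
  shows "lp_bound p (platoon_step \<zeta> x) (platoon_step_const \<zeta> * B)"
proof -
  have "B + \<bar>1 / \<zeta>\<bar> * ((3 + \<zeta>^3 + 3 * \<zeta>^2 + 3 * \<zeta>) * B) = platoon_step_const \<zeta> * B"
    using assms(1) by (simp add: platoon_step_const_def field_simps)
  then show ?thesis
    using lp_bound_add[OF assms(2,3) lp_bound_scaleR[OF assms(2) lp_bound_platoon_op[OF assms], of "1 / \<zeta>"]]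
    by (simp add: platoon_step_def)
qed

text \<open>Power boundedness: the powers of the step operator are those of the isometry \<open>S\<close>, up to a
  factor with exponent at most 2.\<close>

lemma lp_bound_platoon_step_funpow:
  assumes "0 < \<zeta>" "1 \<le> p" "lp_bound p x B"
  shows "lp_bound p ((platoon_step \<zeta> ^^ n) x) ((platoon_step_const \<zeta>)\<^sup>2 * B)"
proof -
  let ?K = "platoon_step_const \<zeta>"
  have K: "1 \<le> ?K" by (rule platoon_step_const_ge_1[OF assms(1)])
  have "lp_bound p ((platoon_step \<zeta> ^^ i) x) (?K ^ i * B)" for i
    by (induction i) (use assms lp_bound_platoon_step in \<open>auto simp: mult.assoc\<close>)
  moreover have "?K ^ (n mod 3) * B \<le> ?K\<^sup>2 * B"
    using K lp_bound_nonneg[OF assms(3)] by (intro mult_right_mono power_increasing) auto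
  ultimately have "lp_bound p ((platoon_step \<zeta> ^^ (n mod 3)) x) (?K\<^sup>2 * B)"
    using lp_bound_mono by blast
  moreover have "platoon_step \<zeta> ^^ n = ((platoon_step \<zeta> ^^ 3) ^^ (n div 3)) \<circ> platoon_step \<zeta> ^^ (n mod 3)"
    by (simp only: funpow_mult funpow_add[symmetric] mult_div_mod_eq)
  moreover have "platoon_step \<zeta> ^^ 3 = right_shift"
    using platoon_step_cubed assms(1) by auto
  ultimately show ?thesis using lp_bound_right_shift[OF assms(2)] by simp
qed

lemma bounded_linear_matrix_vector:
  fixes A :: "complex^'n^'m" shows "bounded_linear ((*v) A)"
  unfolding linear_conv_bounded_linear[symmetric]
  by (rule linearI) (simp_all add: vec_eq_iff matrix_vector_mult_def sum.distrib algebra_simps scaleR_sum_right)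

lemma platoon_step_diff:
  "platoon_step \<zeta> (\<lambda>k. x k - y k) k = platoon_step \<zeta> x k - platoon_step \<zeta> y k"
  by (simp add: platoon_step_def platoon_op_def matrix_vector_mult_diff_distrib algebra_simps)

lemma platoon_step_funpow_diff:
  "(platoon_step \<zeta> ^^ n) (\<lambda>k. x k - y k) k = (platoon_step \<zeta> ^^ n) x k - (platoon_step \<zeta> ^^ n) y k"
proof (induction n arbitrary: k)
  case (Suc n)
  then have "(platoon_step \<zeta> ^^ n) (\<lambda>k. x k - y k) = (\<lambda>k. (platoon_step \<zeta> ^^ n) x k - (platoon_step \<zeta> ^^ n) y k)"
    by blast
  then show ?case by (simp add: platoon_step_diff)
qed simp

lemma platoon_step_smult: "platoon_step \<zeta> (\<lambda>k. c *s x k) k = c *s platoon_step \<zeta> x k"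
  by (simp add: platoon_step_def platoon_op_def vec_eq_iff matrix_vector_mult_def sum_distrib_left algebra_simps)

section \<open>Power series in the step operator\<close>

definition step_series :: "real \<Rightarrow> (nat \<Rightarrow> real) \<Rightarrow> (int \<Rightarrow> complex^3) \<Rightarrow> int \<Rightarrow> complex^3" where
  "step_series \<zeta> a x = (\<lambda>k. \<Sum>n. a n *\<^sub>R (platoon_step \<zeta> ^^ n) x k)"

text \<open>By power boundedness the n-th term has norm at most \<open>\<bar>a n\<bar>\<close> times
  a fixed constant. Operator estimates thus reduce to the l^1 norm of a coefficient
  sequence.\<close>

lemma
  assumes "0 < \<zeta>" "1 \<le> p" "lp_bound p x B" "summable (\<lambda>n. \<bar>a n\<bar>)"
  shows summable_step_series: "summable (\<lambda>n. a n *\<^sub>R (platoon_step \<zeta> ^^ n) x k)"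
    and lp_bound_step_series: "lp_bound p (step_series \<zeta> a x) ((platoon_step_const \<zeta>)\<^sup>2 * B * (\<Sum>n. \<bar>a n\<bar>))"
proof -
  let ?M = "(platoon_step_const \<zeta>)\<^sup>2"
  have b: "lp_bound p (\<lambda>k. a n *\<^sub>R (platoon_step \<zeta> ^^ n) x k) (\<bar>a n\<bar> * (?M * B))" for n
    by (rule lp_bound_scaleR[OF assms(2) lp_bound_platoon_step_funpow[OF assms(1-3)]])
  note s = lp_bound_suminf[OF assms(2) b summable_mult2[OF assms(4)]]
  show "summable (\<lambda>n. a n *\<^sub>R (platoon_step \<zeta> ^^ n) x k)" by (rule s(1))
  show "lp_bound p (step_series \<zeta> a x) (?M * B * (\<Sum>n. \<bar>a n\<bar>))"
    using s(2) by (simp add: step_series_def suminf_mult2[OF assms(4), symmetric] mult.commute)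
qed

text \<open>The factor \<open>r\<close> is there for difference quotients in a parameter of the
  coefficients.\<close>

lemma step_series_coeff_cmult_diff:
  assumes "0 < \<zeta>" "1 \<le> p" "x \<in> lp_space p" "summable (\<lambda>n. \<bar>a n\<bar>)" "summable (\<lambda>n. \<bar>b n\<bar>)"
  shows "step_series \<zeta> (\<lambda>n. r * (a n - b n)) x k = r *\<^sub>R (step_series \<zeta> a x k - step_series \<zeta> b x k)"
proof -
  note s = summable_step_series[OF assms(1,2) lp_bound_norm[OF assms(3)]]
  have d: "summable (\<lambda>n. (a n - b n) *\<^sub>R (platoon_step \<zeta> ^^ n) x k)"
    using summable_diff[OF s[OF assms(4)] s[OF assms(5)], of k k] by (simp add: scaleR_diff_left)
  have "step_series \<zeta> (\<lambda>n. r * (a n - b n)) x k = (\<Sum>n. r *\<^sub>R ((a n - b n) *\<^sub>R (platoon_step \<zeta> ^^ n) x k))"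
    by (simp add: step_series_def)
  also have "\<dots> = r *\<^sub>R (\<Sum>n. (a n - b n) *\<^sub>R (platoon_step \<zeta> ^^ n) x k)"
    by (rule suminf_scaleR_right[OF d, symmetric])
  also have "\<dots> = r *\<^sub>R (step_series \<zeta> a x k - step_series \<zeta> b x k)"
    using suminf_diff[OF s[OF assms(4)] s[OF assms(5)], of k k] by (simp add: step_series_def scaleR_diff_left)
  finally show ?thesis .
qed

lemma step_series_coeff_diff:
  assumes "0 < \<zeta>" "1 \<le> p" "x \<in> lp_space p" "summable (\<lambda>n. \<bar>a n\<bar>)" "summable (\<lambda>n. \<bar>b n\<bar>)"
  shows "step_series \<zeta> (\<lambda>n. a n - b n) x k = step_series \<zeta> a x k - step_series \<zeta> b x k"
  using step_series_coeff_cmult_diff[OF assms, of 1] by simp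

lemma step_series_diff:
  assumes "0 < \<zeta>" "1 \<le> p" "x \<in> lp_space p" "y \<in> lp_space p" "summable (\<lambda>n. \<bar>a n\<bar>)"
  shows "step_series \<zeta> a (\<lambda>k. x k - y k) k = step_series \<zeta> a x k - step_series \<zeta> a y k"
  using summable_step_series[OF assms(1,2) lp_bound_norm[OF assms(3)] assms(5)]
    summable_step_series[OF assms(1,2) lp_bound_norm[OF assms(4)] assms(5)]
  by (simp add: step_series_def platoon_step_funpow_diff suminf_diff scaleR_diff_right)

lemma platoon_step_step_series:
  assumes "0 < \<zeta>" "1 \<le> p" "x \<in> lp_space p" "summable (\<lambda>n. \<bar>a n\<bar>)"
  shows "platoon_step \<zeta> (step_series \<zeta> a x) k = step_series \<zeta> a (platoon_step \<zeta> x) k"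
proof -
  note s = summable_step_series[OF assms(1,2) lp_bound_norm[OF assms(3)] assms(4)]
  \<comment> \<open>\<open>C\<close> is split into what it reads at site \<open>k\<close> and what
    it reads at \<open>k - 1\<close>: two bounded linear maps of \<open>complex^3\<close>, through
    which the sum at a single site can be moved.\<close>
  define L where "L = (\<lambda>v. v + (1 / \<zeta>) *\<^sub>R (A0 \<zeta> *v v))"
  define L' where "L' = (\<lambda>v. (1 / \<zeta>) *\<^sub>R (A1 *v v))"
  have L: "bounded_linear L"
    unfolding L_def by (intro bounded_linear_add bounded_linear_ident
        bounded_linear_compose[OF bounded_linear_scaleR_right bounded_linear_matrix_vector])
  have L': "bounded_linear L'"
    unfolding L'_def by (rule bounded_linear_compose[OF bounded_linear_scaleR_right bounded_linear_matrix_vector])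
  have step: "platoon_step \<zeta> y j = L (y j) + L' (y (j - 1))" for y j
    by (simp add: platoon_step_def platoon_op_def L_def L'_def algebra_simps)
  have *: "L (a n *\<^sub>R (platoon_step \<zeta> ^^ n) x k) + L' (a n *\<^sub>R (platoon_step \<zeta> ^^ n) x (k - 1))
      = a n *\<^sub>R (platoon_step \<zeta> ^^ n) (platoon_step \<zeta> x) k" for n
    using step[of "(platoon_step \<zeta> ^^ n) x" k]
    by (simp add: funpow_swap1[symmetric] linear_cmul[OF bounded_linear.linear[OF L]]
        linear_cmul[OF bounded_linear.linear[OF L']] scaleR_add_right)
  have "platoon_step \<zeta> (step_series \<zeta> a x) k
      = (\<Sum>n. L (a n *\<^sub>R (platoon_step \<zeta> ^^ n) x k)) + (\<Sum>n. L' (a n *\<^sub>R (platoon_step \<zeta> ^^ n) x (k - 1)))"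
    unfolding step[of "step_series \<zeta> a x"]
    by (simp add: step_series_def bounded_linear.suminf[OF L s] bounded_linear.suminf[OF L' s])
  also have "\<dots> = (\<Sum>n. L (a n *\<^sub>R (platoon_step \<zeta> ^^ n) x k) + L' (a n *\<^sub>R (platoon_step \<zeta> ^^ n) x (k - 1)))"
    by (rule suminf_add[OF bounded_linear.summable[OF L s] bounded_linear.summable[OF L' s]])
  also have "\<dots> = (\<Sum>n. a n *\<^sub>R (platoon_step \<zeta> ^^ n) (platoon_step \<zeta> x) k)"
    by (simp only: *)
  finally show ?thesis by (simp add: step_series_def)
qed

text \<open>The coefficients of (z - 1) times the power series with coefficients \<open>a\<close>;
  the missing predecessor of \<open>a 0\<close> counts as 0.\<close>

definition backward_diff :: "(nat \<Rightarrow> real) \<Rightarrow> nat \<Rightarrow> real" where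
  "backward_diff a n = (if n = 0 then 0 else a (n - 1)) - a n"

lemma step_series_platoon_step:
  assumes "0 < \<zeta>" "1 \<le> p" "x \<in> lp_space p" "summable (\<lambda>n. \<bar>a n\<bar>)"
  shows "step_series \<zeta> a (platoon_step \<zeta> x) k = step_series \<zeta> (\<lambda>n. if n = 0 then 0 else a (n - 1)) x k"
proof -
  have sum: "summable (\<lambda>n. \<bar>if n = 0 then 0 else a (n - 1)\<bar>)"
    using assms(4) summable_Suc_iff[of "\<lambda>n. \<bar>if n = 0 then 0 else a (n - 1)\<bar>"] by simp
  note s = summable_step_series[OF assms(1,2) lp_bound_norm[OF assms(3)] sum]
  show ?thesis using suminf_split_head[OF s, of k] by (simp add: step_series_def funpow_swap1)
qed

lemma platoon_op_step_series:
  assumes "0 < \<zeta>" "1 \<le> p" "x \<in> lp_space p" "summable (\<lambda>n. \<bar>a n\<bar>)"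
  shows "platoon_op \<zeta> (step_series \<zeta> a x) k
    = \<zeta> *\<^sub>R step_series \<zeta> (backward_diff a) x k"
proof -
  have "summable (\<lambda>n. \<bar>if n = 0 then 0 else a (n - 1)\<bar>)"
    using assms(4) summable_Suc_iff[of "\<lambda>n. \<bar>if n = 0 then 0 else a (n - 1)\<bar>"] by simp
  then show ?thesis
    using assms by (simp add: platoon_op_eq_step platoon_step_step_series step_series_platoon_step step_series_coeff_diff backward_diff_def[abs_def])
qed

text \<open>Applying C - 1 before the series, as here, or after it, as in
  \<open>platoon_op_step_series\<close>, gives the same coefficients. One l^1 estimate therefore
  governs both the derivative of an orbit and an orbit that starts in the range of C - 1.\<close>

lemma step_series_step_diff:
  assumes "0 < \<zeta>" "1 \<le> p" "x \<in> lp_space p" "summable (\<lambda>n. \<bar>a n\<bar>)"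
  shows "step_series \<zeta> a (\<lambda>k. platoon_step \<zeta> x k - x k) k
    = step_series \<zeta> (backward_diff a) x k"
proof -
  have "summable (\<lambda>n. \<bar>if n = 0 then 0 else a (n - 1)\<bar>)"
    using assms(4) summable_Suc_iff[of "\<lambda>n. \<bar>if n = 0 then 0 else a (n - 1)\<bar>"] by simp
  moreover have "platoon_step \<zeta> x \<in> lp_space p"
    using lp_bound_platoon_step[OF assms(1,2) lp_bound_norm[OF assms(3)]] by (simp add: lp_bound_def)
  ultimately show ?thesis
    using assms by (simp add: step_series_diff step_series_platoon_step step_series_coeff_diff backward_diff_def[abs_def])
qed

section \<open>Poisson weights\<close>

definition poisson_weight :: "real \<Rightarrow> nat \<Rightarrow> real" where
  "poisson_weight \<tau> n = exp (- \<tau>) * \<tau> ^ n / fact n"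

lemma exp_sums: "(\<lambda>n. \<tau> ^ n / fact n) sums exp (\<tau> :: real)"
  using exp_converges[of \<tau>] by (simp add: divide_inverse mult.commute)

lemma poisson_weight_nonneg: "0 \<le> \<tau> \<Longrightarrow> 0 \<le> poisson_weight \<tau> n"
  by (simp add: poisson_weight_def)

lemma poisson_weight_sums: "poisson_weight \<tau> sums 1"
  using sums_mult[OF exp_sums, of "exp (- \<tau>)" \<tau>]
  by (simp add: poisson_weight_def[abs_def] exp_minus)

lemma poisson_weight_summable: "summable (\<lambda>n. \<bar>poisson_weight \<tau> n\<bar>)"
proof -
  have "(\<lambda>n. \<bar>poisson_weight \<tau> n\<bar>) = (\<lambda>n. exp (- \<tau>) * (\<bar>\<tau>\<bar> ^ n / fact n))"
    by (simp add: poisson_weight_def abs_mult power_abs)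
  then show ?thesis using summable_mult[OF sums_summable[OF exp_sums[of "\<bar>\<tau>\<bar>"]], of "exp (- \<tau>)"] by simp
qed

lemma poisson_weight_Suc: "real (Suc n) * poisson_weight \<tau> (Suc n) = \<tau> * poisson_weight \<tau> n"
  by (simp add: poisson_weight_def divide_simps)

lemma poisson_mean_sums: "(\<lambda>n. real n * poisson_weight \<tau> n) sums \<tau>"
proof -
  have "(\<lambda>n. real (Suc n) * poisson_weight \<tau> (Suc n)) sums \<tau>"
    using sums_mult[OF poisson_weight_sums, of \<tau> \<tau>] by (simp only: poisson_weight_Suc) simp
  then show ?thesis by (subst (asm) sums_Suc_iff) simp
qed

text \<open>Shifting the index with \<open>poisson_weight_Suc\<close> gives E N^2 = \<tau> E(N + 1);
  the term at 0 vanishes.\<close>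

lemma poisson_second_moment_sums: "(\<lambda>n. (real n)\<^sup>2 * poisson_weight \<tau> n) sums (\<tau>\<^sup>2 + \<tau>)"
proof -
  have "(\<lambda>n. \<tau> * (real n * poisson_weight \<tau> n + poisson_weight \<tau> n)) sums (\<tau> * (\<tau> + 1))"
    by (intro sums_mult sums_add poisson_mean_sums poisson_weight_sums)
  moreover have "\<tau> * (real n * poisson_weight \<tau> n + poisson_weight \<tau> n)
      = (real (Suc n))\<^sup>2 * poisson_weight \<tau> (Suc n)" for n
  proof -
    have "(real (Suc n))\<^sup>2 * poisson_weight \<tau> (Suc n) = real (Suc n) * (\<tau> * poisson_weight \<tau> n)"
      using poisson_weight_Suc[of n \<tau>] by (simp only: power2_eq_square mult.assoc)
    then show ?thesis by (simp add: algebra_simps)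
  qed
  ultimately have "(\<lambda>n. (real (Suc n))\<^sup>2 * poisson_weight \<tau> (Suc n)) sums (\<tau> * (\<tau> + 1))" by simp
  then show ?thesis by (subst (asm) sums_Suc_iff) (simp add: algebra_simps power2_eq_square)
qed

lemma poisson_variance_sums: "(\<lambda>n. (real n - \<tau>)\<^sup>2 * poisson_weight \<tau> n) sums \<tau>"
proof -
  have "(\<lambda>n. (real n)\<^sup>2 * poisson_weight \<tau> n - 2 * \<tau> * (real n * poisson_weight \<tau> n) + \<tau>\<^sup>2 * poisson_weight \<tau> n)
    sums ((\<tau>\<^sup>2 + \<tau>) - 2 * \<tau> * \<tau> + \<tau>\<^sup>2 * 1)"
    by (intro sums_add sums_diff sums_mult poisson_mean_sums poisson_weight_sums poisson_second_moment_sums)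
  then show ?thesis by (simp add: algebra_simps power2_eq_square)
qed

text \<open>The recursion n w(n) = \<tau> w(n - 1) of the weights w. At n = 0 the default 0 in
  \<open>backward_diff\<close> is just what the formula needs.\<close>

lemma backward_diff_poisson_weight:
  assumes "0 < \<tau>"
  shows "backward_diff (poisson_weight \<tau>) n = (real n - \<tau>) / \<tau> * poisson_weight \<tau> n"
proof (cases n)
  case (Suc m)
  then show ?thesis using poisson_weight_Suc[of m \<tau>] assms by (simp add: backward_diff_def field_simps)
qed (use assms in \<open>simp add: backward_diff_def\<close>)

text \<open>With \<open>N\<close> Poisson distributed of parameter \<open>\<tau>\<close>, the sum is \<open>E \<bar>N - \<tau>\<bar> / \<tau>\<close>, which the
  variance bounds.\<close>

lemma backward_diff_poisson_weight_l1:
  assumes "0 < \<tau>"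
  shows "summable (\<lambda>n. \<bar>backward_diff (poisson_weight \<tau>) n\<bar>)"
    "(\<Sum>n. \<bar>backward_diff (poisson_weight \<tau>) n\<bar>) \<le> \<tau> powr (-1/2)"
proof -
  define s where "s = sqrt \<tau>"
  have s: "0 < s" "\<tau> = s * s" using assms by (simp_all add: s_def)
  \<comment> \<open>AM-GM in place of Cauchy-Schwarz: \<bar>d\<bar> <= (d^2/s + s)/2 for d = n -
    \<tau>. With s the standard deviation, both halves have the same mean, and together they give
    s/\<tau> = 1/s.\<close>
  define b where "b n = 1 / (2 * \<tau>) * (1 / s * ((real n - \<tau>)\<^sup>2 * poisson_weight \<tau> n) + s * poisson_weight \<tau> n)" for n
  have le: "\<bar>backward_diff (poisson_weight \<tau>) n\<bar> \<le> b n" for n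
  proof -
    let ?d = "\<bar>real n - \<tau>\<bar>"
    have "0 \<le> (?d - s)\<^sup>2" by simp
    then have "?d * (2 * s) \<le> (real n - \<tau>)\<^sup>2 + s * s"
      unfolding power2_diff by (simp add: power2_eq_square algebra_simps)
    then have "?d \<le> ((real n - \<tau>)\<^sup>2 + s * s) / (2 * s)" using s(1) by (simp add: pos_le_divide_eq)
    also have "\<dots> = (1 / s * (real n - \<tau>)\<^sup>2 + s) / 2" using s(1) by (simp add: field_simps)
    finally have "?d / \<tau> * poisson_weight \<tau> n \<le> (1 / s * (real n - \<tau>)\<^sup>2 + s) / 2 / \<tau> * poisson_weight \<tau> n"
      using assms by (intro mult_right_mono divide_right_mono poisson_weight_nonneg) auto
    also have "\<dots> = b n" by (simp add: b_def algebra_simps add_divide_distrib)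
    finally show ?thesis using assms
      by (simp add: backward_diff_poisson_weight abs_mult poisson_weight_nonneg)
  qed
  have "b sums (1 / (2 * \<tau>) * (1 / s * \<tau> + s * 1))" unfolding b_def
    by (intro sums_mult sums_add poisson_variance_sums poisson_weight_sums)
  moreover have "1 / (2 * \<tau>) * (1 / s * \<tau> + s * 1) = \<tau> powr (-1/2)"
  proof -
    have "\<tau> powr (-1/2) = 1 / s" using assms by (simp add: s_def powr_half_sqrt powr_minus_divide)
    then show ?thesis using s by (simp add: field_simps)
  qed
  ultimately have b: "b sums (\<tau> powr (-1/2))" by simp
  show sm: "summable (\<lambda>n. \<bar>backward_diff (poisson_weight \<tau>) n\<bar>)"
    by (rule summable_comparison_test[OF _ sums_summable[OF b]]) (use le in auto)
  show "(\<Sum>n. \<bar>backward_diff (poisson_weight \<tau>) n\<bar>) \<le> \<tau> powr (-1/2)"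
    using suminf_le[OF le sm sums_summable[OF b]] sums_unique[OF b] by simp
qed

lemma summable_backward_diff:
  "summable (\<lambda>n. \<bar>a n\<bar>) \<Longrightarrow> summable (\<lambda>n. \<bar>backward_diff a n\<bar>)"
proof (rule summable_comparison_test)
  assume a: "summable (\<lambda>n. \<bar>a n\<bar>)"
  then show "summable (\<lambda>n. \<bar>if n = 0 then 0 else a (n - 1)\<bar> + \<bar>a n\<bar>)"
    using summable_Suc_iff[of "\<lambda>n. \<bar>if n = 0 then 0 else a (n - 1)\<bar>"] by (intro summable_add) simp_all
qed (auto simp: backward_diff_def)

text \<open>A derivative in the parameter is a difference in the index. On the Poisson average of
  the powers of \<open>C\<close> that difference is C - 1, which is why the average solves the
  equation.\<close>

lemma poisson_weight_deriv:
  "((\<lambda>\<tau>. poisson_weight \<tau> n) has_real_derivative backward_diff (poisson_weight \<tau>) n) (at \<tau> within S)"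
proof (cases n)
  case 0
  then show ?thesis unfolding poisson_weight_def backward_diff_def
    by (auto intro!: derivative_eq_intros)
next
  case (Suc m)
  have "((\<lambda>\<tau>. exp (- \<tau>) * \<tau> ^ Suc m / fact (Suc m)) has_real_derivative
      (real (Suc m) * (exp (- \<tau>) * \<tau> ^ m) - exp (- \<tau>) * \<tau> ^ Suc m) / fact (Suc m)) (at \<tau> within S)"
    by (auto intro!: derivative_eq_intros simp del: power_Suc fact_Suc of_nat_Suc)
  also have "(real (Suc m) * (exp (- \<tau>) * \<tau> ^ m) - exp (- \<tau>) * \<tau> ^ Suc m) / fact (Suc m)
      = backward_diff (poisson_weight \<tau>) n"
    using Suc by (simp add: backward_diff_def poisson_weight_def diff_divide_distrib del: power_Suc of_nat_Suc)
  finally show ?thesis by (simp add: Suc poisson_weight_def)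
qed

lemma backward_diff_poisson_weight_deriv:
  "((\<lambda>\<tau>. backward_diff (poisson_weight \<tau>) n) has_real_derivative
    backward_diff (backward_diff (poisson_weight \<tau>)) n) (at \<tau> within S)"
  unfolding backward_diff_def[of _ n]
  by (cases n) (auto intro!: derivative_eq_intros poisson_weight_deriv simp: backward_diff_def[of "poisson_weight \<tau>"])

lemma poisson_weight_le: "0 \<le> \<tau> \<Longrightarrow> \<tau> \<le> R \<Longrightarrow> \<bar>poisson_weight \<tau> n\<bar> \<le> R ^ n / fact n"
  using mult_mono[of "exp (- \<tau>)" 1 "\<tau> ^ n / fact n" "R ^ n / fact n"]
  by (simp add: poisson_weight_def power_mono divide_right_mono)

text \<open>A second-order Taylor estimate summed over the index. As it bounds an l^1 norm,
  difference quotients of the semigroup converge in operator norm.\<close>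

lemma poisson_weight_quadratic_remainder:
  assumes "0 \<le> \<tau>" "\<tau> \<le> R" "0 \<le> \<sigma>" "\<sigma> \<le> R" "\<sigma> \<noteq> \<tau>"
  shows "summable (\<lambda>n. \<bar>1 / (\<sigma> - \<tau>) * (poisson_weight \<sigma> n - poisson_weight \<tau> n) - backward_diff (poisson_weight \<tau>) n\<bar>)"
    "(\<Sum>n. \<bar>1 / (\<sigma> - \<tau>) * (poisson_weight \<sigma> n - poisson_weight \<tau> n) - backward_diff (poisson_weight \<tau>) n\<bar>)
      \<le> 4 * exp R * \<bar>\<sigma> - \<tau>\<bar>"
proof -
  \<comment> \<open>\<open>sh\<close> dominates \<open>backward_diff\<close> and doubles the sum.
    Applied twice to \<open>R ^ n / fact n\<close> it majorises the second derivative on [0, R] and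
    produces the constant 4 exp R.\<close>
  define sh :: "(nat \<Rightarrow> real) \<Rightarrow> nat \<Rightarrow> real" where "sh a n = (if n = 0 then 0 else a (n - 1)) + a n" for a n
  have sh: "\<bar>backward_diff a n\<bar> \<le> sh b n" if "\<And>n. \<bar>a n\<bar> \<le> b n" for a b n
    using that[of n] that[of "n - 1"] unfolding backward_diff_def sh_def by auto
  have sh_sums: "sh a sums (2 * s)" if "a sums s" for a s
    using sums_add[OF _ that, of "\<lambda>n. if n = 0 then 0 else a (n - 1)" s] that
      sums_Suc_iff[of "\<lambda>n. if n = 0 then 0 else a (n - 1)" s] by (simp add: sh_def[abs_def])
  define c where "c = sh (sh (\<lambda>n. R ^ n / fact n))"
  have c_sums: "c sums (4 * exp R)" using sh_sums[OF sh_sums[OF exp_sums[of R]]] by (simp add: c_def)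
  let ?q = "\<lambda>n. 1 / (\<sigma> - \<tau>) * (poisson_weight \<sigma> n - poisson_weight \<tau> n) - backward_diff (poisson_weight \<tau>) n"
  have le: "\<bar>?q n\<bar> \<le> c n * \<bar>\<sigma> - \<tau>\<bar>" for n
  proof -
    let ?S = "closed_segment \<tau> \<sigma>"
    have S: "0 \<le> u" "u \<le> R" "\<bar>u - \<tau>\<bar> \<le> \<bar>\<sigma> - \<tau>\<bar>" if "u \<in> ?S" for u
      using that assms by (auto simp: closed_segment_eq_real_ivl split: if_splits)
    have c0: "0 \<le> c n" using assms by (simp add: c_def sh_def)
    have "\<bar>backward_diff (backward_diff (poisson_weight u)) n\<bar> \<le> c n" if "u \<in> ?S" for u
      unfolding c_def by (intro sh poisson_weight_le S that)
    then have "norm (backward_diff (poisson_weight u) n - backward_diff (poisson_weight \<tau>) n) \<le> c n * norm (u - \<tau>)"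
      if "u \<in> ?S" for u
      by (intro field_differentiable_bound[OF convex_closed_segment backward_diff_poisson_weight_deriv _ that]) auto
    then have *: "norm (backward_diff (poisson_weight u) n - backward_diff (poisson_weight \<tau>) n) \<le> c n * \<bar>\<sigma> - \<tau>\<bar>"
      if "u \<in> ?S" for u
      using that S(3)[OF that] c0 by (smt (verit) mult_left_mono real_norm_def)
    \<comment> \<open>The mean value inequality a second time, now for the weight minus its linear
      part at \<tau>, whose derivative has just been bounded.\<close>
    have "norm ((poisson_weight \<sigma> n - backward_diff (poisson_weight \<tau>) n * \<sigma>)
        - (poisson_weight \<tau> n - backward_diff (poisson_weight \<tau>) n * \<tau>)) \<le> (c n * \<bar>\<sigma> - \<tau>\<bar>) * norm (\<sigma> - \<tau>)"
      by (rule field_differentiable_bound[OF convex_closed_segment, of \<tau> \<sigma> _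
            "\<lambda>u. backward_diff (poisson_weight u) n - backward_diff (poisson_weight \<tau>) n"])
        (auto intro!: derivative_eq_intros poisson_weight_deriv *[unfolded real_norm_def])
    also have "(poisson_weight \<sigma> n - backward_diff (poisson_weight \<tau>) n * \<sigma>)
        - (poisson_weight \<tau> n - backward_diff (poisson_weight \<tau>) n * \<tau>) = (\<sigma> - \<tau>) * ?q n"
      using assms(5) by (simp add: right_diff_distrib) (simp add: algebra_simps)
    finally show ?thesis using assms(5) by (simp add: abs_mult mult.commute)
  qed
  have c': "(\<lambda>n. c n * \<bar>\<sigma> - \<tau>\<bar>) sums (4 * exp R * \<bar>\<sigma> - \<tau>\<bar>)" by (rule sums_mult2[OF c_sums])
  show s: "summable (\<lambda>n. \<bar>?q n\<bar>)"
    by (rule summable_comparison_test[OF _ sums_summable[OF c']]) (use le in auto)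
  show "(\<Sum>n. \<bar>?q n\<bar>) \<le> 4 * exp R * \<bar>\<sigma> - \<tau>\<bar>"
    using suminf_le[OF le s sums_summable[OF c']] sums_unique[OF c'] by simp
qed

section \<open>The semigroup and uniqueness of solutions\<close>

lemma lp_space_I: "lp_bound p x B \<Longrightarrow> x \<in> lp_space p"
  by (simp add: lp_bound_def)

lemma lp_space_diff: "1 \<le> p \<Longrightarrow> x \<in> lp_space p \<Longrightarrow> y \<in> lp_space p \<Longrightarrow> (\<lambda>k. x k - y k) \<in> lp_space p"
  by (rule lp_space_I[OF lp_bound_diff[OF _ lp_bound_norm lp_bound_norm]])

lemma lp_space_scaleR: "1 \<le> p \<Longrightarrow> x \<in> lp_space p \<Longrightarrow> (\<lambda>k. a *\<^sub>R x k) \<in> lp_space p"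
  by (rule lp_space_I[OF lp_bound_scaleR[OF _ lp_bound_norm]])

definition platoon_semigroup :: "real \<Rightarrow> real \<Rightarrow> (int \<Rightarrow> complex^3) \<Rightarrow> int \<Rightarrow> complex^3" where
  "platoon_semigroup \<zeta> t x = step_series \<zeta> (poisson_weight (\<zeta> * t)) x"

lemma platoon_semigroup_0: "platoon_semigroup \<zeta> 0 x = x"
proof
  fix k
  have "(\<Sum>n. poisson_weight 0 n *\<^sub>R (platoon_step \<zeta> ^^ n) x k)
      = (\<Sum>n\<in>{0}. poisson_weight 0 n *\<^sub>R (platoon_step \<zeta> ^^ n) x k)"
    by (rule suminf_finite) (auto simp: poisson_weight_def)
  then show "platoon_semigroup \<zeta> 0 x k = x k"
    by (simp add: platoon_semigroup_def step_series_def poisson_weight_def)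
qed

lemma lp_bound_platoon_semigroup:
  assumes "0 < \<zeta>" "1 \<le> p" "lp_bound p x B" "0 \<le> t"
  shows "lp_bound p (platoon_semigroup \<zeta> t x) ((platoon_step_const \<zeta>)\<^sup>2 * B)"
proof -
  have "\<bar>poisson_weight (\<zeta> * t) n\<bar> = poisson_weight (\<zeta> * t) n" for n
    using assms by (simp add: poisson_weight_nonneg)
  then have "(\<Sum>n. \<bar>poisson_weight (\<zeta> * t) n\<bar>) = 1"
    using sums_unique[OF poisson_weight_sums[of "\<zeta> * t"]] by simp
  then show ?thesis
    using lp_bound_step_series[OF assms(1-3) poisson_weight_summable[of "\<zeta> * t"]] by (simp add: platoon_semigroup_def)
qed

lemma platoon_semigroup_in_lp:
  "0 < \<zeta> \<Longrightarrow> 1 \<le> p \<Longrightarrow> x \<in> lp_space p \<Longrightarrow> platoon_semigroup \<zeta> t x \<in> lp_space p"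
  unfolding platoon_semigroup_def
  by (rule lp_space_I[OF lp_bound_step_series[OF _ _ lp_bound_norm poisson_weight_summable]])

lemma platoon_semigroup_deriv:
  assumes "0 < \<zeta>" "1 \<le> p" "x \<in> lp_space p" "0 \<le> t"
  shows "has_lp_derivative p (\<lambda>t. platoon_semigroup \<zeta> t x) (platoon_op \<zeta> (platoon_semigroup \<zeta> t x)) t"
  unfolding has_lp_derivative_def
proof (intro conjI allI impI)
  note B = lp_bound_norm[OF assms(3)]
  show "platoon_semigroup \<zeta> s x \<in> lp_space p" for s by (rule platoon_semigroup_in_lp[OF assms(1-3)])
  show "platoon_op \<zeta> (platoon_semigroup \<zeta> t x) \<in> lp_space p"
    by (rule lp_space_I[OF lp_bound_platoon_op[OF assms(1,2) lp_bound_norm[OF platoon_semigroup_in_lp[OF assms(1-3)]]]])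
  \<comment> \<open>One factor \<zeta> comes from A = \<zeta>(C - 1), the other from \<zeta>s -
    \<zeta>t. Restricting to s < t + 1 fixes the radius \<zeta>(t + 1) of the Taylor
    estimate.\<close>
  define K where "K = \<zeta> * ((platoon_step_const \<zeta>)\<^sup>2 * lp_norm p x * (4 * exp (\<zeta> * (t + 1)) * \<zeta>))"
  let ?q = "\<lambda>s k. (1 / (s - t)) *\<^sub>R (platoon_semigroup \<zeta> s x k - platoon_semigroup \<zeta> t x k)
    - platoon_op \<zeta> (platoon_semigroup \<zeta> t x) k"
  have b: "lp_bound p (?q s) (K * \<bar>s - t\<bar>)" if s: "0 \<le> s" "s \<noteq> t" "s < t + 1" for s
  proof -
    let ?P = "\<lambda>s. poisson_weight (\<zeta> * s)"
    let ?a = "\<lambda>n. 1 / (\<zeta> * s - \<zeta> * t) * (?P s n - ?P t n)"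
    let ?b = "backward_diff (?P t)"
    have r: "summable (\<lambda>n. \<bar>?a n - ?b n\<bar>)" "(\<Sum>n. \<bar>?a n - ?b n\<bar>) \<le> 4 * exp (\<zeta> * (t + 1)) * \<bar>\<zeta> * s - \<zeta> * t\<bar>"
      using poisson_weight_quadratic_remainder[of "\<zeta> * t" "\<zeta> * (t + 1)" "\<zeta> * s"] assms s by auto
    have sa: "summable (\<lambda>n. \<bar>?a n\<bar>)"
    proof (rule summable_comparison_test)
      show "summable (\<lambda>n. \<bar>1 / (\<zeta> * s - \<zeta> * t)\<bar> * (\<bar>?P s n\<bar> + \<bar>?P t n\<bar>))"
        by (intro summable_mult summable_add poisson_weight_summable)
      have "norm \<bar>?a n\<bar> \<le> \<bar>1 / (\<zeta> * s - \<zeta> * t)\<bar> * (\<bar>?P s n\<bar> + \<bar>?P t n\<bar>)" for n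
        unfolding real_norm_def abs_abs abs_mult by (intro mult_left_mono abs_triangle_ineq4) auto
      then show "\<exists>N. \<forall>n\<ge>N. norm \<bar>?a n\<bar> \<le> \<bar>1 / (\<zeta> * s - \<zeta> * t)\<bar> * (\<bar>?P s n\<bar> + \<bar>?P t n\<bar>)" by blast
    qed
    note sb = summable_backward_diff[OF poisson_weight_summable[of "\<zeta> * t"]]
    have eq: "?q s k = \<zeta> *\<^sub>R step_series \<zeta> (\<lambda>n. ?a n - ?b n) x k" for k
    proof -
      have "\<zeta> *\<^sub>R step_series \<zeta> (\<lambda>n. ?a n - ?b n) x k
          = \<zeta> *\<^sub>R (step_series \<zeta> ?a x k - step_series \<zeta> ?b x k)"
        using step_series_coeff_diff[OF assms(1-3) sa sb] by simp
      also have "step_series \<zeta> ?a x k = (1 / (\<zeta> * s - \<zeta> * t)) *\<^sub>R (step_series \<zeta> (?P s) x k - step_series \<zeta> (?P t) x k)"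
        by (rule step_series_coeff_cmult_diff[OF assms(1-3) poisson_weight_summable poisson_weight_summable])
      finally show ?thesis
        using assms by (simp add: platoon_semigroup_def platoon_op_step_series[OF assms(1-3) poisson_weight_summable]
            scaleR_diff_right right_diff_distrib[symmetric])
    qed
    have "lp_bound p (?q s) (\<bar>\<zeta>\<bar> * ((platoon_step_const \<zeta>)\<^sup>2 * lp_norm p x * (\<Sum>n. \<bar>?a n - ?b n\<bar>)))"
      unfolding eq by (rule lp_bound_scaleR[OF assms(2) lp_bound_step_series[OF assms(1,2) B r(1)]])
    moreover have "\<bar>\<zeta>\<bar> * ((platoon_step_const \<zeta>)\<^sup>2 * lp_norm p x * (\<Sum>n. \<bar>?a n - ?b n\<bar>))
        \<le> \<bar>\<zeta>\<bar> * ((platoon_step_const \<zeta>)\<^sup>2 * lp_norm p x * (4 * exp (\<zeta> * (t + 1)) * \<bar>\<zeta> * s - \<zeta> * t\<bar>))"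
      using lp_norm_nonneg[OF assms(3)] by (intro mult_left_mono r) auto
    moreover have "\<dots> = K * \<bar>s - t\<bar>"
      using assms by (simp add: K_def right_diff_distrib[symmetric] abs_mult)
    ultimately show ?thesis by (simp add: lp_bound_def)
  qed
  have ev: "\<forall>\<^sub>F s in at t within {0..}. lp_bound p (?q s) (K * \<bar>s - t\<bar>)"
    unfolding eventually_at by (rule exI[of _ 1]) (use b in \<open>auto simp: dist_real_def\<close>)
  show "((\<lambda>s. lp_norm p (?q s)) \<longlongrightarrow> 0) (at t within {0..})"
  proof (rule Lim_null_comparison)
    show "\<forall>\<^sub>F s in at t within {0..}. norm (lp_norm p (?q s)) \<le> K * \<bar>s - t\<bar>"
      using ev by eventually_elim (auto simp: lp_bound_def lp_norm_nonneg)
    show "((\<lambda>s. K * \<bar>s - t\<bar>) \<longlongrightarrow> 0) (at t within {0..})"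
      by (auto intro!: tendsto_eq_intros)
  qed
qed

lemma platoon_solution_semigroup:
  assumes "0 < \<zeta>" "1 \<le> p" "x \<in> lp_space p"
  shows "platoon_solution p \<zeta> x (\<lambda>t. platoon_semigroup \<zeta> t x)"
  using platoon_semigroup_deriv[OF assms] by (simp add: platoon_solution_def platoon_semigroup_0)

section \<open>Uniqueness of derivatives and of solutions\<close>

text \<open>Each coordinate is bounded by the l^p norm, so one \<open>d\<close> serves all sites;
  clearing the denominator lets s = t be included.\<close>

lemma has_lp_derivative_uniform:
  assumes p: "1 \<le> p" and D: "has_lp_derivative p x v t" and t: "0 \<le> t" and e: "0 < e"
  shows "\<exists>d>0. \<forall>s\<ge>0. \<bar>s - t\<bar> < d \<longrightarrow> (\<forall>k. norm (x s k - x t k - (s - t) *\<^sub>R v k) \<le> e * \<bar>s - t\<bar>)"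
proof -
  let ?q = "\<lambda>s k. (1 / (s - t)) *\<^sub>R (x s k - x t k) - v k"
  have "((\<lambda>s. lp_norm p (?q s)) \<longlongrightarrow> 0) (at t within {0..})"
    using D by (simp add: has_lp_derivative_def)
  then have "\<forall>\<^sub>F s in at t within {0..}. lp_norm p (?q s) < e" using e by (rule order_tendstoD(2))
  then obtain d where d: "d > 0" "\<And>s. 0 \<le> s \<Longrightarrow> s \<noteq> t \<Longrightarrow> \<bar>s - t\<bar> < d \<Longrightarrow> lp_norm p (?q s) < e"
    unfolding eventually_at by (auto simp: dist_real_def)
  have "norm (x s k - x t k - (s - t) *\<^sub>R v k) \<le> e * \<bar>s - t\<bar>" if s: "0 \<le> s" "\<bar>s - t\<bar> < d" for s k
  proof (cases "s = t")
    case False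
    have "?q s \<in> lp_space p" using D s t by (auto simp: has_lp_derivative_def intro!: lp_space_diff lp_space_scaleR p)
    then have "norm (?q s k) \<le> e"
      using lp_bound_component[OF p lp_bound_norm] d(2)[OF s(1) False s(2)] by (meson less_imp_le order_trans)
    then have "\<bar>s - t\<bar> * norm (?q s k) \<le> \<bar>s - t\<bar> * e" by (intro mult_left_mono) auto
    also have "\<bar>s - t\<bar> * norm (?q s k) = norm ((s - t) *\<^sub>R ?q s k)" by simp
    also have "(s - t) *\<^sub>R ?q s k = x s k - x t k - (s - t) *\<^sub>R v k"
      using False by (simp add: scaleR_diff_right)
    finally show ?thesis by (simp add: mult.commute)
  qed simp
  then show ?thesis using d(1) by blast
qed

lemma has_lp_derivative_component:
  assumes "1 \<le> p" "has_lp_derivative p x v t" "0 \<le> t"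
  shows "((\<lambda>s. x s k) has_vector_derivative v k) (at t within {0..})"
  unfolding has_vector_derivative_def has_derivative_within_alt
proof (intro conjI allI impI bounded_linear_scaleR_left)
  fix e :: real assume "0 < e"
  then show "\<exists>d>0. \<forall>s\<in>{0..}. norm (s - t) < d \<longrightarrow> norm (x s k - x t k - (s - t) *\<^sub>R v k) \<le> e * norm (s - t)"
    using has_lp_derivative_uniform[OF assms, of e] unfolding real_norm_def by (meson atLeast_iff)
qed

lemma has_lp_derivative_unique:
  assumes "1 \<le> p" "has_lp_derivative p x v t" "has_lp_derivative p x w t" "0 \<le> t"
  shows "v = w"
proof
  fix k
  \<comment> \<open>The approach from the right is available at every t >= 0, also at 0, and makes
    the filter nontrivial.\<close>
  have "at_right t \<le> at t within {0..}" using assms(4) by (intro at_le) auto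
  then have "at t within {0..} \<noteq> bot" using trivial_limit_at_right_real[of t] by (auto simp: bot_unique)
  then show "v k = w k"
    using has_lp_derivative_component[OF assms(1,2,4)] has_lp_derivative_component[OF assms(1,3,4)]
    by (rule vector_derivative_unique_within)
qed

text \<open>Differentiability bounds the path near each time, and bisection glues the local bounds.
  The result is uniform in the site, as the iteration for uniqueness requires of its starting
  bound.\<close>

lemma has_lp_derivative_bounded:
  assumes p: "1 \<le> p" and R: "0 \<le> R" and D: "\<And>t. 0 \<le> t \<Longrightarrow> has_lp_derivative p x (v t) t"
  shows "\<exists>B. \<forall>t\<in>{0..R}. \<forall>k. norm (x t k) \<le> B"
proof -
  \<comment> \<open>Intervals in the bisection may reach below 0, where nothing is assumed of the
    path; the guard \<open>0 \<le> t\<close> excludes those times.\<close>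
  have "\<exists>B. \<forall>t\<in>{0..R}. 0 \<le> t \<longrightarrow> (\<forall>k. norm (x t k) \<le> B)"
    using R
  proof (induction rule: Bolzano[where P = "\<lambda>a b. \<exists>B. \<forall>t\<in>{a..b}. 0 \<le> t \<longrightarrow> (\<forall>k. norm (x t k) \<le> B)"])
    case (trans a b c)
    then obtain B B' where B: "\<And>t k. t \<in> {a..b} \<Longrightarrow> 0 \<le> t \<Longrightarrow> norm (x t k) \<le> B"
        "\<And>t k. t \<in> {b..c} \<Longrightarrow> 0 \<le> t \<Longrightarrow> norm (x t k) \<le> B'" by blast
    have "norm (x t k) \<le> max B B'" if "t \<in> {a..c}" "0 \<le> t" for t k
      using B[of t k] that by (cases "t \<le> b") auto
    then show ?case by blast
  next
    case (local t)
    obtain d where d: "d > 0" "\<And>s k. 0 \<le> s \<Longrightarrow> \<bar>s - t\<bar> < d \<Longrightarrow> norm (x s k - x t k - (s - t) *\<^sub>R v t k) \<le> 1 * \<bar>s - t\<bar>"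
      using has_lp_derivative_uniform[OF p D[OF local(1)] local(1), of 1] by auto
    have sp: "x t \<in> lp_space p" "v t \<in> lp_space p" using D[OF local(1)] local(1) by (auto simp: has_lp_derivative_def)
    have "norm (x s k) \<le> lp_norm p (x t) + d * lp_norm p (v t) + d" if s: "0 \<le> s" "\<bar>s - t\<bar> < d" for s k
    proof -
      have "norm (x s k) \<le> norm (x t k) + norm ((s - t) *\<^sub>R v t k) + norm (x s k - x t k - (s - t) *\<^sub>R v t k)"
        using norm_triangle_ineq[of "x t k + (s - t) *\<^sub>R v t k" "x s k - x t k - (s - t) *\<^sub>R v t k"]
          norm_triangle_ineq[of "x t k" "(s - t) *\<^sub>R v t k"] by simp
      also have "norm (x t k) \<le> lp_norm p (x t)" by (rule lp_bound_component[OF p lp_bound_norm[OF sp(1)]])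
      also have "norm ((s - t) *\<^sub>R v t k) \<le> d * lp_norm p (v t)"
        using lp_bound_component[OF p lp_bound_norm[OF sp(2)], of k] s d(1) by (auto intro!: mult_mono)
      also have "norm (x s k - x t k - (s - t) *\<^sub>R v t k) \<le> d" using d(2)[OF s, of k] s by simp
      finally show ?thesis by simp
    qed
    note * = this
    have "\<exists>B. \<forall>s\<in>{a..b}. 0 \<le> s \<longrightarrow> (\<forall>k. norm (x s k) \<le> B)" if "a \<le> t \<and> t \<le> b \<and> b - a < d" for a b
    proof -
      have "norm (x s k) \<le> lp_norm p (x t) + d * lp_norm p (v t) + d" if "s \<in> {a..b}" "0 \<le> s" for s k
        using \<open>a \<le> t \<and> t \<le> b \<and> b - a < d\<close> that by (intro *) auto
      then show ?thesis by blast
    qed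
    then show ?case using d(1) by blast
  qed
  then show ?thesis by auto
qed

text \<open>The difference of two solutions starts at 0 and is bounded over sites and over [0, t].
  Since its derivative is at most L times its supremum over sites, repeated integration improves the
  bound B to B (L s)^n / n!, which tends to 0.\<close>

lemma platoon_solution_unique:
  assumes \<zeta>: "0 < \<zeta>" and p: "1 \<le> p" and x: "platoon_solution p \<zeta> x0 x" and y: "platoon_solution p \<zeta> x0 y" and t: "0 \<le> t"
  shows "x t = y t"
proof
  fix j
  define L where "L = 3 + \<zeta>^3 + 3 * \<zeta>^2 + 3 * \<zeta>"
  define d where "d s = (\<lambda>k. x s k - y s k)" for s
  have Dx: "has_lp_derivative p x (platoon_op \<zeta> (x s)) s" and Dy: "has_lp_derivative p y (platoon_op \<zeta> (y s)) s" if "0 \<le> s" for s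
    using x y that by (auto simp: platoon_solution_def)
  obtain Bx where Bx: "\<And>s k. s \<in> {0..t} \<Longrightarrow> norm (x s k) \<le> Bx"
    using has_lp_derivative_bounded[OF p t Dx] by blast
  obtain By where By: "\<And>s k. s \<in> {0..t} \<Longrightarrow> norm (y s k) \<le> By"
    using has_lp_derivative_bounded[OF p t Dy] by blast
  define B where "B = Bx + By"
  have d0: "d 0 k = 0" for k using x y by (simp add: platoon_solution_def d_def)
  have Dd: "((\<lambda>s. d s k) has_vector_derivative platoon_op \<zeta> (d s) k) (at s within {0..})" if "0 \<le> s" for s k
  proof -
    have "((\<lambda>s. d s k) has_vector_derivative platoon_op \<zeta> (x s) k - platoon_op \<zeta> (y s) k) (at s within {0..})"
      unfolding d_def by (intro has_vector_derivative_diff has_lp_derivative_component[OF p] Dx Dy that)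
    then show ?thesis by (simp add: d_def platoon_op_def matrix_vector_mult_diff_distrib algebra_simps)
  qed
  \<comment> \<open>The operator bound is taken in the supremum norm over sites, whatever
    \<open>p\<close> is.\<close>
  have op: "norm (platoon_op \<zeta> (d s) k) \<le> L * C" if "\<And>k. norm (d s k) \<le> C" for s k C
    using lp_bound_platoon_op[OF \<zeta>, of \<infinity> "d s" C] that by (simp add: lp_bound_infinity L_def)
  have iter: "norm (d s k) \<le> B * ((L * s) ^ n / fact n)" if "s \<in> {0..t}" for s k n
    using that
  proof (induction n arbitrary: s k)
    case 0
    then show ?case using norm_triangle_ineq4[of "x s k" "y s k"] add_mono[OF Bx[OF 0] By[OF 0], of k k]
      unfolding d_def B_def by simp
  next
    case (Suc n)
    show ?case
    proof (cases "s = 0")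
      case False
      let ?\<phi> = "\<lambda>s. B * ((L * s) ^ Suc n / fact (Suc n))"
      have "norm (d s k - d 0 k) \<le> ?\<phi> s - ?\<phi> 0"
      proof (rule differentiable_bound_general[where f' = "\<lambda>u. platoon_op \<zeta> (d u) k"
            and \<phi>' = "\<lambda>u. L * (B * ((L * u) ^ n / fact n))"])
        show "0 < s" using Suc False by simp
        show "continuous_on {0..s} (\<lambda>u. d u k)"
          by (rule continuous_on_vector_derivative[OF has_vector_derivative_within_subset[OF Dd]]) auto
        show "continuous_on {0..s} ?\<phi>" by (intro continuous_intros) auto
        fix u assume u: "0 < u" "u < s"
        show "((\<lambda>u. d u k) has_vector_derivative platoon_op \<zeta> (d u) k) (at u)"
          using Dd[of u k] u at_within_interior[of u "{0..}"] by simp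
        show "norm (platoon_op \<zeta> (d u) k) \<le> L * (B * ((L * u) ^ n / fact n))"
          using u Suc.prems by (intro op Suc.IH) auto
        have "(?\<phi> has_real_derivative B * ((real (Suc n) * (L * (L * u) ^ n)) / fact (Suc n))) (at u)"
          by (auto intro!: derivative_eq_intros simp del: power_Suc fact_Suc of_nat_Suc)
        moreover have "B * ((real (Suc n) * (L * (L * u) ^ n)) / fact (Suc n)) = L * (B * ((L * u) ^ n / fact n))"
          by (simp only: fact_Suc of_nat_mult of_nat_fact) (simp add: mult.commute mult.left_commute del: of_nat_Suc)
        ultimately show "(?\<phi> has_vector_derivative L * (B * ((L * u) ^ n / fact n))) (at u)"
          by (simp only: has_real_derivative_iff_has_vector_derivative)
      qed
      then show ?thesis by (simp add: d0)
    qed (simp add: d0)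
  qed
  have "(\<lambda>n. B * ((L * t) ^ n / fact n)) \<longlonglongrightarrow> B * 0"
    by (intro tendsto_mult tendsto_const summable_LIMSEQ_zero[OF sums_summable[OF exp_sums]])
  then have "norm (d t j) \<le> B * 0"
    by (rule LIMSEQ_le_const) (use iter t in auto)
  then show "x t j = y t j" by (simp add: d_def)
qed

section \<open>Cesaro means and the limit\<close>

text \<open>The coefficients are backward differences of Poisson weights, with l^1 norm at most
  \<tau>^(-1/2). The decay of orbits and of derivatives below rests on this estimate.\<close>

lemma lp_bound_semigroup_step_diff:
  assumes "0 < \<zeta>" "1 \<le> p" "lp_bound p x B" "0 < t"
  shows "lp_bound p (platoon_semigroup \<zeta> t (\<lambda>k. platoon_step \<zeta> x k - x k))
    ((platoon_step_const \<zeta>)\<^sup>2 * B * (\<zeta> * t) powr (-1/2))"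
proof -
  have \<tau>: "0 < \<zeta> * t" using assms by simp
  have "platoon_semigroup \<zeta> t (\<lambda>k. platoon_step \<zeta> x k - x k) = step_series \<zeta> (backward_diff (poisson_weight (\<zeta> * t))) x"
    using step_series_step_diff[OF assms(1,2) lp_space_I[OF assms(3)] poisson_weight_summable]
    by (auto simp: platoon_semigroup_def)
  moreover have "(platoon_step_const \<zeta>)\<^sup>2 * B * (\<Sum>n. \<bar>backward_diff (poisson_weight (\<zeta> * t)) n\<bar>)
      \<le> (platoon_step_const \<zeta>)\<^sup>2 * B * (\<zeta> * t) powr (-1/2)"
    using lp_bound_nonneg[OF assms(3)] by (intro mult_left_mono backward_diff_poisson_weight_l1 \<tau>) auto
  ultimately show ?thesis
    using lp_bound_mono[OF lp_bound_step_series[OF assms(1-3) backward_diff_poisson_weight_l1(1)[OF \<tau>]]] by simp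
qed

lemma platoon_op_semigroup:
  assumes "0 < \<zeta>" "1 \<le> p" "x \<in> lp_space p"
  shows "platoon_op \<zeta> (platoon_semigroup \<zeta> t x) k
    = \<zeta> *\<^sub>R platoon_semigroup \<zeta> t (\<lambda>k. platoon_step \<zeta> x k - x k) k"
  using platoon_op_step_series[OF assms poisson_weight_summable] step_series_step_diff[OF assms poisson_weight_summable]
  by (simp add: platoon_semigroup_def)

lemma lp_bound_platoon_op_semigroup:
  assumes "0 < \<zeta>" "1 \<le> p" "lp_bound p x B" "0 < t"
  shows "lp_bound p (platoon_op \<zeta> (platoon_semigroup \<zeta> t x))
    (\<zeta> * (platoon_step_const \<zeta>)\<^sup>2 * B * (\<zeta> * t) powr (-1/2))"
proof -
  have "platoon_op \<zeta> (platoon_semigroup \<zeta> t x)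
      = (\<lambda>k. \<zeta> *\<^sub>R platoon_semigroup \<zeta> t (\<lambda>k. platoon_step \<zeta> x k - x k) k)"
    by (rule ext) (rule platoon_op_semigroup[OF assms(1,2) lp_space_I[OF assms(3)]])
  then show ?thesis
    using lp_bound_scaleR[OF assms(2) lp_bound_semigroup_step_diff[OF assms], of \<zeta>] assms(1)
    by (simp add: mult.assoc)
qed

section \<open>Cesaro and Abel means of the shift\<close>

text \<open>At n = 0 this is the zero sequence, whereas \<open>cesaro_error p y c 0\<close> measures
  the constant -c; the two are therefore related for n > 0.\<close>

definition cesaro_mean :: "nat \<Rightarrow> (int \<Rightarrow> 'a::real_vector) \<Rightarrow> int \<Rightarrow> 'a" where
  "cesaro_mean n y k = (1 / real n) *\<^sub>R (\<Sum>j=1..n. y (k - int j))"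

lemma cesaro_error_eq:
  assumes "0 < n"
  shows "cesaro_error p y c n = lp_norm p (cesaro_mean n (\<lambda>k. y k - c))"
proof -
  have "(1 / of_nat n) * (\<Sum>j=1..n. (right_shift ^^ j) y k) - c = cesaro_mean n (\<lambda>k. y k - c) k" for k
    using assms by (simp add: cesaro_mean_def right_shift_funpow sum_subtractf scaleR_conv_of_real field_simps)
  then show ?thesis by (simp add: cesaro_error_def)
qed

lemma lp_bound_cesaro_mean:
  assumes "1 \<le> p" "lp_bound p y B" shows "lp_bound p (cesaro_mean n y) B"
proof -
  have "lp_bound p (\<lambda>k. \<Sum>j=1..n. y (k + - int j)) (\<Sum>j=1..n. B)"
    by (intro lp_bound_sum lp_bound_translate assms)
  then have "lp_bound p (cesaro_mean n y) (\<bar>1 / real n\<bar> * (n * B))"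
    unfolding cesaro_mean_def[abs_def] by (intro lp_bound_scaleR assms) simp
  moreover have "\<bar>1 / real n\<bar> * (n * B) \<le> B" using lp_bound_nonneg[OF assms(2)] by (cases "n = 0") auto
  ultimately show ?thesis using lp_bound_mono by blast
qed

lemma cesaro_mean_in_lp: "1 \<le> p \<Longrightarrow> y \<in> lp_space p \<Longrightarrow> cesaro_mean n y \<in> lp_space p"
  by (rule lp_space_I[OF lp_bound_cesaro_mean[OF _ lp_bound_norm]])

lemma cesaro_error_nonneg:
  assumes "1 \<le> p" "y \<in> lp_space p" "(\<lambda>_. c) \<in> lp_space p" "0 < n"
  shows "0 \<le> cesaro_error p y c n"
  unfolding cesaro_error_eq[OF assms(4)]
  by (intro lp_norm_nonneg cesaro_mean_in_lp lp_space_diff assms)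

text \<open>The mean of (1 + S + ... + S^(j-1)) y over j = 1, ..., n: an approximate solution
  \<open>v\<close> of (1 - S) v = y.\<close>

definition abel_mean :: "nat \<Rightarrow> (int \<Rightarrow> 'a::real_vector) \<Rightarrow> int \<Rightarrow> 'a" where
  "abel_mean n y k = (1 / real n) *\<^sub>R (\<Sum>j=1..n. \<Sum>i<j. y (k - int i))"

text \<open>1 - S^j = (1 - S)(1 + ... + S^(j-1)), averaged over j.\<close>

lemma cesaro_abel_decomposition:
  assumes "0 < n"
  shows "y k = abel_mean n y k - abel_mean n y (k - 1) + cesaro_mean n y k"
proof -
  have "(\<Sum>i<j. y (k - int i)) - (\<Sum>i<j. y (k - 1 - int i)) = y k - y (k - int j)" for j
    by (induction j) (auto simp: algebra_simps)
  then have "(\<Sum>j=1..n. \<Sum>i<j. y (k - int i)) - (\<Sum>j=1..n. \<Sum>i<j. y (k - 1 - int i))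
      = real n *\<^sub>R y k - (\<Sum>j=1..n. y (k - int j))"
    by (simp add: sum_subtractf[symmetric]) (simp add: sum_subtractf sum_constant_scaleR)
  then show ?thesis using assms
    by (simp add: abel_mean_def cesaro_mean_def scaleR_diff_right[symmetric]) (simp add: scaleR_diff_right)
qed

text \<open>Serves (b), where the partial sums have a bound independent of \<open>n\<close>; for (a)
  membership of each single Abel mean is enough.\<close>

lemma lp_bound_abel_mean:
  assumes "1 \<le> p" "0 < n" "\<And>j. j \<in> {1..n} \<Longrightarrow> lp_bound p (\<lambda>k. \<Sum>i<j. y (k - int i)) V"
  shows "lp_bound p (abel_mean n y) V"
proof -
  have "lp_bound p (\<lambda>k. \<Sum>j=1..n. \<Sum>i<j. y (k - int i)) (\<Sum>j=1..n. V)"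
    by (rule lp_bound_sum[OF assms(1,3)])
  then have "lp_bound p (abel_mean n y) (\<bar>1 / real n\<bar> * (n * V))"
    unfolding abel_mean_def[abs_def] by (intro lp_bound_scaleR assms) simp
  then show ?thesis using assms(2) by simp
qed

lemma abel_mean_in_lp:
  assumes p: "1 \<le> p" and y: "y \<in> lp_space p" shows "abel_mean n y \<in> lp_space p"
proof -
  have "lp_bound p (\<lambda>k. \<Sum>j=1..n. \<Sum>i<j. y (k + - int i)) (\<Sum>j=1..n. \<Sum>i<j. lp_norm p y)"
    by (intro lp_bound_sum p lp_bound_translate lp_bound_norm y)
  then have "lp_bound p (abel_mean n y) (\<bar>1 / real n\<bar> * (\<Sum>j=1..n. \<Sum>i<j. lp_norm p y))"
    unfolding abel_mean_def[abs_def] by (intro lp_bound_scaleR p) simp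
  then show ?thesis by (rule lp_space_I)
qed

lemma first_comp_in_lp: "1 \<le> p \<Longrightarrow> x \<in> lp_space p \<Longrightarrow> first_comp x \<in> lp_space p"
  using lp_bound_cmult_dominated[OF _ lp_bound_norm, of p x 1 "first_comp x"]
  by (auto simp: first_comp_def Finite_Cartesian_Product.norm_nth_le intro: lp_space_I)

lemma lp_bound_first_comp: "1 \<le> p \<Longrightarrow> lp_bound p x B \<Longrightarrow> lp_bound p (first_comp x) B"
  using lp_bound_cmult_dominated[of p x B 1 "first_comp x"]
  by (auto simp: first_comp_def Finite_Cartesian_Product.norm_nth_le)

lemma lp_bound_embed_first:
  assumes "1 \<le> p" "lp_bound p y B" shows "lp_bound p (\<lambda>k. vector [y k, 0, 0] :: complex^3) B"
proof -
  have "norm (vector [y k, 0, 0] :: complex^3) \<le> 1 * norm (y k)" for k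
    using norm_vec3_le[of "vector [y k, 0, 0]"] by simp
  then show ?thesis using lp_bound_cmult_dominated[OF assms, of 1] by fastforce
qed

text \<open>The range of \<open>C - 1\<close> consists of the sequences whose first component lies in the range of
  \<open>1 - S\<close>: the other two components impose no condition.\<close>

lemma step_range_decomposition:
  assumes \<zeta>: "0 < \<zeta>" and p: "1 \<le> p" and n: "0 < n"
    and x: "lp_bound p x X" and v: "lp_bound p (abel_mean n (first_comp x)) V"
  obtains w where "lp_bound p w ((1 / \<zeta>\<^sup>2 + 3 / \<zeta> + \<zeta>) * X + (3 + \<zeta>) * V)"
    and "\<And>k. x k = (platoon_step \<zeta> w k - w k) + vector [cesaro_mean n (first_comp x) k, 0, 0]"
proof
  define v where "v = abel_mean n (first_comp x)"
  \<comment> \<open>The solution of (C - 1) w = x - (m, 0, 0), with m the Cesaro mean: the first row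
    gives w_2 = \<zeta> v because x_1 - m = v - S v, the second gives w_3 = \<zeta> x_2, and the
    third is then solved for w_1.\<close>
  define w :: "int \<Rightarrow> complex^3" where
    "w = (\<lambda>k. vector [- (x k $ 3 + of_real (3 * \<zeta>\<^sup>2) * v k + of_real (3 * \<zeta>) * x k $ 2) / of_real (\<zeta>\<^sup>2),
      of_real \<zeta> * v k, of_real \<zeta> * x k $ 2])"
  show "lp_bound p w ((1 / \<zeta>\<^sup>2 + 3 / \<zeta> + \<zeta>) * X + (3 + \<zeta>) * V)"
  proof (rule lp_bound_mono[OF lp_bound_add_dominated[OF p lp_bound_scaleR[OF p x] lp_bound_scaleR[OF p assms(5)]]])
    fix k
    have n: "norm (x k $ i) \<le> norm (x k)" for i by (rule Finite_Cartesian_Product.norm_nth_le)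
    have "norm (w k $ 1) \<le> (norm (x k $ 3) + 3 * \<zeta>\<^sup>2 * norm (v k) + 3 * \<zeta> * norm (x k $ 2)) / \<zeta>\<^sup>2"
    proof -
      have "norm (w k $ 1) = norm (x k $ 3 + of_real (3 * \<zeta>\<^sup>2) * v k + of_real (3 * \<zeta>) * x k $ 2) / \<zeta>\<^sup>2"
        unfolding w_def vector_3 norm_divide norm_minus_cancel norm_of_real by simp
      also have "\<dots> \<le> (norm (x k $ 3) + norm (of_real (3 * \<zeta>\<^sup>2) * v k) + norm (of_real (3 * \<zeta>) * x k $ 2)) / \<zeta>\<^sup>2"
        by (intro divide_right_mono norm_triangle_mono) auto
      finally show ?thesis using \<zeta> by (simp only: norm_mult norm_of_real) simp
    qed
    also have "\<dots> \<le> (norm (x k) + 3 * \<zeta>\<^sup>2 * norm (v k) + 3 * \<zeta> * norm (x k)) / \<zeta>\<^sup>2"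
      using \<zeta> by (intro divide_right_mono add_mono mult_left_mono n) auto
    also have "\<dots> = (1 / \<zeta>\<^sup>2 + 3 / \<zeta>) * norm (x k) + 3 * norm (v k)"
      using \<zeta> by (simp add: field_simps power2_eq_square)
    finally have 1: "norm (w k $ 1) \<le> (1 / \<zeta>\<^sup>2 + 3 / \<zeta>) * norm (x k) + 3 * norm (v k)" .
    have 2: "norm (w k $ 2) = \<zeta> * norm (v k)" "norm (w k $ 3) \<le> \<zeta> * norm (x k)"
      using \<zeta> n by (simp_all add: w_def norm_mult)
    have "norm (w k) \<le> (1 / \<zeta>\<^sup>2 + 3 / \<zeta> + \<zeta>) * norm (x k) + (3 + \<zeta>) * norm (v k)"
      using norm_vec3_le[of "w k"] 1 2 by (simp add: distrib_right)
    then show "norm (w k) \<le> norm ((1 / \<zeta>\<^sup>2 + 3 / \<zeta> + \<zeta>) *\<^sub>R x k) + norm ((3 + \<zeta>) *\<^sub>R abel_mean n (first_comp x) k)"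
      using \<zeta> by (simp add: v_def)
  qed (use \<zeta> in simp)
  fix k
  have "x k $ 1 = v k - v (k - 1) + cesaro_mean n (first_comp x) k"
    using cesaro_abel_decomposition[OF n, of "first_comp x" k] by (simp add: first_comp_def v_def)
  then have "x k $ i = ((platoon_step \<zeta> w k - w k) + vector [cesaro_mean n (first_comp x) k, 0, 0]) $ i" for i
    using exhaust_3[of i] \<zeta>
    by (elim disjE) (simp_all add: platoon_step_nth w_def diff_divide_distrib power2_eq_square, simp add: field_simps)
  then show "x k = (platoon_step \<zeta> w k - w k) + vector [cesaro_mean n (first_comp x) k, 0, 0]"
    by (simp add: vec_eq_iff)
qed

lemma platoon_limit_in_lp:
  assumes "0 < \<zeta>" "1 \<le> p" "(\<lambda>_. c) \<in> lp_space p" shows "platoon_limit \<zeta> c \<in> lp_space p"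
proof -
  have "norm (platoon_limit \<zeta> c k) \<le> (1 + \<zeta>) * norm c" for k
  proof -
    have "norm (platoon_limit \<zeta> c k) \<le> norm c + \<zeta> * norm c / 3"
      using norm_vec3_le[of "platoon_limit \<zeta> c k"] assms(1)
      by (simp add: platoon_limit_def norm_mult norm_divide)
    moreover have "0 \<le> \<zeta> * norm c" using assms(1) by simp
    ultimately show ?thesis unfolding distrib_right by linarith
  qed
  then show ?thesis
    using assms(1) lp_bound_cmult_dominated[OF assms(2) lp_bound_norm[OF assms(3)], of "1 + \<zeta>" "platoon_limit \<zeta> c"]
    by (auto intro: lp_space_I)
qed

lemma platoon_semigroup_platoon_limit:
  assumes "\<zeta> \<noteq> 0" shows "platoon_semigroup \<zeta> t (platoon_limit \<zeta> c) = platoon_limit \<zeta> c"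
proof
  fix k
  have "platoon_step \<zeta> (platoon_limit \<zeta> c) k $ i = platoon_limit \<zeta> c k $ i" for i k
    using exhaust_3[of i] assms
    by (elim disjE) (simp_all add: platoon_step_nth platoon_limit_def power2_eq_square)
  then have "platoon_step \<zeta> (platoon_limit \<zeta> c) = platoon_limit \<zeta> c" by (simp add: fun_eq_iff vec_eq_iff)
  then have "(platoon_step \<zeta> ^^ n) (platoon_limit \<zeta> c) = platoon_limit \<zeta> c" for n
    by (induction n) auto
  then show "platoon_semigroup \<zeta> t (platoon_limit \<zeta> c) k = platoon_limit \<zeta> c k"
    using sums_unique[OF sums_scaleR_left[OF poisson_weight_sums[of "\<zeta> * t"], of "platoon_limit \<zeta> c k"]]
    by (simp add: platoon_semigroup_def step_series_def)
qed

lemma platoon_semigroup_diff: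
  assumes "0 < \<zeta>" "1 \<le> p" "x \<in> lp_space p" "y \<in> lp_space p"
  shows "platoon_semigroup \<zeta> t (\<lambda>k. x k - y k) k = platoon_semigroup \<zeta> t x k - platoon_semigroup \<zeta> t y k"
  unfolding platoon_semigroup_def by (rule step_series_diff[OF assms poisson_weight_summable])

text \<open>\<open>x - z\<close> is split as (C - 1) w + e, with \<open>e\<close> the embedded
  Cesaro mean of its first component. The first part decays; the second stays as small as the Cesaro
  error. The free index \<open>n\<close> trades the size of \<open>w\<close> against that
  error.\<close>

lemma lp_bound_semigroup_limit:
  assumes \<zeta>: "0 < \<zeta>" and p: "1 \<le> p" and x: "x \<in> lp_space p" and c: "(\<lambda>_. c) \<in> lp_space p"
    and n: "0 < n" and t: "0 < t" and V: "lp_bound p (abel_mean n (\<lambda>k. first_comp x k - c)) V"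
  shows "lp_bound p (\<lambda>k. platoon_semigroup \<zeta> t x k - platoon_limit \<zeta> c k)
    ((platoon_step_const \<zeta>)\<^sup>2 * ((1 / \<zeta>\<^sup>2 + 3 / \<zeta> + \<zeta>) * lp_norm p (\<lambda>k. x k - platoon_limit \<zeta> c k) + (3 + \<zeta>) * V)
       * (\<zeta> * t) powr (-1/2) + (platoon_step_const \<zeta>)\<^sup>2 * cesaro_error p (first_comp x) c n)"
proof -
  let ?u = "\<lambda>k. x k - platoon_limit \<zeta> c k"
  let ?W = "(1 / \<zeta>\<^sup>2 + 3 / \<zeta> + \<zeta>) * lp_norm p ?u + (3 + \<zeta>) * V"
  note z = platoon_limit_in_lp[OF \<zeta> p c]
  have fu: "first_comp ?u = (\<lambda>k. first_comp x k - c)"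
    by (simp add: first_comp_def platoon_limit_def fun_eq_iff)
  obtain w where w: "lp_bound p w ?W"
    and u: "\<And>k. ?u k = (platoon_step \<zeta> w k - w k) + vector [cesaro_mean n (first_comp ?u) k, 0, 0]"
    using step_range_decomposition[OF \<zeta> p n lp_bound_norm[OF lp_space_diff[OF p x z]] V[folded fu]] by blast
  define e :: "int \<Rightarrow> complex^3" where "e = (\<lambda>k. vector [cesaro_mean n (first_comp ?u) k, 0, 0])"
  define d where "d = (\<lambda>k. platoon_step \<zeta> w k - w k)"
  have "lp_bound p (cesaro_mean n (first_comp ?u)) (cesaro_error p (first_comp x) c n)"
    unfolding cesaro_error_eq[OF n] fu
    by (intro lp_bound_norm cesaro_mean_in_lp lp_space_diff first_comp_in_lp p x c)
  note e = lp_bound_embed_first[OF p this, folded e_def]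
  have "?u k = d k + e k" for k unfolding d_def e_def by (rule u)
  then have "d = (\<lambda>k. ?u k - e k)" by (auto simp: fun_eq_iff)
  then have "platoon_semigroup \<zeta> t d k = platoon_semigroup \<zeta> t ?u k - platoon_semigroup \<zeta> t e k" for k
    using platoon_semigroup_diff[OF \<zeta> p lp_space_diff[OF p x z] lp_space_I[OF e], of t k] by simp
  then have "platoon_semigroup \<zeta> t x k - platoon_limit \<zeta> c k = platoon_semigroup \<zeta> t d k + platoon_semigroup \<zeta> t e k" for k
    using platoon_semigroup_diff[OF \<zeta> p x z, of t k] platoon_semigroup_platoon_limit[of \<zeta> t c] \<zeta> by simp
  then show ?thesis
    using lp_bound_add[OF p lp_bound_semigroup_step_diff[OF \<zeta> p w t, folded d_def] lp_bound_platoon_semigroup[OF \<zeta> p e, of t]] t by simp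
qed

lemma lp_bound_nth: "1 \<le> p \<Longrightarrow> lp_bound p x B \<Longrightarrow> lp_bound p (\<lambda>k. x k $ i) B"
  for x :: "int \<Rightarrow> complex^3"
  using lp_bound_cmult_dominated[of p x B 1 "\<lambda>k. x k $ i"] by (auto simp: Finite_Cartesian_Product.norm_nth_le)

lemma cesaro_mean_telescope:
  "cesaro_mean n (\<lambda>k. g k - g (k - 1)) k = (1 / real n) *\<^sub>R (g (k - 1) - g (k - 1 - int n))"
proof -
  have "(\<Sum>j=1..n. g (k - int j) - g (k - int j - 1)) = g (k - 1) - g (k - 1 - int n)"
    by (induction n) (simp_all add: algebra_simps)
  then show ?thesis by (simp add: cesaro_mean_def)
qed

text \<open>Along an orbit the first component moves by increments in the range of \<open>1 - S\<close>, so the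
  Cesaro means do not see the motion in the limit.\<close>

lemma lp_bound_cesaro_orbit:
  assumes \<zeta>: "0 < \<zeta>" and p: "1 \<le> p" and x: "lp_bound p x X" and t: "0 \<le> t"
  shows "lp_bound p (cesaro_mean n (\<lambda>k. first_comp x k - first_comp (platoon_semigroup \<zeta> t x) k))
    (2 * t * (platoon_step_const \<zeta>)\<^sup>2 * X / real n)"
proof -
  let ?M = "(platoon_step_const \<zeta>)\<^sup>2"
  let ?P = "poisson_weight (\<zeta> * t)"
  let ?C = "\<lambda>m. (platoon_step \<zeta> ^^ m) x"
  define h where "h m k = ?P m *\<^sub>R (first_comp x k - first_comp (?C m) k)" for m k
  \<comment> \<open>One application of \<open>C\<close> adds (1 - S) of the second component, over
    \<zeta>, to the first. Summed over the powers below m, this exhibits the change as (1 - S) of a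
    sequence \<open>G m\<close> whose norm grows linearly in m.\<close>
  define G where "G m k = (\<Sum>l<m. (- 1 / \<zeta>) *\<^sub>R (?C l k $ 2))" for m k
  have P: "0 \<le> ?P m" for m using \<zeta> t by (simp add: poisson_weight_nonneg)
  have X: "0 \<le> X" by (rule lp_bound_nonneg[OF x])
  have h_sums: "(\<lambda>m. h m k) sums (first_comp x k - first_comp (platoon_semigroup \<zeta> t x) k)" for k
  proof -
    have "(\<lambda>m. ?P m *\<^sub>R x k - ?P m *\<^sub>R ?C m k) sums (1 *\<^sub>R x k - platoon_semigroup \<zeta> t x k)"
      unfolding platoon_semigroup_def step_series_def
      by (intro sums_diff sums_scaleR_left poisson_weight_sums summable_sums
          summable_step_series[OF \<zeta> p x poisson_weight_summable])
    from bounded_linear.sums[OF bounded_linear_vec_nth this, of 1] show ?thesis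
      by (simp add: h_def first_comp_def scaleR_diff_right)
  qed
  have c_sums: "(\<lambda>m. cesaro_mean n (h m) k) sums cesaro_mean n (\<lambda>k. first_comp x k - first_comp (platoon_semigroup \<zeta> t x) k) k" for k
    unfolding cesaro_mean_def by (intro sums_scaleR_right sums_sum h_sums)
  have diff: "first_comp x k - first_comp (?C m) k = G m k - G m (k - 1)" for m k
  proof (induction m)
    case (Suc m)
    have "first_comp (?C (Suc m)) k = first_comp (?C m) k + (1 / \<zeta>) *\<^sub>R (?C m k $ 2 - ?C m (k - 1) $ 2)"
      by (simp add: first_comp_def platoon_step_nth scaleR_conv_of_real)
    moreover have "G (Suc m) j = G m j - (1 / \<zeta>) *\<^sub>R (?C m j $ 2)" for j by (simp add: G_def)
    ultimately show ?case using Suc by (simp only: scaleR_diff_right) (simp add: algebra_simps del: funpow.simps)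
  qed (simp add: G_def)
  have G: "lp_bound p (G m) (real m * (?M * X / \<zeta>))" for m
  proof -
    have "lp_bound p (G m) (\<Sum>l<m. \<bar>- 1 / \<zeta>\<bar> * (?M * X))"
      unfolding G_def[abs_def] by (intro lp_bound_sum lp_bound_scaleR lp_bound_nth lp_bound_platoon_step_funpow \<zeta> p x)
    then show ?thesis using \<zeta> by simp
  qed
  have b: "lp_bound p (cesaro_mean n (h m)) ((real m * ?P m) * (2 * ?M * X / (\<zeta> * real n)))" for m
  proof -
    have "cesaro_mean n (h m) = (\<lambda>k. (?P m / real n) *\<^sub>R (G m (k + - 1) - G m (k + (- 1 - int n))))"
    proof
      fix k
      have "h m = (\<lambda>k. ?P m *\<^sub>R G m k - ?P m *\<^sub>R G m (k - 1))"
        by (simp add: h_def fun_eq_iff diff scaleR_diff_right)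
      then show "cesaro_mean n (h m) k = (?P m / real n) *\<^sub>R (G m (k + - 1) - G m (k + (- 1 - int n)))"
        using cesaro_mean_telescope[of n "\<lambda>k. ?P m *\<^sub>R G m k" k] by (simp add: scaleR_diff_right algebra_simps)
    qed
    moreover have "lp_bound p (\<lambda>k. (?P m / real n) *\<^sub>R (G m (k + - 1) - G m (k + (- 1 - int n))))
        (\<bar>?P m / real n\<bar> * (real m * (?M * X / \<zeta>) + real m * (?M * X / \<zeta>)))"
      by (intro lp_bound_scaleR lp_bound_diff lp_bound_translate G p)
    moreover have "\<bar>?P m / real n\<bar> * (real m * (?M * X / \<zeta>) + real m * (?M * X / \<zeta>))
        = (real m * ?P m) * (2 * ?M * X / (\<zeta> * real n))"
      using P by (simp add: mult_ac)
    ultimately show ?thesis by simp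
  qed
  \<comment> \<open>The linear growth in m meets the Poisson mean \<zeta>t, hence a bound linear in
    t; the \<zeta> cancels.\<close>
  have bs: "(\<lambda>m. (real m * ?P m) * (2 * ?M * X / (\<zeta> * real n))) sums ((\<zeta> * t) * (2 * ?M * X / (\<zeta> * real n)))"
    by (rule sums_mult2[OF poisson_mean_sums])
  have "lp_bound p (\<lambda>k. \<Sum>m. cesaro_mean n (h m) k) (\<Sum>m. (real m * ?P m) * (2 * ?M * X / (\<zeta> * real n)))"
    by (rule lp_bound_suminf(2)[OF p b sums_summable[OF bs]])
  then show ?thesis
    unfolding sums_unique[OF c_sums, symmetric] sums_unique[OF bs, symmetric] using \<zeta> by (simp add: mult_ac)
qed

lemma tendsto_powr_neg_half:
  fixes \<zeta> :: real
  shows "0 < \<zeta> \<Longrightarrow> ((\<lambda>t. (\<zeta> * t) powr (-1/2)) \<longlongrightarrow> 0) at_top"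
  by (intro tendsto_neg_powr filterlim_tendsto_pos_mult_at_top[OF tendsto_const] filterlim_ident) auto

lemma lp_bound_limit_zero:
  assumes "1 \<le> p" "\<forall>\<^sub>F t in F. lp_bound p x (b t)" "(b \<longlongrightarrow> (0::real)) F" "F \<noteq> bot"
  shows "x k = 0"
proof -
  have "\<forall>\<^sub>F t in F. norm (x k) \<le> b t"
    using assms(2) by eventually_elim (rule lp_bound_component[OF assms(1)])
  then have "norm (x k) \<le> 0" by (rule tendsto_lowerbound[OF assms(3) _ assms(4)])
  then show ?thesis by simp
qed

text \<open>Row 1 makes the second component independent of the site, row 2 kills the third, and row
  3 ties the first to the second. This identifies the possible limits of orbits.\<close>

lemma platoon_op_kernel:
  assumes "\<zeta> \<noteq> 0" "\<And>k. platoon_op \<zeta> z k = 0"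
  shows "z k = platoon_limit \<zeta> (z 0 $ 1) k"
proof -
  have 2: "z k $ 2 = z (k - 1) $ 2" and 3: "z k $ 3 = 0"
    and 1: "of_real (\<zeta>^3) * z k $ 1 + of_real (3 * \<zeta>^2) * z k $ 2 + of_real (3 * \<zeta>) * z k $ 3 = 0" for k
    using platoon_op_nth[of \<zeta> z k] assms(2)[of k] by (simp_all add: algebra_simps eq_neg_iff_add_eq_0)
  have c: "z k $ 2 = z 0 $ 2" for k
  proof (induction k rule: int_induct[where k = 0])
    case (step1 i) then show ?case using 2[of "i + 1"] by simp
  next
    case (step2 i) then show ?case using 2[of i] by simp
  qed simp
  have "of_real (\<zeta>\<^sup>2) * (of_real \<zeta> * z k $ 1 + 3 * z k $ 2) = 0" for k
    using 1[of k] 3[of k] by (simp add: algebra_simps power2_eq_square power3_eq_cube)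
  then have *: "of_real \<zeta> * z k $ 1 + 3 * z k $ 2 = 0" for k using assms(1) by simp
  then have "of_real \<zeta> * z k $ 1 = of_real \<zeta> * z 0 $ 1" for k
    using c[of k] by (metis add_right_cancel)
  then have 4: "z k $ 1 = z 0 $ 1" for k using assms(1) by simp
  have 5: "z k $ 2 = - of_real \<zeta> * z 0 $ 1 / 3" for k
    using *[of k] 4[of k] by (simp add: field_simps eq_neg_iff_add_eq_0)
  show ?thesis
    using 3[of k] 4[of k] 5[of k] by (simp add: vec_eq_iff forall_3 platoon_limit_def)
qed

text \<open>A z is A T(t)x minus A (T(t)x - z); both tend to 0, so A z = 0 and \<open>z\<close> is
  constant with some first component c. The Cesaro means are then split at time t: x - T(t)x
  contributes O(t/n), T(t)x - z at most its norm. Here t is chosen first and n afterwards.\<close>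

lemma platoon_semigroup_limit_imp_cesaro:
  assumes \<zeta>: "0 < \<zeta>" and p: "1 \<le> p" and x: "x \<in> lp_space p"
    and lim: "lp_converges_to p (\<lambda>t. platoon_semigroup \<zeta> t x) z"
  shows "\<exists>c. (\<lambda>_. c) \<in> lp_space p \<and> cesaro_error p (first_comp x) c \<longlonglongrightarrow> 0"
proof -
  let ?T = "\<lambda>t. platoon_semigroup \<zeta> t x"
  let ?M = "(platoon_step_const \<zeta>)\<^sup>2"
  let ?X = "lp_norm p x"
  let ?L = "3 + \<zeta>^3 + 3 * \<zeta>^2 + 3 * \<zeta>"
  have z: "z \<in> lp_space p" and lim0: "((\<lambda>t. lp_norm p (\<lambda>k. ?T t k - z k)) \<longlongrightarrow> 0) at_top"
    using lim by (auto simp: lp_converges_to_def)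
  have T: "?T t \<in> lp_space p" for t by (rule platoon_semigroup_in_lp[OF \<zeta> p x])
  have Tz: "lp_bound p (\<lambda>k. ?T t k - z k) (lp_norm p (\<lambda>k. ?T t k - z k))" for t
    by (intro lp_bound_norm lp_space_diff p T z)
  have "lp_bound p (platoon_op \<zeta> z) (\<zeta> * ?M * ?X * (\<zeta> * t) powr (-1/2) + ?L * lp_norm p (\<lambda>k. ?T t k - z k))"
    if "0 < t" for t
  proof -
    have "platoon_op \<zeta> z = (\<lambda>k. platoon_op \<zeta> (?T t) k - platoon_op \<zeta> (\<lambda>k. ?T t k - z k) k)"
      by (simp add: platoon_op_def fun_eq_iff matrix_vector_mult_diff_distrib)
    moreover have "lp_bound p (\<lambda>k. platoon_op \<zeta> (?T t) k - platoon_op \<zeta> (\<lambda>k. ?T t k - z k) k)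
      (\<zeta> * ?M * ?X * (\<zeta> * t) powr (-1/2) + ?L * lp_norm p (\<lambda>k. ?T t k - z k))"
      by (rule lp_bound_diff[OF p lp_bound_platoon_op_semigroup[OF \<zeta> p lp_bound_norm[OF x] that]
            lp_bound_platoon_op[OF \<zeta> p Tz]])
    ultimately show ?thesis by simp
  qed
  then have "\<forall>\<^sub>F t in at_top. lp_bound p (platoon_op \<zeta> z)
      (\<zeta> * ?M * ?X * (\<zeta> * t) powr (-1/2) + ?L * lp_norm p (\<lambda>k. ?T t k - z k))"
    by (rule eventually_mono[OF eventually_gt_at_top[of 0]])
  moreover have "((\<lambda>t. \<zeta> * ?M * ?X * (\<zeta> * t) powr (-1/2) + ?L * lp_norm p (\<lambda>k. ?T t k - z k)) \<longlongrightarrow> 0) at_top"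
    using tendsto_add[OF tendsto_mult[OF tendsto_const tendsto_powr_neg_half[OF \<zeta>]] tendsto_mult[OF tendsto_const lim0],
        of "\<zeta> * ?M * ?X" ?L] by simp
  ultimately have "platoon_op \<zeta> z k = 0" for k
    by (rule lp_bound_limit_zero[OF p]) simp
  then have zc: "z k = platoon_limit \<zeta> (z 0 $ 1) k" for k
    by (rule platoon_op_kernel[rotated]) (use \<zeta> in auto)
  define c where "c = z 0 $ 1"
  have fz: "first_comp z = (\<lambda>_. c)"
    by (rule ext) (simp add: first_comp_def zc[folded c_def] platoon_limit_def)
  have c: "(\<lambda>_. c) \<in> lp_space p" using first_comp_in_lp[OF p z] by (simp add: fz)
  have bound: "cesaro_error p (first_comp x) c n \<le> 2 * t * ?M * ?X / real n + lp_norm p (\<lambda>k. ?T t k - z k)"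
    if "0 < n" "0 \<le> t" for n t
  proof -
    have "first_comp (\<lambda>k. ?T t k - z k) = (\<lambda>k. first_comp (?T t) k - c)"
      using fun_cong[OF fz] by (simp add: first_comp_def fun_eq_iff)
    then have 1: "lp_bound p (cesaro_mean n (\<lambda>k. first_comp (?T t) k - c)) (lp_norm p (\<lambda>k. ?T t k - z k))"
      using lp_bound_cesaro_mean[OF p lp_bound_first_comp[OF p Tz[of t]], of n] by simp
    have "cesaro_mean n (\<lambda>k. first_comp x k - c)
      = (\<lambda>k. cesaro_mean n (\<lambda>k. first_comp x k - first_comp (?T t) k) k + cesaro_mean n (\<lambda>k. first_comp (?T t) k - c) k)"
      by (simp add: fun_eq_iff cesaro_mean_def scaleR_add_right[symmetric] sum.distrib[symmetric])
    then show ?thesis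
      using lp_bound_add[OF p lp_bound_cesaro_orbit[OF \<zeta> p lp_bound_norm[OF x] that(2), of n] 1]
      by (simp add: cesaro_error_eq[OF that(1)] lp_bound_def)
  qed
  have "cesaro_error p (first_comp x) c \<longlonglongrightarrow> 0"
  proof (rule tendstoI)
    fix e :: real assume e: "0 < e"
    have "\<forall>\<^sub>F t in at_top. lp_norm p (\<lambda>k. ?T t k - z k) < e / 2"
      using lim0 e by (intro order_tendstoD) auto
    then have "\<forall>\<^sub>F t in at_top. lp_norm p (\<lambda>k. ?T t k - z k) < e / 2 \<and> 0 \<le> t"
      using eventually_ge_at_top[of 0] by eventually_elim simp
    then obtain t where t: "lp_norm p (\<lambda>k. ?T t k - z k) < e / 2" "0 \<le> t"
      by (auto simp: eventually_at_top_linorder)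
    have "(\<lambda>n. 2 * t * ?M * ?X / real n) \<longlonglongrightarrow> 0" by (rule lim_const_over_n)
    then have "\<forall>\<^sub>F n in sequentially. 2 * t * ?M * ?X / real n < e / 2"
      using e by (intro order_tendstoD) auto
    then show "\<forall>\<^sub>F n in sequentially. dist (cesaro_error p (first_comp x) c n) 0 < e"
      using eventually_gt_at_top[of 0]
    proof eventually_elim
      case (elim n)
      show ?case using bound[OF elim(2) t(2)] elim(1) t(1) cesaro_error_nonneg[OF p first_comp_in_lp[OF p x] c elim(2)]
        by (simp add: dist_real_def)
    qed
  qed
  with c show ?thesis by blast
qed

text \<open>In \<open>lp_bound_semigroup_limit\<close>, n is fixed first to make the Cesaro error
  small; the Abel mean, however large, is then beaten by t^(-1/2).\<close>

lemma platoon_semigroup_converges: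
  assumes \<zeta>: "0 < \<zeta>" and p: "1 \<le> p" and x: "x \<in> lp_space p" and c: "(\<lambda>_. c) \<in> lp_space p"
    and lim: "cesaro_error p (first_comp x) c \<longlonglongrightarrow> 0"
  shows "lp_converges_to p (\<lambda>t. platoon_semigroup \<zeta> t x) (platoon_limit \<zeta> c)"
  unfolding lp_converges_to_def
proof (intro conjI tendstoI platoon_limit_in_lp \<zeta> p c)
  fix e :: real assume e: "0 < e"
  let ?M = "(platoon_step_const \<zeta>)\<^sup>2"
  have "(\<lambda>n. ?M * cesaro_error p (first_comp x) c n) \<longlonglongrightarrow> ?M * 0" by (intro tendsto_mult tendsto_const lim)
  then have "\<forall>\<^sub>F n in sequentially. ?M * cesaro_error p (first_comp x) c n < e / 2"
    using e by (intro order_tendstoD) auto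
  then have "\<forall>\<^sub>F n in sequentially. ?M * cesaro_error p (first_comp x) c n < e / 2 \<and> 0 < n"
    using eventually_gt_at_top[of 0] by eventually_elim simp
  then obtain n where n: "?M * cesaro_error p (first_comp x) c n < e / 2" "0 < n"
    by (auto simp: eventually_at_top_linorder)
  have V: "lp_bound p (abel_mean n (\<lambda>k. first_comp x k - c)) (lp_norm p (abel_mean n (\<lambda>k. first_comp x k - c)))"
    by (intro lp_bound_norm abel_mean_in_lp lp_space_diff first_comp_in_lp p x c)
  define K where "K = ?M * ((1 / \<zeta>\<^sup>2 + 3 / \<zeta> + \<zeta>) * lp_norm p (\<lambda>k. x k - platoon_limit \<zeta> c k)
    + (3 + \<zeta>) * lp_norm p (abel_mean n (\<lambda>k. first_comp x k - c)))"
  have "((\<lambda>t. K * (\<zeta> * t) powr (-1/2)) \<longlongrightarrow> K * 0) at_top"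
    by (intro tendsto_mult tendsto_const tendsto_powr_neg_half \<zeta>)
  then have "\<forall>\<^sub>F t in at_top. K * (\<zeta> * t) powr (-1/2) < e / 2"
    using e by (intro order_tendstoD) auto
  then show "\<forall>\<^sub>F t in at_top. dist (lp_norm p (\<lambda>k. platoon_semigroup \<zeta> t x k - platoon_limit \<zeta> c k)) 0 < e"
    using eventually_gt_at_top[of 0]
  proof eventually_elim
    case (elim t)
    show ?case
      using lp_bound_semigroup_limit[OF \<zeta> p x c n(2) elim(2) V, folded K_def] n(1) elim(1)
      by (simp add: lp_bound_def dist_real_def lp_norm_nonneg)
  qed
qed

lemma bigo_inverse_imp_bounded:
  assumes "f \<in> O(\<lambda>n. 1 / real n)"
  obtains C where "\<And>n. real n * f n \<le> C" "0 \<le> C"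
proof -
  obtain c where c: "\<forall>\<^sub>F n in sequentially. norm (f n) \<le> c * norm (1 / real n)"
    using assms by (auto elim: landau_o.bigE)
  then obtain N where N: "\<And>n. N \<le> n \<Longrightarrow> norm (f n) \<le> c * norm (1 / real n)"
    by (auto simp: eventually_at_top_linorder)
  \<comment> \<open>The O-estimate holds only from N on; the finitely many earlier values are
    absorbed in a sum.\<close>
  have "real n * f n \<le> \<bar>c\<bar> + (\<Sum>n<N. \<bar>real n * f n\<bar>)" for n
  proof (cases "n < N")
    case True
    then have "\<bar>real n * f n\<bar> \<le> (\<Sum>n<N. \<bar>real n * f n\<bar>)" by (intro member_le_sum) auto
    then show ?thesis by linarith
  next
    case False
    have "real n * f n \<le> real n * (c * norm (1 / real n))"
      using N[of n] False by (intro mult_left_mono) auto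
    also have "\<dots> \<le> \<bar>c\<bar>" by (cases "n = 0") auto
    also have "\<dots> \<le> \<bar>c\<bar> + (\<Sum>n<N. \<bar>real n * f n\<bar>)" by (simp add: sum_nonneg)
    finally show ?thesis .
  qed
  then show ?thesis by (rule that) (simp add: sum_nonneg)
qed

text \<open>1 + S + ... + S^m is 1 plus m times a Cesaro mean: the means start at S^1, so the term
  \<open>y\<close> is split off.\<close>

lemma lp_bound_partial_sums:
  assumes p: "1 \<le> p" and y: "y \<in> lp_space p" and C: "\<And>n. real n * lp_norm p (cesaro_mean n y) \<le> C" "0 \<le> C"
  shows "lp_bound p (\<lambda>k. \<Sum>i<j. y (k - int i)) (lp_norm p y + C)"
proof (cases j)
  case 0
  then show ?thesis using lp_norm_nonneg[OF y] C(2) by (auto intro!: lp_bound_mono[OF lp_bound_zero[OF p]])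
next
  case (Suc m)
  have "(\<Sum>i<j. y (k - int i)) = y k + real m *\<^sub>R cesaro_mean m y k" for k
  proof -
    have "(\<Sum>i<j. y (k - int i)) = y k + (\<Sum>i<m. y (k - int (Suc i)))"
      unfolding Suc by (subst sum.lessThan_Suc_shift) simp
    also have "(\<Sum>i<m. y (k - int (Suc i))) = (\<Sum>i=1..m. y (k - int i))"
      by (rule sum.reindex_bij_witness[of _ "\<lambda>i. i - 1" Suc]) auto
    finally show ?thesis by (cases "m = 0") (simp_all add: cesaro_mean_def)
  qed
  moreover have "lp_bound p (\<lambda>k. y k + real m *\<^sub>R cesaro_mean m y k) (lp_norm p y + \<bar>real m\<bar> * lp_norm p (cesaro_mean m y))"
    by (intro lp_bound_add lp_bound_scaleR lp_bound_norm cesaro_mean_in_lp p y)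
  ultimately show ?thesis using lp_bound_mono C(1)[of m] by fastforce
qed

text \<open>A Cesaro error O(1/n) bounds the partial sums and hence the Abel means uniformly in n.
  At fixed t the index n can then go to infinity, which removes the Cesaro term and keeps the
  decaying one.\<close>

lemma platoon_semigroup_convergence_rate:
  assumes \<zeta>: "0 < \<zeta>" and p: "1 \<le> p" and x: "x \<in> lp_space p" and c: "(\<lambda>_. c) \<in> lp_space p"
    and rate: "cesaro_error p (first_comp x) c \<in> O(\<lambda>n. 1 / real n)"
  shows "\<exists>K. \<forall>t>0. lp_norm p (\<lambda>k. platoon_semigroup \<zeta> t x k - platoon_limit \<zeta> c k) \<le> K * t powr (-1/2)"
proof -
  let ?M = "(platoon_step_const \<zeta>)\<^sup>2"
  let ?y = "\<lambda>k. first_comp x k - c"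
  obtain C where C: "\<And>n. real n * cesaro_error p (first_comp x) c n \<le> C" "0 \<le> C"
    using bigo_inverse_imp_bounded[OF rate] by blast
  have y: "?y \<in> lp_space p" by (intro lp_space_diff first_comp_in_lp p x c)
  have "real n * lp_norm p (cesaro_mean n ?y) \<le> C" for n
    using C(1)[of n] C(2) by (cases "n = 0") (simp_all add: cesaro_error_eq)
  then have V: "lp_bound p (abel_mean n ?y) (lp_norm p ?y + C)" if "0 < n" for n
    by (intro lp_bound_abel_mean lp_bound_partial_sums p y that C)
  define K where "K = ?M * ((1 / \<zeta>\<^sup>2 + 3 / \<zeta> + \<zeta>) * lp_norm p (\<lambda>k. x k - platoon_limit \<zeta> c k) + (3 + \<zeta>) * (lp_norm p ?y + C))"
  have "lp_norm p (\<lambda>k. platoon_semigroup \<zeta> t x k - platoon_limit \<zeta> c k) \<le> (K * \<zeta> powr (-1/2)) * t powr (-1/2)" if t: "0 < t" for t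
  proof (rule LIMSEQ_le_const)
    have "cesaro_error p (first_comp x) c \<longlonglongrightarrow> 0"
    proof (rule tendsto_sandwich[OF _ _ tendsto_const lim_const_over_n[of C]])
      show "\<forall>\<^sub>F n in sequentially. 0 \<le> cesaro_error p (first_comp x) c n"
        using eventually_gt_at_top[of 0] by eventually_elim (rule cesaro_error_nonneg[OF p first_comp_in_lp[OF p x] c])
      show "\<forall>\<^sub>F n in sequentially. cesaro_error p (first_comp x) c n \<le> C / real n"
        using eventually_gt_at_top[of 0] by eventually_elim (use C(1) in \<open>simp add: field_simps\<close>)
    qed
    from tendsto_add[OF tendsto_const tendsto_mult[OF tendsto_const this], of "(K * \<zeta> powr (-1/2)) * t powr (-1/2)" ?M]
    show "(\<lambda>n. (K * \<zeta> powr (-1/2)) * t powr (-1/2) + ?M * cesaro_error p (first_comp x) c n)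
        \<longlonglongrightarrow> (K * \<zeta> powr (-1/2)) * t powr (-1/2)" by simp
    have "lp_norm p (\<lambda>k. platoon_semigroup \<zeta> t x k - platoon_limit \<zeta> c k)
        \<le> (K * \<zeta> powr (-1/2)) * t powr (-1/2) + ?M * cesaro_error p (first_comp x) c n" if "0 < n" for n
      using lp_bound_semigroup_limit[OF \<zeta> p x c that t V[OF that], folded K_def] \<zeta> t
      by (simp add: lp_bound_def powr_mult mult.assoc)
    then show "\<exists>N. \<forall>n\<ge>N. lp_norm p (\<lambda>k. platoon_semigroup \<zeta> t x k - platoon_limit \<zeta> c k)
        \<le> (K * \<zeta> powr (-1/2)) * t powr (-1/2) + ?M * cesaro_error p (first_comp x) c n" by (intro exI[of _ 1]) auto
  qed
  then show ?thesis by blast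
qed

section \<open>Existence of Cesaro limits\<close>

lemma lp_const_zero:
  fixes c :: "'a::real_normed_vector"
  assumes p: "1 \<le> p" "p \<noteq> \<infinity>" and c: "(\<lambda>_. c) \<in> lp_space p"
  shows "c = 0"
proof (rule ccontr)
  define q where "q = real_of_ereal p"
  assume "c \<noteq> 0"
  then have pos: "0 < norm c powr q" by simp
  obtain N where N: "lp_norm p (\<lambda>_::int. c) powr q < real N * norm c powr q"
    using reals_Archimedean3[OF pos] by blast
  have "(\<Sum>k\<in>{1..int N}. norm c powr q) \<le> lp_norm p (\<lambda>_::int. c) powr q"
    using lp_bound_norm[OF c] finite_atLeastAtMost_int unfolding lp_bound_finite[OF p] q_def by blast
  with N show False by simp
qed

text \<open>\<open>y\<close> is cut into a tail of small norm, which Cesaro means do not enlarge,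
  and a finitely supported part, whose n-th mean is at most B/n on at most n card F sites. The norm
  of the latter is O(n^(1/q - 1)), and q > 1 makes it vanish.\<close>

lemma cesaro_tendsto_zero:
  fixes y :: "int \<Rightarrow> complex"
  assumes p: "1 < p" "p \<noteq> \<infinity>" and y: "y \<in> lp_space p"
  shows "cesaro_error p y 0 \<longlonglongrightarrow> 0"
proof (rule tendstoI)
  define q where "q = real_of_ereal p"
  have p1: "1 \<le> p" using p by simp
  have q: "1 < q" using p by (cases p) (auto simp: q_def)
  fix e :: real assume e: "0 < e"
  let ?f = "\<lambda>k. norm (y k) powr q"
  have s: "?f summable_on UNIV" using y p by (simp add: lp_space_def q_def)
  then have "((sum ?f) \<longlongrightarrow> infsum ?f UNIV) (finite_subsets_at_top UNIV)"
    using has_sum_infsum has_sum_def by blast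
  then have "\<forall>\<^sub>F F in finite_subsets_at_top UNIV. infsum ?f UNIV - (e/2) powr q < sum ?f F"
    using e by (intro order_tendstoD) auto
  then obtain F where F: "finite F" "infsum ?f UNIV - (e/2) powr q < sum ?f F"
    by (auto simp: eventually_finite_subsets_at_top)
  define g where "g k = (if k \<in> F then 0 else y k)" for k
  define h where "h k = (if k \<in> F then y k else 0)" for k
  have "(\<Sum>k\<in>G. norm (g k) powr q) \<le> (e/2) powr q" if G: "finite G" for G
  proof -
    have "(\<Sum>k\<in>G. norm (g k) powr q) = (\<Sum>k\<in>G - F. ?f k)"
      using G q by (intro sum.mono_neutral_cong_right) (auto simp: g_def)
    moreover have "(\<Sum>k\<in>G - F. ?f k) + sum ?f F = sum ?f (G \<union> F)"
      using G F(1) by (subst sum.union_disjoint[symmetric]) (auto intro!: arg_cong[where f = "sum ?f"])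
    moreover have "sum ?f (G \<union> F) \<le> infsum ?f UNIV"
      by (rule finite_sum_le_infsum) (use s G F(1) in auto)
    ultimately show ?thesis using F(2) by linarith
  qed
  then have g: "lp_bound p g (e/2)" using e by (simp add: lp_bound_finite[OF p1 p(2)] q_def)
  define B where "B = (\<Sum>k\<in>F. norm (y k))"
  have B: "0 \<le> B" by (simp add: B_def sum_nonneg)
  have h: "lp_bound p (cesaro_mean n h) (B * real (card F) powr (1/q) * real n powr (1/q - 1))" if n: "0 < n" for n
  proof -
    let ?S = "(\<lambda>(i, j). i + int j) ` (F \<times> {1..n})"
    have 1: "norm (cesaro_mean n h k) \<le> B / real n" for k
    proof -
      have "norm (\<Sum>j=1..n. h (k - int j)) \<le> (\<Sum>j=1..n. norm (h (k - int j)))" by (rule norm_sum)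
      also have "\<dots> = (\<Sum>i\<in>(\<lambda>j. k - int j) ` {1..n}. norm (h i))"
        by (subst sum.reindex) (auto simp: inj_on_def)
      also have "\<dots> = (\<Sum>i\<in>((\<lambda>j. k - int j) ` {1..n}) \<inter> F. norm (y i))"
        by (rule sum.mono_neutral_cong_right) (auto simp: h_def)
      also have "\<dots> \<le> B" unfolding B_def using F(1) by (intro sum_mono2) auto
      finally show ?thesis by (simp add: cesaro_mean_def divide_right_mono)
    qed
    have 2: "cesaro_mean n h k = 0" if "k \<notin> ?S" for k
    proof -
      have "h (k - int j) = 0" if "j \<in> {1..n}" for j
      proof -
        have "k - int j \<notin> F" using \<open>k \<notin> ?S\<close> that by (force simp: image_iff)
        then show ?thesis by (simp add: h_def)
      qed
      then show ?thesis by (simp add: cesaro_mean_def)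
    qed
    have "lp_bound p (cesaro_mean n h) (B / real n * real (card ?S) powr (1/q))"
      unfolding q_def by (rule lp_bound_finite_support[OF p1 p(2) _ _ 1 2]) (use F(1) B in auto)
    moreover have "B / real n * real (card ?S) powr (1/q) \<le> B / real n * (real (card F) * real n) powr (1/q)"
    proof -
      have "card ?S \<le> card F * n" using card_image_le[of "F \<times> {1..n}"] F(1) by (simp add: card_cartesian_product)
      then have "real (card ?S) \<le> real (card F) * real n" by (metis of_nat_le_iff of_nat_mult)
      then show ?thesis using B q by (intro mult_left_mono powr_mono2) auto
    qed
    moreover have "B / real n * (real (card F) * real n) powr (1/q) = B * real (card F) powr (1/q) * real n powr (1/q - 1)"
      using n by (simp add: powr_mult powr_diff)
    ultimately show ?thesis using lp_bound_mono by simp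
  qed
  have "((\<lambda>n. B * real (card F) powr (1/q) * real n powr (1/q - 1)) \<longlonglongrightarrow> B * real (card F) powr (1/q) * 0)"
    using q by (intro tendsto_mult tendsto_const tendsto_neg_powr filterlim_real_sequentially) auto
  then have "\<forall>\<^sub>F n in sequentially. B * real (card F) powr (1/q) * real n powr (1/q - 1) < e / 2"
    using e by (intro order_tendstoD) auto
  then show "\<forall>\<^sub>F n in sequentially. dist (cesaro_error p y 0 n) 0 < e"
    using eventually_gt_at_top[of 0]
  proof eventually_elim
    case (elim n)
    have "cesaro_mean n (\<lambda>k. y k - 0) = (\<lambda>k. cesaro_mean n g k + cesaro_mean n h k)"
      by (auto simp: fun_eq_iff cesaro_mean_def scaleR_add_right[symmetric] sum.distrib[symmetric] g_def h_def
          intro!: sum.cong arg_cong[where f = "scaleR _"])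
    then have "lp_bound p (cesaro_mean n (\<lambda>k. y k - 0)) (e/2 + B * real (card F) powr (1/q) * real n powr (1/q - 1))"
      using lp_bound_add[OF p1 lp_bound_cesaro_mean[OF p1 g, of n] h[OF elim(2)]] by simp
    then show ?case using elim by (simp add: cesaro_error_eq lp_bound_def dist_real_def lp_norm_nonneg)
  qed
qed

text \<open>For p = 1, the unit vector at 0: c must be 0, but the means have l^1 norm 1. For p =
  \<infinity>, the indicator of k >= 0: its n-th mean is 0 at site 0 and 1 at site n, hence at
  distance at least 1/2 from every constant.\<close>

lemma exists_no_cesaro_limit:
  assumes "p = 1 \<or> p = \<infinity>"
  obtains y :: "int \<Rightarrow> complex" where "y \<in> lp_space p"
    and "\<And>c. (\<lambda>_. c) \<in> lp_space p \<Longrightarrow> \<not> cesaro_error p y c \<longlonglongrightarrow> 0"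
proof -
  have *: "\<not> f \<longlonglongrightarrow> 0" if "\<And>n. 0 < n \<Longrightarrow> 1/2 \<le> f n" for f :: "nat \<Rightarrow> real"
  proof
    assume "f \<longlonglongrightarrow> 0"
    then have "1/2 \<le> (0::real)" by (rule LIMSEQ_le_const) (use that in \<open>auto intro!: exI[of _ 1]\<close>)
    then show False by simp
  qed
  show ?thesis
  proof (cases "p = 1")
    case True
    have p: "1 \<le> p" "p \<noteq> \<infinity>" "real_of_ereal p = 1" using True by auto
    define y :: "int \<Rightarrow> complex" where "y k = (if k = 0 then 1 else 0)" for k
    have y: "y \<in> lp_space p"
      by (rule lp_space_I[OF lp_bound_finite_support[OF p(1,2), of "{0}" 1]]) (auto simp: y_def)
    have "1/2 \<le> cesaro_error p y 0 n" if n: "0 < n" for n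
    proof -
      have m: "cesaro_mean n y \<in> lp_space p" by (rule cesaro_mean_in_lp[OF p(1) y])
      have "(\<Sum>k\<in>{1..int n}. norm (cesaro_mean n y k) powr 1) \<le> lp_norm p (cesaro_mean n y) powr 1"
        using lp_bound_norm[OF m] finite_atLeastAtMost_int unfolding lp_bound_finite[OF p(1,2)] p(3) by blast
      then have "(\<Sum>k\<in>{1..int n}. norm (cesaro_mean n y k)) \<le> cesaro_error p y 0 n"
        using lp_norm_nonneg[OF m] by (simp add: cesaro_error_eq[OF n])
      moreover have "norm (cesaro_mean n y k) = 1 / real n" if k: "k \<in> {1..int n}" for k
      proof -
        have "(\<Sum>j=1..n. y (k - int j)) = (\<Sum>j\<in>{nat k}. y (k - int j))"
          using k by (intro sum.mono_neutral_right) (auto simp: y_def)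
        then show ?thesis using k by (simp add: cesaro_mean_def y_def)
      qed
      ultimately show ?thesis using n by simp
    qed
    then have "\<not> cesaro_error p y c \<longlonglongrightarrow> 0" if "(\<lambda>_. c) \<in> lp_space p" for c
      using lp_const_zero[OF p(1,2) that] * by blast
    then show ?thesis using that y by blast
  next
    case False
    then have p: "p = \<infinity>" "1 \<le> p" using assms by auto
    define y :: "int \<Rightarrow> complex" where "y k = (if 0 \<le> k then 1 else 0)" for k
    have y: "y \<in> lp_space p"
      unfolding p(1) by (rule lp_space_I[of _ _ 1]) (simp add: lp_bound_infinity y_def)
    have "1/2 \<le> cesaro_error p y c n" if n: "0 < n" and c: "(\<lambda>_. c) \<in> lp_space p" for n c
    proof -
      have "lp_bound p (cesaro_mean n (\<lambda>k. y k - c)) (cesaro_error p y c n)"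
        unfolding cesaro_error_eq[OF n] by (intro lp_bound_norm cesaro_mean_in_lp lp_space_diff y c p)
      then have b: "norm (cesaro_mean n (\<lambda>k. y k - c) k) \<le> cesaro_error p y c n" for k
        by (rule lp_bound_component[OF p(2)])
      have "cesaro_mean n (\<lambda>k. y k - c) 0 = - c"
      proof -
        have "(\<Sum>j=1..n. y (0 - int j) - c) = (\<Sum>j=1..n. - c)" by (intro sum.cong) (auto simp: y_def)
        then show ?thesis using n by (simp add: cesaro_mean_def scaleR_conv_of_real)
      qed
      moreover have "cesaro_mean n (\<lambda>k. y k - c) (int n) = 1 - c"
      proof -
        have "(\<Sum>j=1..n. y (int n - int j) - c) = (\<Sum>j=1..n. 1 - c)" by (intro sum.cong) (auto simp: y_def)
        then show ?thesis using n by (simp add: cesaro_mean_def scaleR_conv_of_real)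
      qed
      ultimately have "norm c \<le> cesaro_error p y c n" "norm (1 - c) \<le> cesaro_error p y c n"
        using b[of 0] b[of "int n"] by simp_all
      moreover have "norm (1 :: complex) \<le> norm c + norm (1 - c)"
        using norm_triangle_ineq[of c "1 - c"] by simp
      ultimately show ?thesis by simp
    qed
    then have "\<not> cesaro_error p y c \<longlonglongrightarrow> 0" if "(\<lambda>_. c) \<in> lp_space p" for c
      using * that by blast
    then show ?thesis using that y by blast
  qed
qed

section \<open>From the semigroup to arbitrary solutions\<close>

lemma platoon_solution_eq_semigroup:
  assumes "0 < \<zeta>" "1 \<le> p" "x0 \<in> lp_space p" "platoon_solution p \<zeta> x0 x" "0 \<le> t"
  shows "x t = platoon_semigroup \<zeta> t x0"
  by (rule platoon_solution_unique[OF assms(1,2,4) platoon_solution_semigroup[OF assms(1-3)] assms(5)])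

lemma platoon_solution_converges_iff:
  assumes "0 < \<zeta>" "1 \<le> p" "x0 \<in> lp_space p" "platoon_solution p \<zeta> x0 x"
  shows "lp_converges_to p x z \<longleftrightarrow> lp_converges_to p (\<lambda>t. platoon_semigroup \<zeta> t x0) z"
proof -
  have "\<forall>\<^sub>F t in at_top. lp_norm p (\<lambda>k. x t k - z k) = lp_norm p (\<lambda>k. platoon_semigroup \<zeta> t x0 k - z k)"
    using eventually_ge_at_top[of 0]
    by eventually_elim (simp add: platoon_solution_eq_semigroup[OF assms])
  then show ?thesis unfolding lp_converges_to_def by (simp cong: tendsto_cong)
qed

lemma convergence_rate_sqrt:
  assumes \<zeta>: "0 < \<zeta>" and p: "1 \<le> p" shows "convergence_rate p \<zeta> (\<lambda>t. t powr (-1/2))"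
  unfolding convergence_rate_def
proof (intro allI impI)
  fix x0 x c
  assume x0: "x0 \<in> lp_space p" and x: "platoon_solution p \<zeta> x0 x" and c: "(\<lambda>_. c) \<in> lp_space p"
    and rate: "cesaro_error p (first_comp x0) c \<in> O(\<lambda>n. 1 / real n)"
  obtain K where K: "\<And>t. 0 < t \<Longrightarrow> lp_norm p (\<lambda>k. platoon_semigroup \<zeta> t x0 k - platoon_limit \<zeta> c k) \<le> K * t powr (-1/2)"
    using platoon_semigroup_convergence_rate[OF \<zeta> p x0 c rate] by blast
  show "(\<lambda>t. lp_norm p (\<lambda>k. x t k - platoon_limit \<zeta> c k)) \<in> O(\<lambda>t. t powr (-1/2))"
  proof (rule bigoI)
    show "\<forall>\<^sub>F t in at_top. norm (lp_norm p (\<lambda>k. x t k - platoon_limit \<zeta> c k)) \<le> K * norm (t powr (-1/2))"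
      using eventually_gt_at_top[of 0]
    proof eventually_elim
      case (elim t)
      have l: "(\<lambda>k. platoon_semigroup \<zeta> t x0 k - platoon_limit \<zeta> c k) \<in> lp_space p"
        by (intro lp_space_diff platoon_semigroup_in_lp platoon_limit_in_lp \<zeta> p x0 c)
      show ?case using K[OF elim] lp_norm_nonneg[OF l] elim
        by (simp add: platoon_solution_eq_semigroup[OF \<zeta> p x0 x])
    qed
  qed
qed

lemma derivative_rate_sqrt:
  assumes \<zeta>: "0 < \<zeta>" and p: "1 \<le> p" shows "derivative_rate p \<zeta> (\<lambda>t. t powr (-1/2))"
  unfolding derivative_rate_def
proof (intro allI impI)
  fix x0 x x'
  assume x0: "x0 \<in> lp_space p" and x: "platoon_solution p \<zeta> x0 x"
    and x': "\<forall>t\<ge>0. has_lp_derivative p x (x' t) t"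
  \<comment> \<open>The derivative \<open>x'\<close> is arbitrary in the rate statement; uniqueness
    of derivatives identifies it with \<open>A\<close> applied to the orbit.\<close>
  have eq: "x' t = platoon_op \<zeta> (platoon_semigroup \<zeta> t x0)" if "0 \<le> t" for t
  proof -
    have "has_lp_derivative p x (x' t) t" "has_lp_derivative p x (platoon_op \<zeta> (x t)) t"
      using x' x that by (auto simp: platoon_solution_def)
    from has_lp_derivative_unique[OF p this that] show ?thesis
      by (simp add: platoon_solution_eq_semigroup[OF \<zeta> p x0 x that])
  qed
  show "(\<lambda>t. lp_norm p (x' t)) \<in> O(\<lambda>t. t powr (-1/2))"
  proof (rule bigoI)
    show "\<forall>\<^sub>F t in at_top. norm (lp_norm p (x' t)) \<le>
        (\<zeta> * (platoon_step_const \<zeta>)\<^sup>2 * lp_norm p x0 * \<zeta> powr (-1/2)) * norm (t powr (-1/2))"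
      using eventually_gt_at_top[of 0]
    proof eventually_elim
      case (elim t)
      show ?case using lp_bound_platoon_op_semigroup[OF \<zeta> p lp_bound_norm[OF x0] elim] elim \<zeta>
        by (simp add: lp_bound_def eq lp_norm_nonneg powr_mult mult.assoc)
    qed
  qed
qed

section \<open>Approximate eigenvectors\<close>

lemma platoon_step_funpow_smult: "(platoon_step \<zeta> ^^ n) (\<lambda>k. c *s x k) k = c *s (platoon_step \<zeta> ^^ n) x k"
proof (induction n arbitrary: k)
  case (Suc n)
  then have "(platoon_step \<zeta> ^^ n) (\<lambda>k. c *s x k) = (\<lambda>k. c *s (platoon_step \<zeta> ^^ n) x k)" by blast
  then show ?case by (simp add: platoon_step_smult)
qed simp

lemma of_real_smult_eq_scaleR: "complex_of_real a *s v = a *\<^sub>R v"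
  by (simp add: vec_eq_iff) (simp add: scaleR_conv_of_real)

lemma lp_bound_smult:
  fixes x :: "int \<Rightarrow> complex^'n"
  shows "1 \<le> p \<Longrightarrow> lp_bound p x B \<Longrightarrow> lp_bound p (\<lambda>k. c *s x k) (norm c * B)"
  by (rule lp_bound_cmult_dominated) (auto simp: norm_vector_smult)

lemma lp_bound_smultD:
  fixes x :: "int \<Rightarrow> complex^'n"
  assumes "1 \<le> p" "lp_bound p (\<lambda>k. c *s x k) B" "c \<noteq> 0"
  shows "lp_bound p x (B / norm c)"
  using lp_bound_smult[OF assms(1,2), of "inverse c"] assms(3)
  by (simp add: vector_smult_assoc norm_inverse divide_inverse mult.commute)

text \<open>The vector \<open>w\<close> is the eigenvector of \<open>1 + (A\<^sub>0 + \<mu>\<^sup>3 A\<^sub>1) / \<zeta>\<close> for the eigenvalue \<open>\<mu>\<close>;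
  the defect of \<open>c\<close> as an eigensequence of \<open>S\<close> is all that remains.\<close>

lemma platoon_step_modulated:
  fixes c :: "int \<Rightarrow> complex" and \<mu> :: complex
  assumes "\<zeta> \<noteq> 0"
  defines "w \<equiv> vector [- (1 + \<mu> + \<mu>\<^sup>2) / of_real \<zeta>, 1, of_real \<zeta> * (\<mu> - 1)] :: complex^3"
  shows "platoon_step \<zeta> (\<lambda>k. c k *s w) k - \<mu> *s (c k *s w) = vector [(\<mu>^3 * c k - c (k - 1)) / of_real \<zeta>, 0, 0]"
proof -
  have "(platoon_step \<zeta> (\<lambda>k. c k *s w) k - \<mu> *s (c k *s w)) $ i = vector [(\<mu>^3 * c k - c (k - 1)) / of_real \<zeta>, 0, 0] $ i" for i
    using exhaust_3[of i] assms(1)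
    by (elim disjE) (simp_all add: platoon_step_nth w_def field_simps power2_eq_square power3_eq_cube)
  then show ?thesis by (simp add: vec_eq_iff)
qed

lemma approximate_eigenvector_normalize:
  assumes p: "1 \<le> p" and f: "f \<in> lp_space p" and L: "0 < lp_norm p f"
    and D: "lp_bound p (\<lambda>k. platoon_step \<zeta> f k - \<mu> *s f k) D" "D \<le> \<epsilon> * lp_norm p f"
  shows "\<exists>f \<in> lp_space p. lp_norm p f = 1 \<and> lp_bound p (\<lambda>k. platoon_step \<zeta> f k - \<mu> *s f k) \<epsilon>"
proof -
  let ?L = "lp_norm p f"
  define c where "c = complex_of_real (1 / ?L)"
  have c: "norm c = 1 / ?L" "c \<noteq> 0" using L by (auto simp: c_def norm_divide)
  let ?g = "\<lambda>k. c *s f k"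
  have g1: "lp_bound p ?g 1" using lp_bound_smult[OF p lp_bound_norm[OF f], of c] c L by simp
  then have g: "?g \<in> lp_space p" by (rule lp_space_I)
  have "lp_bound p f (lp_norm p ?g / norm c)" by (rule lp_bound_smultD[OF p lp_bound_norm[OF g] c(2)])
  then have "?L \<le> lp_norm p ?g * ?L" using c by (simp add: lp_bound_def)
  then have "1 \<le> lp_norm p ?g" using L by simp
  then have n: "lp_norm p ?g = 1" using g1 by (simp add: lp_bound_def)
  have "(\<lambda>k. platoon_step \<zeta> ?g k - \<mu> *s ?g k) = (\<lambda>k. c *s (platoon_step \<zeta> f k - \<mu> *s f k))"
    by (auto simp: platoon_step_smult vec_eq_iff algebra_simps)
  then have "lp_bound p (\<lambda>k. platoon_step \<zeta> ?g k - \<mu> *s ?g k) (norm c * D)"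
    using lp_bound_smult[OF p D(1), of c] by simp
  moreover have "norm c * D \<le> \<epsilon>" using D(2) c L by (simp add: divide_le_eq)
  ultimately show ?thesis using g n lp_bound_mono by blast
qed

text \<open>The plane wave \<eta> satisfies S \<eta> = \<mu>^3 \<eta>, so together with
  \<open>w\<close> it gives an exact eigenvector, which settles p = \<infinity>. For finite
  \<open>p\<close> it is cut to N sites: the defect lives at the two ends and is bounded
  independently of N, while the norm is at least N^(1/q).\<close>

lemma approximate_eigenvector:
  assumes \<zeta>: "0 < \<zeta>" and p: "1 \<le> p" and \<epsilon>: "0 < \<epsilon>"
  shows "\<exists>f \<in> lp_space p. lp_norm p f = 1 \<and> lp_bound p (\<lambda>k. platoon_step \<zeta> f k - cis \<theta> *s f k) \<epsilon>"
proof -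
  define \<mu> where "\<mu> = cis \<theta>"
  define w :: "complex^3" where "w = vector [- (1 + \<mu> + \<mu>\<^sup>2) / of_real \<zeta>, 1, of_real \<zeta> * (\<mu> - 1)]"
  have w: "1 \<le> norm w" using Finite_Cartesian_Product.norm_nth_le[of w 2] by (simp add: w_def)
  define \<eta> where "\<eta> k = cis (- 3 * \<theta> * real_of_int k)" for k
  have \<mu>3: "\<mu>^3 = cis (3 * \<theta>)" using Complex.DeMoivre[of \<theta> 3] by (simp add: \<mu>_def)
  have \<eta>: "\<mu>^3 * \<eta> k = \<eta> (k - 1)" "norm (\<eta> k) = 1" for k
    unfolding \<eta>_def \<mu>3 cis_mult by (rule arg_cong[where f = cis], simp add: algebra_simps) simp
  have modulated: "platoon_step \<zeta> (\<lambda>k. c k *s w) k - \<mu> *s (c k *s w) = vector [(\<mu>^3 * c k - c (k - 1)) / of_real \<zeta>, 0, 0]" for c :: "int \<Rightarrow> complex" and k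
    unfolding w_def by (rule platoon_step_modulated) (use \<zeta> in simp)
  show ?thesis unfolding \<mu>_def[symmetric]
  proof (cases "p = \<infinity>")
    case True
    let ?f = "\<lambda>k. \<eta> k *s w"
    have f: "?f \<in> lp_space p"
      unfolding True by (rule lp_space_I[of _ _ "norm w"]) (simp add: lp_bound_infinity norm_vector_smult \<eta>)
    have "norm (?f 0) \<le> lp_norm p ?f" by (rule lp_bound_component[OF p lp_bound_norm[OF f]])
    then have L: "0 < lp_norm p ?f" using w by (simp add: norm_vector_smult \<eta>)
    have "vector [0, 0, 0] = (0 :: complex^3)" by (simp add: vec_eq_iff forall_3)
    then have "lp_bound p (\<lambda>k. platoon_step \<zeta> ?f k - \<mu> *s ?f k) 0"
      unfolding modulated \<eta> using lp_bound_zero[OF p] by simp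
    then show "\<exists>f \<in> lp_space p. lp_norm p f = 1 \<and> lp_bound p (\<lambda>k. platoon_step \<zeta> f k - \<mu> *s f k) \<epsilon>"
      by (rule approximate_eigenvector_normalize[OF p f L]) (use \<epsilon> L in simp)
  next
    case False
    define q where "q = real_of_ereal p"
    have q: "1 \<le> q" using real_of_ereal_ge_1[OF p False] by (simp add: q_def)
    \<comment> \<open>Bounds the defect, which has size at most 1/\<zeta> on two sites. N is then
      taken so large that N^(1/q) exceeds D/\<epsilon>, which makes the defect at most \<epsilon>
      after normalisation.\<close>
    define D where "D = 1 / \<zeta> * real 2 powr (1 / q)"
    have D: "0 < D" using \<zeta> by (simp add: D_def)
    obtain N :: nat where N: "(D / \<epsilon>) powr q < real N" using reals_Archimedean2 by blast
    have N0: "0 < N" using N by (metis gr0I of_nat_0 not_less powr_ge_zero)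
    define c where "c k = (if 0 \<le> k \<and> k < int N then \<eta> k else 0)" for k
    let ?f = "\<lambda>k. c k *s w"
    have f: "?f \<in> lp_space p"
    proof (rule lp_space_I[OF lp_bound_finite_support[OF p False]])
      show "finite {0..<int N}" by simp
      show "norm (?f k) \<le> norm w" for k using w by (simp add: norm_vector_smult c_def \<eta>)
    qed (auto simp: c_def)
    have "(\<Sum>k\<in>{0..<int N}. norm (?f k) powr q) \<le> lp_norm p ?f powr q"
      using lp_bound_norm[OF f] finite_atLeastLessThan_int unfolding lp_bound_finite[OF p False] q_def by blast
    moreover have "real N \<le> (\<Sum>k\<in>{0..<int N}. norm (?f k) powr q)"
    proof -
      have "(\<Sum>k\<in>{0..<int N}. 1) \<le> (\<Sum>k\<in>{0..<int N}. norm (?f k) powr q)"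
        using w q by (intro sum_mono) (auto simp: c_def norm_vector_smult \<eta> ge_one_powr_ge_zero)
      then show ?thesis by simp
    qed
    ultimately have "(D / \<epsilon>) powr q < lp_norm p ?f powr q" using N by linarith
    then have L: "D / \<epsilon> < lp_norm p ?f"
      using powr_mono2[of q "lp_norm p ?f" "D / \<epsilon>"] q lp_norm_nonneg[OF f] by linarith
    have "lp_bound p (\<lambda>k. platoon_step \<zeta> ?f k - \<mu> *s ?f k) (1 / \<zeta> * real (card {0, int N}) powr (1 / q))"
      unfolding q_def modulated
    proof (rule lp_bound_finite_support[OF p False])
      fix k
      have b: "norm (\<mu>^3 * c k - c (k - 1)) \<le> 1"
      proof (cases "0 \<le> k \<and> k < int N")
        case True
        then show ?thesis using \<eta>[of k] \<eta>(2)[of "k - 1"] by (simp add: c_def)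
      next
        case False
        then show ?thesis using \<eta>(2)[of "k - 1"] by (auto simp: c_def)
      qed
      have "norm (vector [(\<mu>^3 * c k - c (k - 1)) / of_real \<zeta>, 0, 0] :: complex^3) \<le> norm (\<mu>^3 * c k - c (k - 1)) / \<zeta>"
        using norm_vec3_le[of "vector [(\<mu>^3 * c k - c (k - 1)) / of_real \<zeta>, 0, 0]"] \<zeta> by (simp add: norm_divide)
      also have "\<dots> \<le> 1 / \<zeta>" using b \<zeta> by (intro divide_right_mono) auto
      finally show "norm (vector [(\<mu>^3 * c k - c (k - 1)) / of_real \<zeta>, 0, 0] :: complex^3) \<le> 1 / \<zeta>" .
      assume "k \<notin> {0, int N}"
      then have "\<mu>^3 * c k - c (k - 1) = 0" using \<eta>(1)[of k] by (auto simp: c_def)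
      then show "vector [(\<mu>^3 * c k - c (k - 1)) / of_real \<zeta>, 0, 0] = (0 :: complex^3)"
        by (simp add: vec_eq_iff forall_3)
    qed (use \<zeta> in auto)
    then have b: "lp_bound p (\<lambda>k. platoon_step \<zeta> ?f k - \<mu> *s ?f k) D" using N0 by (simp add: D_def)
    have "0 < D / \<epsilon>" using D \<epsilon> by simp
    then have L0: "0 < lp_norm p ?f" using L by linarith
    show "\<exists>f \<in> lp_space p. lp_norm p f = 1 \<and> lp_bound p (\<lambda>k. platoon_step \<zeta> f k - \<mu> *s f k) \<epsilon>"
      by (rule approximate_eigenvector_normalize[OF p f L0 b]) (use L \<epsilon> in \<open>simp add: field_simps\<close>)
  qed
qed

text \<open>C^(n+1) f - \<mu>^(n+1) f = C^n (C f - \<mu> f) + \<mu> (C^n f - \<mu>^n f), so by power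
  boundedness the error grows only linearly in n.\<close>

lemma lp_bound_approximate_eigenvector_funpow:
  assumes \<zeta>: "0 < \<zeta>" and p: "1 \<le> p" and \<mu>: "norm \<mu> = 1"
    and f: "lp_bound p (\<lambda>k. platoon_step \<zeta> f k - \<mu> *s f k) \<epsilon>"
  shows "lp_bound p (\<lambda>k. (platoon_step \<zeta> ^^ n) f k - \<mu>^n *s f k) (real n * ((platoon_step_const \<zeta>)\<^sup>2 * \<epsilon>))"
proof (induction n)
  case 0
  then show ?case using lp_bound_zero[OF p] by simp
next
  case (Suc n)
  let ?M = "(platoon_step_const \<zeta>)\<^sup>2"
  have "(\<lambda>k. (platoon_step \<zeta> ^^ Suc n) f k - \<mu>^Suc n *s f k)
    = (\<lambda>k. (platoon_step \<zeta> ^^ n) (\<lambda>k. platoon_step \<zeta> f k - \<mu> *s f k) k + \<mu> *s ((platoon_step \<zeta> ^^ n) f k - \<mu>^n *s f k))"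
    by (simp add: fun_eq_iff platoon_step_funpow_diff platoon_step_funpow_smult funpow_Suc_right
        vec_eq_iff algebra_simps del: funpow.simps)
  moreover have "lp_bound p \<dots> (?M * \<epsilon> + norm \<mu> * (real n * (?M * \<epsilon>)))"
    by (rule lp_bound_add[OF p lp_bound_platoon_step_funpow[OF \<zeta> p f] lp_bound_smult[OF p Suc]])
  ultimately show ?case using \<mu> by (simp add: distrib_right)
qed

lemma poisson_generating_sums: "(\<lambda>n. poisson_weight \<tau> n *\<^sub>R (\<mu>::complex) ^ n) sums exp (of_real \<tau> * (\<mu> - 1))"
proof -
  have "(\<lambda>n. exp (- \<tau>) *\<^sub>R ((of_real \<tau> * \<mu>) ^ n /\<^sub>R fact n)) sums (exp (- \<tau>) *\<^sub>R exp (of_real \<tau> * \<mu>))"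
    by (intro sums_scaleR_right exp_converges)
  moreover have "exp (- \<tau>) *\<^sub>R ((of_real \<tau> * \<mu>) ^ n /\<^sub>R fact n) = poisson_weight \<tau> n *\<^sub>R \<mu> ^ n" for n
    by (simp add: poisson_weight_def scaleR_conv_of_real power_mult_distrib divide_inverse mult_ac)
  moreover have "exp (- \<tau>) *\<^sub>R exp (of_real \<tau> * \<mu>) = exp (of_real \<tau> * (\<mu> - 1))"
    by (simp add: scaleR_conv_of_real exp_of_real[symmetric] exp_add[symmetric] algebra_simps del: exp_of_real)
  ultimately show ?thesis by simp
qed

text \<open>On an exact eigenvector the operator is multiplication by (\<mu> - 1) exp(\<tau>(\<mu> -
  1)), by the Poisson generating function. The errors of C^(n+1) and C^n, linear in n, average to
  the factor 2\<tau> + 1.\<close>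

lemma lp_bound_semigroup_approximate_eigenvector:
  assumes \<zeta>: "0 < \<zeta>" and p: "1 \<le> p" and \<mu>: "norm \<mu> = 1" and t: "0 \<le> t" and fl: "f \<in> lp_space p"
    and f: "lp_bound p (\<lambda>k. platoon_step \<zeta> f k - \<mu> *s f k) \<epsilon>"
  shows "lp_bound p (\<lambda>k. platoon_semigroup \<zeta> t (\<lambda>k. platoon_step \<zeta> f k - f k) k
      - ((\<mu> - 1) * exp (of_real (\<zeta> * t) * (\<mu> - 1))) *s f k)
    ((2 * (\<zeta> * t) + 1) * ((platoon_step_const \<zeta>)\<^sup>2 * \<epsilon>))"
proof -
  let ?\<tau> = "\<zeta> * t"
  let ?P = "poisson_weight ?\<tau>"
  let ?M = "(platoon_step_const \<zeta>)\<^sup>2"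
  let ?E = "exp (of_real ?\<tau> * (\<mu> - 1))"
  let ?e = "\<lambda>n k. (platoon_step \<zeta> ^^ n) f k - \<mu>^n *s f k"
  let ?d = "\<lambda>k. platoon_step \<zeta> f k - f k"
  have d: "?d \<in> lp_space p"
    by (rule lp_space_diff[OF p lp_space_I[OF lp_bound_platoon_step[OF \<zeta> p lp_bound_norm[OF fl]]] fl])
  have P: "0 \<le> ?P n" for n using \<zeta> t by (simp add: poisson_weight_nonneg)
  have "(\<lambda>n. ?P n *\<^sub>R (platoon_step \<zeta> ^^ n) ?d k - ((\<mu> - 1) * (?P n *\<^sub>R \<mu>^n)) *s f k)
      sums (platoon_semigroup \<zeta> t ?d k - ((\<mu> - 1) * ?E) *s f k)" for k
  proof (rule sums_diff)
    show "(\<lambda>n. ?P n *\<^sub>R (platoon_step \<zeta> ^^ n) ?d k) sums platoon_semigroup \<zeta> t ?d k"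
      unfolding platoon_semigroup_def step_series_def
      by (rule summable_sums[OF summable_step_series[OF \<zeta> p lp_bound_norm[OF d] poisson_weight_summable]])
    have lin: "bounded_linear (\<lambda>c. c *s f k)"
      unfolding linear_conv_bounded_linear[symmetric]
      by (rule linearI) (simp_all add: vec_eq_iff algebra_simps)
    show "(\<lambda>n. ((\<mu> - 1) * (?P n *\<^sub>R \<mu>^n)) *s f k) sums (((\<mu> - 1) * ?E) *s f k)"
      by (rule bounded_linear.sums[OF lin sums_mult[OF poisson_generating_sums]])
  qed
  moreover have "?P n *\<^sub>R (platoon_step \<zeta> ^^ n) ?d k - ((\<mu> - 1) * (?P n *\<^sub>R \<mu>^n)) *s f k
      = ?P n *\<^sub>R (?e (Suc n) k - ?e n k)" for n k
    by (simp add: platoon_step_funpow_diff funpow_Suc_right vec_eq_iff del: funpow.simps)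
      (simp add: scaleR_conv_of_real algebra_simps)
  ultimately have sums: "(\<lambda>n. ?P n *\<^sub>R (?e (Suc n) k - ?e n k)) sums (platoon_semigroup \<zeta> t ?d k - ((\<mu> - 1) * ?E) *s f k)" for k
    by simp
  have b: "lp_bound p (\<lambda>k. ?P n *\<^sub>R (?e (Suc n) k - ?e n k)) ((2 * (real n * ?P n) + ?P n) * (?M * \<epsilon>))" for n
  proof -
    have "lp_bound p (\<lambda>k. ?P n *\<^sub>R (?e (Suc n) k - ?e n k)) (\<bar>?P n\<bar> * (real (Suc n) * (?M * \<epsilon>) + real n * (?M * \<epsilon>)))"
      by (intro lp_bound_scaleR[OF p] lp_bound_diff[OF p] lp_bound_approximate_eigenvector_funpow[OF \<zeta> p \<mu> f])
    moreover have "\<bar>?P n\<bar> * (real (Suc n) * (?M * \<epsilon>) + real n * (?M * \<epsilon>)) = (2 * (real n * ?P n) + ?P n) * (?M * \<epsilon>)"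
      using P by (simp add: algebra_simps)
    ultimately show ?thesis by simp
  qed
  have bs: "(\<lambda>n. (2 * (real n * ?P n) + ?P n) * (?M * \<epsilon>)) sums ((2 * ?\<tau> + 1) * (?M * \<epsilon>))"
    by (intro sums_mult2 sums_add sums_mult poisson_mean_sums poisson_weight_sums)
  show ?thesis
    using lp_bound_suminf(2)[OF p b sums_summable[OF bs]]
    unfolding sums_unique[OF sums, symmetric] sums_unique[OF bs, symmetric] .
qed

lemma sin_ge_half:
  assumes "0 \<le> x" "x \<le> (1::real)" shows "x / 2 \<le> sin x"
proof -
  have "(\<lambda>x. sin x - x / 2) 0 \<le> (\<lambda>x. sin x - x / 2) x"
  proof (rule DERIV_nonneg_imp_nondecreasing[OF assms(1)])
    fix u assume u: "0 \<le> u" "u \<le> x"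
    have "cos (pi / 3) \<le> cos u" using u assms pi_gt3 by (intro cos_monotone_0_pi_le) auto
    then have "0 \<le> cos u - 1 / 2" by (simp add: cos_60)
    moreover have "((\<lambda>x. sin x - x / 2) has_real_derivative cos u - 1 / 2) (at u)"
      by (auto intro!: derivative_eq_intros)
    ultimately show "\<exists>y. ((\<lambda>x. sin x - x / 2) has_real_derivative y) (at u) \<and> 0 \<le> y" by blast
  qed
  then show ?thesis by simp
qed

text \<open>With \<theta> = \<tau>^(-1/2), the modulus of \<mu> - 1 is at least sin \<theta> >=
  \<theta>/2, and the exponential has modulus exp(\<tau>(cos \<theta> - 1)) >=
  exp(-\<tau>\<theta>^2/2) = exp(-1/2): the scale at which damping is still bounded below.\<close>

lemma symbol_lower_bound:
  assumes "1 \<le> \<tau>"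
  defines "\<mu> \<equiv> cis (\<tau> powr (-1/2))"
  shows "exp (-1/2) / 2 * \<tau> powr (-1/2) \<le> norm ((\<mu> - 1) * exp (of_real \<tau> * (\<mu> - 1)))"
proof -
  define \<theta> where "\<theta> = \<tau> powr (-1/2)"
  have \<theta>: "0 < \<theta>" "\<theta> \<le> 1" using assms(1) powr_mono[of "-1/2" 0 \<tau>] by (auto simp: \<theta>_def)
  have "\<tau> * \<theta>\<^sup>2 = \<tau> * \<tau> powr (-1)" using assms(1) by (simp add: \<theta>_def power2_eq_square powr_add[symmetric])
  then have \<tau>\<theta>: "\<tau> * \<theta>\<^sup>2 = 1" using assms(1) by (simp add: powr_minus)
  have "\<theta> / 2 \<le> sin \<theta>" using \<theta> by (intro sin_ge_half) auto
  also have "sin \<theta> \<le> norm (\<mu> - 1)" using abs_Im_le_cmod[of "\<mu> - 1"] by (simp add: \<mu>_def \<theta>_def)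
  finally have 1: "\<theta> / 2 \<le> norm (\<mu> - 1)" .
  have "\<bar>sin (\<theta> / 2)\<bar> \<le> \<bar>\<theta> / 2\<bar>" by (rule abs_sin_x_le_abs_x)
  then have "(sin (\<theta> / 2))\<^sup>2 \<le> (\<theta> / 2)\<^sup>2" by (simp only: abs_le_square_iff)
  moreover have "cos \<theta> = 1 - 2 * (sin (\<theta> / 2))\<^sup>2" using cos_double_sin[of "\<theta> / 2"] by simp
  ultimately have "1 - \<theta>\<^sup>2 / 2 \<le> cos \<theta>" by (simp add: power_divide)
  then have "\<tau> * (1 - \<theta>\<^sup>2 / 2) \<le> \<tau> * cos \<theta>" using assms(1) by (intro mult_left_mono) auto
  then have "- 1 / 2 \<le> \<tau> * (cos \<theta> - 1)" using \<tau>\<theta> by (simp add: right_diff_distrib)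
  then have 2: "exp (-1/2) \<le> norm (exp (of_real \<tau> * (\<mu> - 1)))"
    by (simp add: norm_exp_eq_Re \<mu>_def \<theta>_def)
  have "exp (-1/2) / 2 * \<theta> = \<theta> / 2 * exp (-1/2)" by simp
  also have "\<dots> \<le> norm (\<mu> - 1) * norm (exp (of_real \<tau> * (\<mu> - 1)))"
    using 1 2 by (intro mult_mono) auto
  finally show ?thesis unfolding \<theta>_def norm_mult .
qed

lemma semigroup_lower_bound:
  assumes \<zeta>: "0 < \<zeta>" and p: "1 \<le> p" and t: "1 \<le> \<zeta> * t"
  shows "\<exists>f. lp_bound p f 1 \<and> exp (-1/2) / 4 * (\<zeta> * t) powr (-1/2)
    \<le> lp_norm p (platoon_semigroup \<zeta> t (\<lambda>k. platoon_step \<zeta> f k - f k))"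
proof -
  let ?\<tau> = "\<zeta> * t"
  let ?M = "(platoon_step_const \<zeta>)\<^sup>2"
  define \<mu> where "\<mu> = cis (?\<tau> powr (-1/2))"
  define b where "b = exp (-1/2) / 4 * ?\<tau> powr (-1/2)"
  have "0 < ?\<tau>" using t by linarith
  then have b: "0 < b" unfolding b_def by (intro mult_pos_pos) auto
  have M: "0 < ?M" using platoon_step_const_ge_1[OF \<zeta>] by simp
  have \<tau>: "0 < 2 * ?\<tau> + 1" using t by simp
  \<comment> \<open>Chosen so that the accumulated error equals \<open>b\<close>, half of the lower
    bound 2b for the symbol; the other half survives.\<close>
  define \<epsilon> where "\<epsilon> = b / ((2 * ?\<tau> + 1) * ?M)"
  have \<epsilon>: "0 < \<epsilon>" "(2 * ?\<tau> + 1) * (?M * \<epsilon>) = b" using b M \<tau> by (simp_all add: \<epsilon>_def)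
  obtain f where f: "f \<in> lp_space p" "lp_norm p f = 1" "lp_bound p (\<lambda>k. platoon_step \<zeta> f k - \<mu> *s f k) \<epsilon>"
    using approximate_eigenvector[OF \<zeta> p \<epsilon>(1)] unfolding \<mu>_def by blast
  let ?d = "\<lambda>k. platoon_step \<zeta> f k - f k"
  let ?c = "(\<mu> - 1) * exp (of_real ?\<tau> * (\<mu> - 1))"
  have t0: "0 \<le> t" using zero_less_mult_pos[of \<zeta> t] t \<zeta> by linarith
  have T: "platoon_semigroup \<zeta> t ?d \<in> lp_space p"
    by (intro platoon_semigroup_in_lp \<zeta> p lp_space_diff lp_space_I[OF lp_bound_platoon_step[OF \<zeta> p lp_bound_norm]] f)
  have r: "lp_bound p (\<lambda>k. platoon_semigroup \<zeta> t ?d k - ?c *s f k) b"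
    using lp_bound_semigroup_approximate_eigenvector[OF \<zeta> p _ t0 f(1,3)] by (simp add: \<mu>_def \<epsilon>(2)[unfolded \<mu>_def])
  have "lp_bound p (\<lambda>k. ?c *s f k) (lp_norm p (platoon_semigroup \<zeta> t ?d) + b)"
    using lp_bound_diff[OF p lp_bound_norm[OF T] r] by simp
  moreover have c: "2 * b \<le> norm ?c"
    using symbol_lower_bound[OF t] by (simp add: b_def \<mu>_def)
  moreover have "?c \<noteq> 0" using c b by (intro notI) simp
  ultimately have "1 \<le> (lp_norm p (platoon_semigroup \<zeta> t ?d) + b) / norm ?c"
    using lp_bound_smultD[OF p] f(2) by (fastforce simp: lp_bound_def)
  then have "norm ?c \<le> lp_norm p (platoon_semigroup \<zeta> t ?d) + b"
    using \<open>?c \<noteq> 0\<close> by (simp add: le_divide_eq)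
  then show ?thesis using c f by (intro exI[of _ f]) (auto simp: b_def lp_bound_def)
qed

section \<open>Optimality of the rates\<close>

text \<open>A quantitative uniform boundedness principle (gliding hump with signs, after Sokal). The
  coefficient of \<open>f n\<close> is \<open>\<plusminus>\<rho>\<^sup>n\<close>, the sign being chosen so that the norm of \<open>Q n\<close> at the
  partial sum is at least \<open>\<rho>\<^sup>n\<close> times that of \<open>Q n (f n)\<close>; the smallness of \<open>\<rho>\<close> controls the tail.\<close>

lemma gliding_hump:
  fixes Q :: "nat \<Rightarrow> (int \<Rightarrow> 'a::banach) \<Rightarrow> int \<Rightarrow> 'b::real_normed_vector" and s :: "nat \<Rightarrow> real"
  assumes p: "1 \<le> p"
    and lin: "\<And>n x y a k. x \<in> lp_space p \<Longrightarrow> y \<in> lp_space p \<Longrightarrow> Q n (\<lambda>k. x k - a *\<^sub>R y k) k = Q n x k - a *\<^sub>R Q n y k"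
    and bound: "\<And>n x B. lp_bound p x B \<Longrightarrow> lp_bound p (Q n x) (K * s n * B)"
    and f: "\<And>n. lp_bound p (f n) 1" "\<And>n. c * s n \<le> lp_norm p (Q n (f n))"
    and s: "\<And>n. 0 \<le> s n" and \<rho>: "0 < \<rho>" "\<rho> < 1" "K * (\<rho> / (1 - \<rho>)) \<le> c / 2"
  shows "\<exists>x \<in> lp_space p. \<forall>n. c / 2 * \<rho> ^ n * s n \<le> lp_norm p (Q n x)"
proof -
  define sg :: "nat \<Rightarrow> (int \<Rightarrow> 'a) \<Rightarrow> real" where
    "sg n y = (if lp_norm p (Q n (\<lambda>k. y k - \<rho> ^ n *\<^sub>R f n k)) \<ge> lp_norm p (Q n (\<lambda>k. y k - (- (\<rho> ^ n)) *\<^sub>R f n k))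
      then 1 else - 1)" for n y
  \<comment> \<open>\<open>S n\<close> is the partial sum before the n-th hump; the sign of that
    hump depends on it, hence the recursion.\<close>
  define S where "S = rec_nat (\<lambda>k. 0) (\<lambda>n y k. y k - (sg n y * \<rho> ^ n) *\<^sub>R f n k)"
  define a where "a n = sg n (S n) * \<rho> ^ n" for n
  have S0: "S 0 = (\<lambda>k. 0)" and SS: "S (Suc n) = (\<lambda>k. S n k - a n *\<^sub>R f n k)" for n
    by (simp_all add: S_def a_def)
  have a: "\<bar>a n\<bar> = \<rho> ^ n" for n using \<rho> by (simp add: a_def sg_def)
  have fl: "f n \<in> lp_space p" for n by (rule lp_space_I[OF f(1)])
  have Sl: "S n \<in> lp_space p" for n
    by (induction n) (simp_all add: S0 SS lp_space_I[OF lp_bound_zero[OF p]] lp_space_diff lp_space_scaleR p fl)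
  have S_sum: "S n k = (\<Sum>m<n. - a m *\<^sub>R f m k)" for n k
    by (induction n) (simp_all add: S0 SS)
  have term_bound: "lp_bound p (\<lambda>k. - a m *\<^sub>R f m k) (\<rho> ^ m)" for m
    using lp_bound_scaleR[OF p f(1), of "- a m" m] by (simp add: a)
  have geo: "(\<lambda>m. \<rho> ^ m) sums (1 / (1 - \<rho>))" using \<rho> by (intro geometric_sums) simp
  define x where "x k = (\<Sum>m. - a m *\<^sub>R f m k)" for k
  note xs = lp_bound_suminf[OF p term_bound sums_summable[OF geo]]
  have x: "x \<in> lp_space p" unfolding x_def[abs_def] by (rule lp_space_I[OF xs(2)])
  have tail: "lp_bound p (\<lambda>k. S (Suc n) k - x k) (\<rho> ^ n * (\<rho> / (1 - \<rho>)))" for n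
  proof -
    have g: "(\<lambda>m. \<rho> ^ (m + Suc n)) sums (\<rho> ^ n * (\<rho> / (1 - \<rho>)))"
      using sums_mult2[OF geo, of "\<rho> ^ Suc n"] by (simp add: power_add mult_ac)
    have "lp_bound p (\<lambda>k. \<Sum>m. - a (m + Suc n) *\<^sub>R f (m + Suc n) k) (\<rho> ^ n * (\<rho> / (1 - \<rho>)))"
      using lp_bound_suminf(2)[OF p term_bound sums_summable[OF g]] by (simp only: sums_unique[OF g, symmetric])
    moreover have "(\<Sum>m. - a (m + Suc n) *\<^sub>R f (m + Suc n) k) = x k - S (Suc n) k" for k
      unfolding x_def S_sum by (rule suminf_minus_initial_segment[OF xs(1)])
    ultimately have "lp_bound p (\<lambda>k. x k - S (Suc n) k) (\<rho> ^ n * (\<rho> / (1 - \<rho>)))" by simp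
    then show ?thesis using lp_bound_cmult_dominated[OF p, of "\<lambda>k. x k - S (Suc n) k" _ 1 "\<lambda>k. S (Suc n) k - x k"]
      by (simp add: norm_minus_commute)
  qed
  have Ql: "Q n y \<in> lp_space p" if "y \<in> lp_space p" for n y
    by (rule lp_space_I[OF bound[OF lp_bound_norm[OF that]]])
  have hump: "\<rho> ^ n * (c * s n) \<le> lp_norm p (Q n (S (Suc n)))" for n
  proof -
    let ?N = "lp_norm p (Q n (S (Suc n)))"
    let ?u = "\<lambda>k. S n k - \<rho> ^ n *\<^sub>R f n k" and ?v = "\<lambda>k. S n k - (- (\<rho> ^ n)) *\<^sub>R f n k"
    have uv: "?u \<in> lp_space p" "?v \<in> lp_space p" by (intro lp_space_diff lp_space_scaleR p Sl fl)+
    have N: "lp_norm p (Q n ?u) \<le> ?N" "lp_norm p (Q n ?v) \<le> ?N"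
      by (auto simp: SS a_def sg_def)
    \<comment> \<open>The images under \<open>Q n\<close> of the two sign choices differ by 2
      \<rho>^n Q n (f n), so the larger of them has norm at least \<rho>^n times that of Q n (f
      n).\<close>
    have "lp_bound p (\<lambda>k. Q n ?v k - Q n ?u k) (?N + ?N)"
      using N by (intro lp_bound_diff[OF p] lp_bound_mono[OF lp_bound_norm[OF Ql[OF uv(2)]]]
          lp_bound_mono[OF lp_bound_norm[OF Ql[OF uv(1)]]])
    moreover have "Q n ?v k - Q n ?u k = (2 * \<rho> ^ n) *\<^sub>R Q n (f n) k" for k
      by (simp add: lin[OF Sl fl] del: scaleR_minus_left) (simp add: scaleR_left_distrib[symmetric])
    ultimately have "lp_bound p (\<lambda>k. (2 * \<rho> ^ n) *\<^sub>R Q n (f n) k) (?N + ?N)" by simp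
    from lp_bound_scaleR[OF p this, of "inverse (2 * \<rho> ^ n)"]
    have "lp_bound p (Q n (f n)) (?N / \<rho> ^ n)" using \<rho> by (simp add: field_simps)
    then have "c * s n \<le> ?N / \<rho> ^ n" using f(2)[of n] by (simp add: lp_bound_def)
    then show ?thesis using \<rho> by (simp add: field_simps)
  qed
  have "c / 2 * \<rho> ^ n * s n \<le> lp_norm p (Q n x)" for n
  proof -
    \<comment> \<open>Passing from the partial sum to \<open>x\<close> costs at most K s n times the
      norm of the tail, which the condition on \<rho> makes at most half of the hump.\<close>
    have "Q n (\<lambda>k. S (Suc n) k - 1 *\<^sub>R x k) k = Q n (S (Suc n)) k - 1 *\<^sub>R Q n x k" for k
      by (rule lin[OF Sl x])
    then have "Q n (S (Suc n)) = (\<lambda>k. Q n x k + Q n (\<lambda>k. S (Suc n) k - x k) k)" by (simp add: fun_eq_iff)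
    then have "lp_bound p (Q n (S (Suc n))) (lp_norm p (Q n x) + K * s n * (\<rho> ^ n * (\<rho> / (1 - \<rho>))))"
      using lp_bound_add[OF p lp_bound_norm[OF Ql[OF x]] bound[OF tail]] by simp
    then have "\<rho> ^ n * (c * s n) \<le> lp_norm p (Q n x) + K * s n * (\<rho> ^ n * (\<rho> / (1 - \<rho>)))"
      using hump[of n] by (simp add: lp_bound_def)
    moreover have "\<rho> ^ n * s n * (K * (\<rho> / (1 - \<rho>))) \<le> \<rho> ^ n * s n * (c / 2)"
      using \<rho> s by (intro mult_left_mono) auto
    moreover have "K * s n * (\<rho> ^ n * (\<rho> / (1 - \<rho>))) = \<rho> ^ n * s n * (K * (\<rho> / (1 - \<rho>)))"
      by (simp only: mult_ac)
    moreover have "\<rho> ^ n * (c * s n) = 2 * (\<rho> ^ n * s n * (c / 2))" "c / 2 * \<rho> ^ n * s n = \<rho> ^ n * s n * (c / 2)"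
      by simp_all
    ultimately show ?thesis by linarith
  qed
  with x show ?thesis by blast
qed

text \<open>Along suitable times t n, r is at most \<rho>^(2n) (t n)^(-1/2), while the gliding hump
  gives one orbit whose derivative there is at least a constant times \<rho>^n (t n)^(-1/2). A rate
  \<open>r\<close> would keep \<rho>^n bounded below.\<close>

lemma not_derivative_rate:
  assumes \<zeta>: "0 < \<zeta>" and p: "1 \<le> p" and r: "r \<in> o(\<lambda>t. t powr (-1/2))"
  shows "\<not> derivative_rate p \<zeta> r"
proof
  assume rate: "derivative_rate p \<zeta> r"
  define K where "K = (platoon_step_const \<zeta>)\<^sup>2"
  define c :: real where "c = exp (-1/2) / 4"
  have K: "1 \<le> K" using platoon_step_const_ge_1[OF \<zeta>] by (simp add: K_def)
  have c: "0 < c" by (simp add: c_def)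
  \<comment> \<open>The solution of K \<rho>/(1 - \<rho>) = c/2.\<close>
  define \<rho> where "\<rho> = c / (c + 2 * K)"
  have \<rho>: "0 < \<rho>" "\<rho> < 1" using c K by (auto simp: \<rho>_def)
  have "1 - \<rho> = 2 * K / (c + 2 * K)" using c K by (simp add: \<rho>_def field_simps)
  then have \<rho>3: "K * (\<rho> / (1 - \<rho>)) \<le> c / 2" using c K by (simp add: \<rho>_def)
  \<comment> \<open>Of the two factors \<rho>^n, one pays for the coefficient of the hump and the
    other drives the contradiction.\<close>
  have "\<exists>t. real n \<le> t \<and> 1 \<le> \<zeta> * t \<and> norm (r t) \<le> \<rho> ^ (2 * n) * t powr (-1/2)" for n
  proof -
    have "\<forall>\<^sub>F t in at_top. norm (r t) \<le> \<rho> ^ (2 * n) * norm (t powr (-1/2))"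
      using r \<rho> by (intro landau_o.smallD) auto
    then have "\<forall>\<^sub>F t in at_top. real n \<le> t \<and> 1 / \<zeta> \<le> t \<and> norm (r t) \<le> \<rho> ^ (2 * n) * t powr (-1/2)"
      using eventually_ge_at_top[of "real n"] eventually_ge_at_top[of "1 / \<zeta>"] by eventually_elim simp
    then obtain t where "real n \<le> t" "1 / \<zeta> \<le> t" "norm (r t) \<le> \<rho> ^ (2 * n) * t powr (-1/2)"
      by (auto simp: eventually_at_top_linorder)
    then show ?thesis using \<zeta> by (intro exI[of _ t]) (simp add: divide_le_eq mult.commute)
  qed
  then obtain t where t: "\<And>n. real n \<le> t n" "\<And>n. 1 \<le> \<zeta> * t n" "\<And>n. norm (r (t n)) \<le> \<rho> ^ (2 * n) * t n powr (-1/2)"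
    by metis
  have t0: "0 < t n" for n using zero_less_mult_pos[of \<zeta> "t n"] t(2)[of n] \<zeta> by linarith
  define s where "s n = (\<zeta> * t n) powr (-1/2)" for n
  \<comment> \<open>Written as a series and not as the semigroup after C - 1, so that linearity in
    \<open>x\<close> follows from that of the series and of the powers of \<open>C\<close>.\<close>
  define Q where "Q n = step_series \<zeta> (backward_diff (poisson_weight (\<zeta> * t n)))" for n
  have Q: "Q n x = platoon_semigroup \<zeta> (t n) (\<lambda>k. platoon_step \<zeta> x k - x k)" if "x \<in> lp_space p" for n x
    using step_series_step_diff[OF \<zeta> p that poisson_weight_summable] by (auto simp: Q_def platoon_semigroup_def)
  have sm: "summable (\<lambda>m. \<bar>backward_diff (poisson_weight (\<zeta> * t n)) m\<bar>)" for n
    by (rule summable_backward_diff[OF poisson_weight_summable])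
  have "\<forall>n. \<exists>f. lp_bound p f 1 \<and> c * s n \<le> lp_norm p (Q n f)"
    using semigroup_lower_bound[OF \<zeta> p t(2)] Q lp_space_I unfolding c_def s_def by metis
  then obtain f where f: "\<And>n. lp_bound p (f n) 1" "\<And>n. c * s n \<le> lp_norm p (Q n (f n))" by metis
  obtain x where x: "x \<in> lp_space p" and low: "\<And>n. c / 2 * \<rho> ^ n * s n \<le> lp_norm p (Q n x)"
  proof -
    have "\<exists>x \<in> lp_space p. \<forall>n. c / 2 * \<rho> ^ n * s n \<le> lp_norm p (Q n x)"
    proof (rule gliding_hump[where Q = Q and f = f and s = s, OF p _ _ f _ \<rho> \<rho>3])
      fix n a k and x y :: "int \<Rightarrow> complex^3"
      assume xy: "x \<in> lp_space p" "y \<in> lp_space p"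
      have "Q n (\<lambda>k. a *\<^sub>R y k) k = a *\<^sub>R Q n y k"
        unfolding Q_def step_series_def of_real_smult_eq_scaleR[symmetric] platoon_step_funpow_smult
        unfolding of_real_smult_eq_scaleR
        by (simp add: suminf_scaleR_right[OF summable_step_series[OF \<zeta> p lp_bound_norm[OF xy(2)] sm]] mult.commute)
      then show "Q n (\<lambda>k. x k - a *\<^sub>R y k) k = Q n x k - a *\<^sub>R Q n y k"
        using step_series_diff[OF \<zeta> p xy(1) lp_space_scaleR[OF p xy(2)] sm] by (simp add: Q_def)
    next
      fix n B and x :: "int \<Rightarrow> complex^3"
      assume B: "lp_bound p x B"
      show "lp_bound p (Q n x) (K * s n * B)"
        using lp_bound_semigroup_step_diff[OF \<zeta> p B t0[of n]] by (simp add: Q[OF lp_space_I[OF B]] K_def s_def mult_ac)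
    qed (simp add: s_def)
    then show ?thesis using that by blast
  qed
  have "(\<lambda>t. lp_norm p (platoon_op \<zeta> (platoon_semigroup \<zeta> t x))) \<in> O(r)"
    using rate[unfolded derivative_rate_def, THEN spec[of _ x], THEN spec[of _ "\<lambda>t. platoon_semigroup \<zeta> t x"],
        THEN spec[of _ "\<lambda>t. platoon_op \<zeta> (platoon_semigroup \<zeta> t x)"]]
      platoon_solution_semigroup[OF \<zeta> p x] platoon_semigroup_deriv[OF \<zeta> p x] x by simp
  then obtain C where C: "0 < C" "\<forall>\<^sub>F t in at_top. norm (lp_norm p (platoon_op \<zeta> (platoon_semigroup \<zeta> t x))) \<le> C * norm (r t)"
    by (rule landau_o.bigE)
  then obtain T where T: "\<And>t. T \<le> t \<Longrightarrow> norm (lp_norm p (platoon_op \<zeta> (platoon_semigroup \<zeta> t x))) \<le> C * norm (r t)"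
    by (auto simp: eventually_at_top_linorder)
  have main: "\<zeta> * (c / 2) \<le> C * sqrt \<zeta> * \<rho> ^ n" if n: "T \<le> real n" for n
  proof -
    have sp: "0 < s n" using t(2)[of n] by (auto simp: s_def)
    have op: "platoon_op \<zeta> (platoon_semigroup \<zeta> (t n) x) = (\<lambda>k. \<zeta> *\<^sub>R Q n x k)"
      using platoon_op_semigroup[OF \<zeta> p x] by (auto simp: Q[OF x])
    have "(\<lambda>k. \<zeta> *\<^sub>R Q n x k) \<in> lp_space p"
      unfolding op[symmetric] by (rule lp_space_I[OF lp_bound_platoon_op_semigroup[OF \<zeta> p lp_bound_norm[OF x] t0]])
    from lp_bound_scaleR[OF p lp_bound_norm[OF this], of "1 / \<zeta>"]
    have "lp_norm p (Q n x) \<le> (1 / \<zeta>) * lp_norm p (\<lambda>k. \<zeta> *\<^sub>R Q n x k)" using \<zeta> by (simp add: lp_bound_def)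
    also have "\<dots> \<le> (1 / \<zeta>) * (C * norm (r (t n)))"
      using T[of "t n"] t(1)[of n] n \<zeta> unfolding op by (intro mult_left_mono) auto
    also have "\<dots> \<le> (1 / \<zeta>) * (C * (\<rho> ^ (2 * n) * t n powr (-1/2)))"
      using C(1) \<zeta> by (intro mult_left_mono t(3)) auto
    also have "t n powr (-1/2) = sqrt \<zeta> * s n"
      using \<zeta> t0[of n] by (simp add: s_def powr_mult powr_minus powr_half_sqrt)
    finally have "c / 2 * \<rho> ^ n * s n \<le> (1 / \<zeta>) * (C * (\<rho> ^ (2 * n) * (sqrt \<zeta> * s n)))"
      by (rule order_trans[OF low])
    then have "\<zeta> * (c / 2 * \<rho> ^ n * s n) \<le> \<zeta> * ((1 / \<zeta>) * (C * (\<rho> ^ (2 * n) * (sqrt \<zeta> * s n))))"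
      using \<zeta> by (intro mult_left_mono) auto
    also have "\<dots> = (C * sqrt \<zeta> * \<rho> ^ n) * (\<rho> ^ n * s n)"
      using \<zeta> by (simp add: mult_2 power_add)
    also have "\<zeta> * (c / 2 * \<rho> ^ n * s n) = (\<zeta> * (c / 2)) * (\<rho> ^ n * s n)" by simp
    finally have "(\<zeta> * (c / 2)) * (\<rho> ^ n * s n) \<le> (C * sqrt \<zeta> * \<rho> ^ n) * (\<rho> ^ n * s n)" .
    moreover have "0 < \<rho> ^ n * s n" using \<rho> sp by simp
    ultimately show ?thesis by (simp only: mult_le_cancel_right_pos)
  qed
  have "(\<lambda>n. C * sqrt \<zeta> * \<rho> ^ n) \<longlonglongrightarrow> C * sqrt \<zeta> * 0"
    using \<rho> by (intro tendsto_mult tendsto_const LIMSEQ_power_zero) auto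
  moreover obtain N where "T \<le> real N" using real_arch_simple by blast
  moreover have "\<zeta> * (c / 2) \<le> C * sqrt \<zeta> * \<rho> ^ n" if "N \<le> n" for n
    using \<open>T \<le> real N\<close> that by (intro main) linarith
  ultimately have "\<zeta> * (c / 2) \<le> C * sqrt \<zeta> * 0"
    by (meson LIMSEQ_le_const)
  then show False using mult_pos_pos[OF \<zeta> c] by simp
qed

text \<open>The derivative is \<zeta> times the orbit of u = (C - 1) x0. The first component of
  \<open>u\<close> is (1 - S) of a bounded multiple of the second component of \<open>x0\<close>, so
  its Cesaro means telescope to O(1/n) with c = 0, and (b) at rate \<open>r\<close> applies to
  \<open>u\<close>.\<close>

lemma convergence_rate_imp_derivative_rate:
  assumes \<zeta>: "0 < \<zeta>" and p: "1 \<le> p" and rate: "convergence_rate p \<zeta> r"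
  shows "derivative_rate p \<zeta> r"
  unfolding derivative_rate_def
proof (intro allI impI)
  fix x0 x x'
  assume x0: "x0 \<in> lp_space p" and x: "platoon_solution p \<zeta> x0 x"
    and x': "\<forall>t\<ge>0. has_lp_derivative p x (x' t) t"
  let ?u = "\<lambda>k. platoon_step \<zeta> x0 k - x0 k"
  let ?T = "\<lambda>t. platoon_semigroup \<zeta> t ?u"
  have u: "?u \<in> lp_space p"
    by (rule lp_space_diff[OF p lp_space_I[OF lp_bound_platoon_step[OF \<zeta> p lp_bound_norm[OF x0]]] x0])
  have eq: "x' t = (\<lambda>k. \<zeta> *\<^sub>R ?T t k)" if "0 \<le> t" for t
  proof -
    have "has_lp_derivative p x (x' t) t" "has_lp_derivative p x (platoon_op \<zeta> (x t)) t"
      using x' x that by (auto simp: platoon_solution_def)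
    from has_lp_derivative_unique[OF p this that] show ?thesis
      using platoon_op_semigroup[OF \<zeta> p x0] by (auto simp: platoon_solution_eq_semigroup[OF \<zeta> p x0 x that])
  qed
  have "cesaro_error p (first_comp ?u) 0 \<in> O(\<lambda>n. 1 / real n)"
  proof (rule bigoI)
    let ?g = "\<lambda>k. (1 / \<zeta>) *\<^sub>R (x0 k $ 2)"
    show "\<forall>\<^sub>F n in sequentially. norm (cesaro_error p (first_comp ?u) 0 n) \<le> (2 * (\<bar>1 / \<zeta>\<bar> * lp_norm p x0)) * norm (1 / real n)"
      using eventually_gt_at_top[of 0]
    proof eventually_elim
      case (elim n)
      have "(\<lambda>k. first_comp ?u k - 0) = (\<lambda>k. ?g k - ?g (k - 1))"
        by (simp add: first_comp_def platoon_step_nth fun_eq_iff scaleR_conv_of_real right_diff_distrib diff_divide_distrib)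
      then have "cesaro_mean n (\<lambda>k. first_comp ?u k - 0) = (\<lambda>k. (1 / real n) *\<^sub>R (?g (k + - 1) - ?g (k + (- 1 - int n))))"
        by (auto simp only: cesaro_mean_telescope[of n ?g] intro!: ext) (simp add: algebra_simps)
      moreover have "lp_bound p \<dots> (\<bar>1 / real n\<bar> * (\<bar>1 / \<zeta>\<bar> * lp_norm p x0 + \<bar>1 / \<zeta>\<bar> * lp_norm p x0))"
        by (intro lp_bound_scaleR[OF p] lp_bound_diff[OF p] lp_bound_translate[OF p, of ?g]
            lp_bound_nth[OF p] lp_bound_norm x0)
      ultimately have "lp_bound p (cesaro_mean n (\<lambda>k. first_comp ?u k - 0)) (\<bar>1 / real n\<bar> * (\<bar>1 / \<zeta>\<bar> * lp_norm p x0 + \<bar>1 / \<zeta>\<bar> * lp_norm p x0))"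
        by simp
      then show ?case
        unfolding cesaro_error_eq[OF elim] by (simp add: lp_bound_def lp_norm_nonneg mult_ac)
    qed
  qed
  moreover have "(\<lambda>_. 0) \<in> lp_space p" by (rule lp_space_I[OF lp_bound_zero[OF p]])
  ultimately have "(\<lambda>t. lp_norm p (\<lambda>k. ?T t k - platoon_limit \<zeta> 0 k)) \<in> O(r)"
    using rate u platoon_solution_semigroup[OF \<zeta> p u] unfolding convergence_rate_def by blast
  moreover have "platoon_limit \<zeta> 0 k = 0" for k by (simp add: platoon_limit_def vec_eq_iff forall_3)
  ultimately have 1: "(\<lambda>t. lp_norm p (?T t)) \<in> O(r)" by simp
  have "(\<lambda>t. lp_norm p (x' t)) \<in> O(\<lambda>t. lp_norm p (?T t))"
  proof (rule bigoI)
    show "\<forall>\<^sub>F t in at_top. norm (lp_norm p (x' t)) \<le> \<zeta> * norm (lp_norm p (?T t))"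
      using eventually_ge_at_top[of 0]
    proof eventually_elim
      case (elim t)
      have T: "?T t \<in> lp_space p" by (rule platoon_semigroup_in_lp[OF \<zeta> p u])
      show ?case using lp_bound_scaleR[OF p lp_bound_norm[OF T], of \<zeta>] \<zeta>
        by (simp add: eq[OF elim] lp_bound_def lp_norm_nonneg[OF T] lp_norm_nonneg)
    qed
  qed
  then show "(\<lambda>t. lp_norm p (x' t)) \<in> O(r)" using 1 by (rule landau_o.big_trans)
qed

theorem corollary5p1:
  fixes \<zeta> :: real and p :: ereal
  assumes "\<zeta> > 0" and "1 \<le> p"
  shows "(\<forall>x0 \<in> lp_space p. (\<exists>x. platoon_solution p \<zeta> x0 x) \<and>
       (\<forall>x x'. platoon_solution p \<zeta> x0 x \<longrightarrow> platoon_solution p \<zeta> x0 x' \<longrightarrow> (\<forall>t\<ge>0. x t = x' t))) \<and>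
    (\<forall>x0 x. x0 \<in> lp_space p \<longrightarrow> platoon_solution p \<zeta> x0 x \<longrightarrow>
       ((\<exists>z. lp_converges_to p x z) \<longleftrightarrow>
        (\<exists>c. (\<lambda>_. c) \<in> lp_space p \<and> cesaro_error p (first_comp x0) c \<longlonglongrightarrow> 0)) \<and>
       (\<forall>c. (\<lambda>_. c) \<in> lp_space p \<longrightarrow> cesaro_error p (first_comp x0) c \<longlonglongrightarrow> 0 \<longrightarrow>
            lp_converges_to p x (platoon_limit \<zeta> c))) \<and>
    ((\<forall>x0 x. x0 \<in> lp_space p \<longrightarrow> platoon_solution p \<zeta> x0 x \<longrightarrow> (\<exists>z. lp_converges_to p x z))
       \<longleftrightarrow> 1 < p \<and> p < \<infinity>) \<and>
    (p < \<infinity> \<longrightarrow> (\<forall>c::complex. (\<lambda>_. c) \<in> lp_space p \<longrightarrow> c = 0)) \<and>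
    convergence_rate p \<zeta> (\<lambda>t. t powr (-1/2)) \<and>
    derivative_rate p \<zeta> (\<lambda>t. t powr (-1/2)) \<and>
    (\<forall>r. (\<forall>t\<ge>0. r t > 0) \<longrightarrow> r \<in> o(\<lambda>t. t powr (-1/2)) \<longrightarrow> \<not> convergence_rate p \<zeta> r) \<and>
    (\<forall>r. (\<forall>t\<ge>0. r t > 0) \<longrightarrow> r \<in> o(\<lambda>t. t powr (-1/2)) \<longrightarrow> \<not> derivative_rate p \<zeta> r)"
proof -
  note \<zeta>p = assms
  have conv: "(\<exists>z. lp_converges_to p x z) \<longleftrightarrow>
      (\<exists>c. (\<lambda>_. c) \<in> lp_space p \<and> cesaro_error p (first_comp x0) c \<longlonglongrightarrow> 0)"
    if x0: "x0 \<in> lp_space p" "platoon_solution p \<zeta> x0 x" for x0 x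
    using platoon_semigroup_limit_imp_cesaro[OF \<zeta>p x0(1)] platoon_semigroup_converges[OF \<zeta>p x0(1)]
    unfolding platoon_solution_converges_iff[OF \<zeta>p x0] by blast
  have lim: "lp_converges_to p x (platoon_limit \<zeta> c)"
    if x0: "x0 \<in> lp_space p" "platoon_solution p \<zeta> x0 x"
      and "(\<lambda>_. c) \<in> lp_space p" "cesaro_error p (first_comp x0) c \<longlonglongrightarrow> 0" for x0 x c
    unfolding platoon_solution_converges_iff[OF \<zeta>p x0] by (rule platoon_semigroup_converges[OF \<zeta>p x0(1) that(3,4)])
  have all: "(\<forall>x0 x. x0 \<in> lp_space p \<longrightarrow> platoon_solution p \<zeta> x0 x \<longrightarrow> (\<exists>z. lp_converges_to p x z))
      \<longleftrightarrow> 1 < p \<and> p < \<infinity>"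
  proof
    assume L: "\<forall>x0 x. x0 \<in> lp_space p \<longrightarrow> platoon_solution p \<zeta> x0 x \<longrightarrow> (\<exists>z. lp_converges_to p x z)"
    show "1 < p \<and> p < \<infinity>"
    proof (rule ccontr)
      assume "\<not> (1 < p \<and> p < \<infinity>)"
      then have "p = 1 \<or> p = \<infinity>" using assms(2) by auto
      then obtain y :: "int \<Rightarrow> complex" where y: "y \<in> lp_space p"
        and no: "\<And>c. (\<lambda>_. c) \<in> lp_space p \<Longrightarrow> \<not> cesaro_error p y c \<longlonglongrightarrow> 0"
        using exists_no_cesaro_limit by blast
      \<comment> \<open>\<open>y\<close> becomes the first component, so its lack of a Cesaro limit
        is passed on to an initial vector.\<close>
      let ?x0 = "\<lambda>k. vector [y k, 0, 0] :: complex^3"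
      have x0: "?x0 \<in> lp_space p" by (rule lp_space_I[OF lp_bound_embed_first[OF assms(2) lp_bound_norm[OF y]]])
      have "first_comp ?x0 = y" by (simp add: first_comp_def)
      then show False
        using L x0 platoon_solution_semigroup[OF \<zeta>p x0] conv[OF x0 platoon_solution_semigroup[OF \<zeta>p x0]] no by metis
    qed
  next
    assume R: "1 < p \<and> p < \<infinity>"
    have z: "(\<lambda>_. 0) \<in> lp_space p" by (rule lp_space_I[OF lp_bound_zero[OF assms(2)]])
    have "\<exists>z. lp_converges_to p x z" if "x0 \<in> lp_space p" "platoon_solution p \<zeta> x0 x" for x0 x
      using conv[OF that] cesaro_tendsto_zero[of p, OF _ _ first_comp_in_lp[OF assms(2) that(1)]] R z by auto
    then show "\<forall>x0 x. x0 \<in> lp_space p \<longrightarrow> platoon_solution p \<zeta> x0 x \<longrightarrow> (\<exists>z. lp_converges_to p x z)" by blast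
  qed
  show ?thesis
  proof (intro conjI ballI allI impI conv all)
    fix x0 :: "int \<Rightarrow> complex^3" assume "x0 \<in> lp_space p"
    then show "\<exists>x. platoon_solution p \<zeta> x0 x" using platoon_solution_semigroup[OF \<zeta>p] by blast
  next
    fix x0 x x' t assume "platoon_solution p \<zeta> x0 x" "platoon_solution p \<zeta> x0 x'" "0 \<le> (t::real)"
    then show "x t = x' t" by (rule platoon_solution_unique[OF \<zeta>p])
  next
    fix x0 x c assume "x0 \<in> lp_space p" "platoon_solution p \<zeta> x0 x" "(\<lambda>_. c) \<in> lp_space p"
      "cesaro_error p (first_comp x0) c \<longlonglongrightarrow> 0"
    then show "lp_converges_to p x (platoon_limit \<zeta> c)" by (rule lim)
  next
    fix c :: complex assume "p < \<infinity>" "(\<lambda>_. c) \<in> lp_space p"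
    then show "c = 0" using lp_const_zero[OF assms(2)] by auto
  next
    show "convergence_rate p \<zeta> (\<lambda>t. t powr (-1/2))" by (rule convergence_rate_sqrt[OF \<zeta>p])
    show "derivative_rate p \<zeta> (\<lambda>t. t powr (-1/2))" by (rule derivative_rate_sqrt[OF \<zeta>p])
  next
    fix r :: "real \<Rightarrow> real" assume "r \<in> o(\<lambda>t. t powr (-1/2))"
    then show "\<not> derivative_rate p \<zeta> r" "\<not> convergence_rate p \<zeta> r"
      using not_derivative_rate[OF \<zeta>p] convergence_rate_imp_derivative_rate[OF \<zeta>p] by blast+
  qed assumption+
qed

end
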